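(* Let $G:(0,\infty)\times S^{n-1}\to(0,\infty)$ be continuous and such that $G_t=\partial G/\partial t$ is continuous and negative on $(0,\infty)\times S^{n-1}$, and suppose that $G_t(t,u)=G_t(t,-u)$ for $(t,u)\in(0,\infty)\times S^{n-1}$. Let $0<\varepsilon_0<1$ and suppose that for every $v\in S^{n-1}$, $$\lim_{t\to0+}\int_{\Sigma_{\varepsilon_0}(v)}G(t,u)\,du=\infty,$$ where $\Sigma_{\varepsilon_0}(v)=\{u\in S^{n-1}:\langle u,v\rangle\ge\varepsilon_0\}$. Suppose that $\psi:(0,\infty)\to(0,\infty)$ is continuous, that $\int_1^\infty\frac{\psi(s)}{s}\,ds=\infty$, and that $\varphi(t)=\int_0^t\frac{\psi(s)}{s}\,ds$ is finite for all $t>0$. Let $\mu$ be a finite Borel measure on $S^{n-1}$. Then the following are equivalent: (i) $\mu$ is even and is not concentrated on any closed hemisphere. (ii) There exist an origin-symmetric $K\in\mathcal{K}_{(o)}^n$ and $\tau<0$ such that $$\mu=\tau\,\widetilde{C}_{G,\psi}(K,\cdot),\quad\text{where}\quad \tau=\frac{\mu(S^{n-1})}{\widetilde{C}_{G,\psi}(K,S^{n-1})}.$$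
   Context: Let $n\ge2$, let $o$ be the origin of $\mathbb{R}^n$ and $S^{n-1}$ the unit sphere; $du$ denotes integration with respect to $(n-1)$-dimensional Hausdorff measure $\mathcal{H}^{n-1}$. $\mathcal{K}_{(o)}^n$ is the class of compact convex subsets of $\mathbb{R}^n$ containing $o$ in their interiors; $K$ is origin symmetric if $K=-K$. A Borel measure $\mu$ on $S^{n-1}$ is even if $\mu(E)=\mu(-E)$ for all Borel $E$. A finite Borel measure $\mu$ on $S^{n-1}$ is not concentrated on any closed hemisphere if $\int_{S^{n-1}}\langle u,v\rangle_+\,d\mu(u)>0$ for all $v\in S^{n-1}$, where $a_+=\max\{a,0\}$. For $K\in\mathcal{K}_{(o)}^n$ and $u\in S^{n-1}$, $h_K(u)=\max\{\langle u,x\rangle:x\in K\}$ and $\rho_K(u)=\max\{\lambda\ge0:\lambda u\in K\}$. For $K\in\mathcal{K}_{(o)}^n$ and a Borel set $E\subset S^{n-1}$, let $\boldsymbol{\alpha}_K^*(E)$ be the set of $u\in S^{n-1}$ such that some $v\in E$ is an outer unit normal vector of $K$ at the boundary point $\rho_K(u)u$, i.e. $\langle v,\rho_K(u)u\rangle=h_K(v)$. For $\mathcal{H}^{n-1}$-almost all $u\in S^{n-1}$ there is exactly one outer unit normal vector of $K$ at $\rho_K(u)u$, denoted by $\alpha_K(u)$. The general dual Orlicz curvature measure is the finite signed Borel measure $$\widetilde{C}_{G,\psi}(K,E)=\frac1n\int_{\boldsymbol{\alpha}_K^*(E)}\frac{\rho_K(u)\,G_t(\rho_K(u),u)}{\psi(h_K(\alpha_K(u)))}\,du,\qquad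 E\subset S^{n-1}\text{ Borel}.$$ *)

theory Defs
  imports "HOL-Analysis.Analysis"
begin

section \<open>Hausdorff measure\<close>

text \<open>
  \<^term>\<open>diameter\<close> is unspecified for unbounded sets, so boundedness of the covering sets is required
  explicitly; the clause for the empty set matters only for \<open>d = 0\<close>. The factor
  \<^term>\<open>unit_ball_vol (real d) * (r / 2) ^ d\<close>, the volume of a \<open>d\<close>-ball of diameter \<open>r\<close>, is the
  usual normalisation of \<open>\<H>\<^sup>d\<close>, so that \<open>\<H>\<^sup>d\<close> is the usual surface area on \<open>d\<close>-dimensional
  surfaces.
\<close>

definition hausdorff_gauge :: "nat \<Rightarrow> 'a::metric_space set \<Rightarrow> ennreal" where
  "hausdorff_gauge d U =
     (if U = {} then 0 else ennreal (unit_ball_vol (real d) * (diameter U / 2) ^ d))"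

definition hausdorff_pre_measure :: "nat \<Rightarrow> real \<Rightarrow> 'a::metric_space set \<Rightarrow> ennreal" where
  "hausdorff_pre_measure d \<delta> A =
     (INF U \<in> {U :: nat \<Rightarrow> 'a set. (\<forall>i. bounded (U i) \<and> diameter (U i) \<le> \<delta>) \<and> A \<subseteq> (\<Union>i. U i)}.
        \<Sum>i. hausdorff_gauge d (U i))"

definition hausdorff_outer_measure :: "nat \<Rightarrow> 'a::metric_space set \<Rightarrow> ennreal" where
  "hausdorff_outer_measure d A = (SUP \<delta> \<in> {0<..}. hausdorff_pre_measure d \<delta> A)"

text \<open>\<open>\<H>\<^sup>d\<close> on the sigma-algebra of all its Caratheodory-measurable sets.\<close>

definition hausdorff_measure :: "nat \<Rightarrow> 'a::metric_space measure" where
  "hausdorff_measure d =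
     measure_of UNIV (lambda_system UNIV (Pow UNIV) (hausdorff_outer_measure d))
       (hausdorff_outer_measure d)"

lemma outer_measure_space_hausdorff_pre_measure:
  "outer_measure_space (Pow UNIV) (hausdorff_pre_measure d \<delta> :: 'a::metric_space set \<Rightarrow> ennreal)"
    if "0 < \<delta>"
proof -
  define f :: "'a set \<Rightarrow> ennreal" where
    "f = (\<lambda>U. if bounded U \<and> diameter U \<le> \<delta> then hausdorff_gauge d U else \<infinity>)"
  interpret ring_of_sets UNIV "Pow UNIV :: 'a set set"
    by (rule ring_of_sets_Pow)
  have pos: "positive (Pow UNIV) f"
    using that by (simp add: positive_def f_def hausdorff_gauge_def)
  have inc: "increasing (Pow UNIV) f"
  proof (simp add: increasing_def, intro allI impI)
    fix U V :: "'a set" assume "U \<subseteq> V"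
    show "f U \<le> f V"
    proof (cases "bounded V \<and> diameter V \<le> \<delta>")
      case True
      have "diameter U \<le> diameter V" "bounded U"
        using \<open>U \<subseteq> V\<close> True by (auto intro: diameter_subset bounded_subset)
      moreover have "hausdorff_gauge d U \<le> hausdorff_gauge d V"
        using \<open>U \<subseteq> V\<close> calculation
        by (auto simp: hausdorff_gauge_def diameter_ge_0
            intro!: ennreal_leI mult_left_mono power_mono divide_right_mono less_imp_le[OF unit_ball_vol_pos])
      ultimately show ?thesis using True by (auto simp: f_def)
    qed (auto simp: f_def)
  qed
  have "hausdorff_pre_measure d \<delta> A = outer_measure (Pow UNIV) f A" for A :: "'a set"
  proof (rule antisym)
    show "outer_measure (Pow UNIV) f A \<le> hausdorff_pre_measure d \<delta> A"
      unfolding hausdorff_pre_measure_def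
    proof (rule INF_greatest)
      fix U :: "nat \<Rightarrow> 'a set"
      assume U: "U \<in> {U. (\<forall>i. bounded (U i) \<and> diameter (U i) \<le> \<delta>) \<and> A \<subseteq> (\<Union>i. U i)}"
      then have "outer_measure (Pow UNIV) f A \<le> (\<Sum>i. f (U i))"
        by (intro outer_measure_le[OF pos inc]) auto
      also have "\<dots> = (\<Sum>i. hausdorff_gauge d (U i))"
        using U by (simp add: f_def)
      finally show "outer_measure (Pow UNIV) f A \<le> (\<Sum>i. hausdorff_gauge d (U i))" .
    qed
    show "hausdorff_pre_measure d \<delta> A \<le> outer_measure (Pow UNIV) f A"
      unfolding outer_measure_def
    proof (rule INF_greatest)
      fix U :: "nat \<Rightarrow> 'a set"
      assume U: "U \<in> {U. range U \<subseteq> Pow UNIV \<and> disjoint_family U \<and> A \<subseteq> (\<Union>i. U i)}"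
      show "hausdorff_pre_measure d \<delta> A \<le> (\<Sum>i. f (U i))"
      proof (cases "\<forall>i. bounded (U i) \<and> diameter (U i) \<le> \<delta>")
        case True
        then show ?thesis
          unfolding hausdorff_pre_measure_def
          using U by (intro INF_lower2[of U]) (auto simp: f_def)
      next
        case False
        then obtain i where "\<not> (bounded (U i) \<and> diameter (U i) \<le> \<delta>)" by blast
        then have "f (U i) = \<infinity>" unfolding f_def by (rule if_not_P)
        moreover have "f (U i) \<le> (\<Sum>i. f (U i))"
          using sum_le_suminf[of "\<lambda>i. f (U i)" "{i}"] by simp
        ultimately show ?thesis by (simp add: top_unique)
      qed
    qed
  qed
  then have "hausdorff_pre_measure d \<delta> = outer_measure (Pow UNIV) f" ..
  with outer_measure_space_outer_measure[OF pos inc] show ?thesis by simp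
qed

lemma outer_measure_space_hausdorff_outer_measure:
  "outer_measure_space (Pow UNIV) (hausdorff_outer_measure d :: 'a::metric_space set \<Rightarrow> ennreal)"
proof -
  note pre = outer_measure_space_hausdorff_pre_measure[unfolded outer_measure_space_def
      positive_def increasing_def countably_subadditive_def, where 'a='a and d=d]
  have "hausdorff_outer_measure d (\<Union>i. A i) \<le> (\<Sum>i. hausdorff_outer_measure d (A i))"
    if "disjoint_family A" for A :: "nat \<Rightarrow> 'a set"
    unfolding hausdorff_outer_measure_def
  proof (rule SUP_least)
    fix \<delta> :: real assume \<delta>: "\<delta> \<in> {0<..}"
    then have "hausdorff_pre_measure d \<delta> (\<Union>i. A i) \<le> (\<Sum>i. hausdorff_pre_measure d \<delta> (A i))"
      using pre[of \<delta>] that by auto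
    also have "\<dots> \<le> (\<Sum>i. SUP \<delta>\<in>{0<..}. hausdorff_pre_measure d \<delta> (A i))"
      using \<delta> by (intro suminf_le SUP_upper) auto
    finally show "hausdorff_pre_measure d \<delta> (\<Union>i. A i)
        \<le> (\<Sum>i. SUP \<delta>\<in>{0<..}. hausdorff_pre_measure d \<delta> (A i))" .
  qed
  moreover have "hausdorff_outer_measure d ({} :: 'a set) = 0"
    using pre by (simp add: hausdorff_outer_measure_def)
  moreover have "hausdorff_outer_measure d A \<le> hausdorff_outer_measure d B" if "A \<subseteq> B" for A B :: "'a set"
    using pre that unfolding hausdorff_outer_measure_def by (intro SUP_mono) auto
  ultimately show ?thesis
    by (auto simp: outer_measure_space_def positive_def increasing_def countably_subadditive_def)
qed

lemma measure_space_hausdorff: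
  "measure_space UNIV (lambda_system UNIV (Pow UNIV) (hausdorff_outer_measure d))
     (hausdorff_outer_measure d :: 'a::metric_space set \<Rightarrow> ennreal)"
  using sigma_algebra.caratheodory_lemma[OF sigma_algebra_Pow
      outer_measure_space_hausdorff_outer_measure] .

lemma space_hausdorff_measure [simp]: "space (hausdorff_measure d) = UNIV"
  unfolding hausdorff_measure_def by (rule space_measure_of) simp

lemma sets_hausdorff_measure:
  "sets (hausdorff_measure d) = lambda_system UNIV (Pow UNIV) (hausdorff_outer_measure d)"
  unfolding hausdorff_measure_def
  using measure_space_hausdorff[of d] unfolding measure_space_def
  by (intro sigma_algebra.sets_measure_of_eq) (elim conjE)

lemma emeasure_hausdorff_measure:
  assumes "A \<in> sets (hausdorff_measure d)"
  shows "emeasure (hausdorff_measure d) A = hausdorff_outer_measure d A"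
  unfolding hausdorff_measure_def
  using measure_space_hausdorff[of d] assms unfolding measure_space_def sets_hausdorff_measure
  by (elim conjE, intro emeasure_measure_of_sigma)

abbreviation unit_sphere :: "'a::euclidean_space set" where
  "unit_sphere \<equiv> sphere 0 1"

text \<open>The measure \<open>du\<close>. It is complete, which is convenient because \<open>reverse_radial_gauss\<close> below need
  not map Borel sets to Borel sets, but does so up to null sets.\<close>

definition sphere_measure :: "'a::euclidean_space measure" where
  "sphere_measure = restrict_space (hausdorff_measure (DIM('a) - 1)) unit_sphere"


section \<open>Convex bodies\<close>

definition convex_body_o :: "'a::euclidean_space set \<Rightarrow> bool" where
  "convex_body_o K \<longleftrightarrow> compact K \<and> convex K \<and> 0 \<in> interior K"

definition origin_symmetric :: "'a::euclidean_space set \<Rightarrow> bool" where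
  "origin_symmetric K \<longleftrightarrow> K = uminus ` K"

definition support_fun :: "'a::euclidean_space set \<Rightarrow> 'a \<Rightarrow> real" where
  "support_fun K u = (SUP x\<in>K. u \<bullet> x)"

definition radial_fun :: "'a::euclidean_space set \<Rightarrow> 'a \<Rightarrow> real" where
  "radial_fun K u = Sup {r. 0 \<le> r \<and> r *\<^sub>R u \<in> K}"

definition outer_normal_at :: "'a::euclidean_space set \<Rightarrow> 'a \<Rightarrow> 'a \<Rightarrow> bool" where
  "outer_normal_at K u v \<longleftrightarrow>
     v \<in> unit_sphere \<and> v \<bullet> (radial_fun K u *\<^sub>R u) = support_fun K v"

definition reverse_radial_gauss :: "'a::euclidean_space set \<Rightarrow> 'a set \<Rightarrow> 'a set" where
  "reverse_radial_gauss K E = {u \<in> unit_sphere. \<exists>v\<in>E. outer_normal_at K u v}"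

text \<open>Meaningful only for the almost all \<open>u\<close> at which the outer unit normal is unique; elsewhere
  its value is irrelevant.\<close>

definition radial_gauss :: "'a::euclidean_space set \<Rightarrow> 'a \<Rightarrow> 'a" where
  "radial_gauss K u = (THE v. outer_normal_at K u v)"


section \<open>The general dual Orlicz curvature measure\<close>

definition partial_t :: "(real \<Rightarrow> 'a \<Rightarrow> real) \<Rightarrow> real \<Rightarrow> 'a \<Rightarrow> real" where
  "partial_t G t u = deriv (\<lambda>s. G s u) t"

definition dual_orlicz_curvature ::
    "(real \<Rightarrow> 'a::euclidean_space \<Rightarrow> real) \<Rightarrow> (real \<Rightarrow> real) \<Rightarrow> 'a set \<Rightarrow> 'a set \<Rightarrow> real" where
  "dual_orlicz_curvature G \<psi> K E =
     1 / real DIM('a) *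
     (LINT u : reverse_radial_gauss K E | sphere_measure.
        radial_fun K u * partial_t G (radial_fun K u) u / \<psi> (support_fun K (radial_gauss K u)))"


section \<open>Borel measures on the sphere\<close>

definition finite_borel_on_sphere :: "'a::euclidean_space measure \<Rightarrow> bool" where
  "finite_borel_on_sphere \<mu> \<longleftrightarrow>
     sets \<mu> = sets (restrict_space borel unit_sphere) \<and> finite_measure \<mu>"

definition even_measure :: "'a::euclidean_space measure \<Rightarrow> bool" where
  "even_measure \<mu> \<longleftrightarrow> (\<forall>E\<in>sets \<mu>. measure \<mu> E = measure \<mu> (uminus ` E))"

definition not_concentrated_on_closed_hemisphere :: "'a::euclidean_space measure \<Rightarrow> bool" where
  "not_concentrated_on_closed_hemisphere \<mu> \<longleftrightarrow>
     (\<forall>v\<in>unit_sphere. (LINT u|\<mu>. max (u \<bullet> v) 0) > 0)"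

definition cap :: "real \<Rightarrow> 'a::euclidean_space \<Rightarrow> 'a set" where
  "cap \<epsilon> v = {u \<in> unit_sphere. u \<bullet> v \<ge> \<epsilon>}"

end

theory Submission
  imports Defs "HOL-Complex_Analysis.Great_Picard"
begin

text \<open>
  The equivalence is the Euler-Lagrange equation of a constrained minimisation problem. Put
  \<open>\<phi>(t) = \<integral>\<^sub>0\<^sup>t \<psi>(s)/s ds\<close> and, for an even continuous function \<open>f > 0\<close> on the sphere, let \<open>[f]\<close> be its
  Wulff shape, the set of all \<open>x\<close> with \<open>\<langle>x,v\<rangle> \<le> f(v)\<close> for every unit vector \<open>v\<close>. One minimises the
  energy \<open>\<integral> \<phi>(f) d\<mu>\<close> among all \<open>f\<close> whose dual volume \<open>\<integral> G(\<rho>\<^bsub>[f]\<^esub>(u),u) du\<close> does not exceed that of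
  the unit ball. Passing from \<open>f\<close> to the support function of \<open>[f]\<close> does not change the dual volume and does
  not increase the energy, so there is a minimiser that is the support function \<open>h\<close> of a symmetric
  body \<open>K\<close>.

  It is convenient to work with \<open>a = 1/f\<close>: then \<open>1/\<rho>\<^bsub>[f]\<^esub>(u)\<close> is the maximum over \<open>v\<close> of
  \<open>a(v)\<langle>u,v\<rangle>\<close>, and at \<open>a = 1/h\<close> the maximum is attained exactly at the outer unit normals of \<open>K\<close>
  in direction \<open>u\<close>.
  Perturbing \<open>1/h\<close> to \<open>(1 + tg)/h\<close> changes a maximum with a unique maximiser \<open>v\<close> at the relative rate
  \<open>g(v)\<close> (\<open>polar_gauge_variation\<close>). Hence the dual volume has the derivative
  \<open>-\<integral> \<rho>(u) G\<^sub>t(\<rho>(u),u) g(\<alpha>(u)) du\<close>, and the energy has the derivative \<open>-\<integral> \<psi>(h) g d\<mu>\<close>. No even \<open>g\<close>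
  decreases both, so the two functionals are proportional with a negative factor
  (\<open>minimal_body_multiplier\<close>). With \<open>g/\<psi>(h)\<close> in place of \<open>g\<close> this is the equality of \<open>\<mu>\<close> with a
  multiple of the curvature measure (\<open>minimal_body_curvature\<close>).

  A minimiser exists (\<open>minimal_body_exists\<close>) because \<open>\<mu>\<close> gives a certain minimal mass to a
  cap of fixed size around every direction, which turns a bound on the energy into a bound on the
  bodies. A subsequence of the support functions of a minimising sequence converges uniformly. If the
  limit vanished at some \<open>v\<close>, then the radial functions would tend to \<open>0\<close> uniformly on the cap
  \<open>\<Sigma>(v)\<close>, and the blow-up of the integrals of \<open>G\<close> over that cap would violate the constraint.

  Conversely, a multiple of the curvature measure of a symmetric body is even by reflection, and it
  charges the open hemisphere around \<open>v\<close> because the normals of \<open>K\<close> in directions close to \<open>v\<close>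
  lie in it (\<open>dual_orlicz_curvature_open_hemisphere_neg\<close>).

  All of this needs the outer normal to be unique in almost every direction. A linear functional has
  a unique maximiser on a given compact set unless it belongs to a Lebesgue null set
  (\<open>negligible_nonunique_maximizer\<close>), and null cones meet the sphere in null sets of the Hausdorff measure
  by an Eilenberg-type covering argument (\<open>hausdorff_null_if_cone_negligible\<close>).
\<close>

section \<open>Hausdorff measure as a metric outer measure\<close>

lemma hausdorff_outer_measure_mono:
  "A \<subseteq> B \<Longrightarrow> hausdorff_outer_measure d A \<le> hausdorff_outer_measure d (B :: 'a::metric_space set)"
  using outer_measure_space_hausdorff_outer_measure[of d, where 'a='a]
  by (simp add: outer_measure_space_def increasing_def)

lemma hausdorff_outer_measure_empty [simp]:
  "hausdorff_outer_measure d ({} :: 'a::metric_space set) = 0"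
  using outer_measure_space_hausdorff_outer_measure[of d, where 'a='a]
  by (simp add: outer_measure_space_def positive_def)

lemma hausdorff_outer_measure_UN_le:
  fixes A :: "nat \<Rightarrow> 'a::metric_space set"
  shows "hausdorff_outer_measure d (\<Union>i. A i) \<le> (\<Sum>i. hausdorff_outer_measure d (A i))"
proof -
  have "hausdorff_outer_measure d (\<Union>i. A i) = hausdorff_outer_measure d (\<Union>i. disjointed A i)"
    by (simp add: UN_disjointed_eq)
  also have "\<dots> \<le> (\<Sum>i. hausdorff_outer_measure d (disjointed A i))"
    using outer_measure_space_hausdorff_outer_measure[of d, where 'a='a]
      disjoint_family_disjointed[of A]
    by (simp add: outer_measure_space_def countably_subadditive_def)
  also have "\<dots> \<le> (\<Sum>i. hausdorff_outer_measure d (A i))"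
    by (intro suminf_le hausdorff_outer_measure_mono disjointed_subset) auto
  finally show ?thesis .
qed

lemma hausdorff_outer_measure_Un_le:
  fixes A B :: "'a::metric_space set"
  shows "hausdorff_outer_measure d (A \<union> B) \<le> hausdorff_outer_measure d A + hausdorff_outer_measure d B"
proof -
  have "hausdorff_outer_measure d (\<Union>i. binaryset A B i)
      \<le> (\<Sum>i. hausdorff_outer_measure d (binaryset A B i))"
    by (rule hausdorff_outer_measure_UN_le)
  moreover have "(\<Sum>i. hausdorff_outer_measure d (binaryset A B i))
      = hausdorff_outer_measure d A + hausdorff_outer_measure d B"
    by (rule suminf_binaryset_eq) simp
  ultimately show ?thesis by (simp add: UN_binaryset_eq)
qed

lemma hausdorff_pre_measure_le_outer:
  "0 < \<delta> \<Longrightarrow> hausdorff_pre_measure d \<delta> A \<le> hausdorff_outer_measure d A"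
  unfolding hausdorff_outer_measure_def by (intro SUP_upper) auto

lemma hausdorff_pre_measure_antimono:
  "\<delta> \<le> \<delta>' \<Longrightarrow> hausdorff_pre_measure d \<delta>' A \<le> hausdorff_pre_measure d \<delta> A"
  unfolding hausdorff_pre_measure_def by (intro INF_superset_mono) (auto intro: order_trans)

lemma hausdorff_pre_measure_le_cover:
  assumes "\<And>i. bounded (U i)" "\<And>i. diameter (U i) \<le> \<delta>" "A \<subseteq> (\<Union>i. U i)"
  shows "hausdorff_pre_measure d \<delta> A \<le> (\<Sum>i. hausdorff_gauge d (U i))"
  unfolding hausdorff_pre_measure_def using assms by (intro INF_lower) auto

text \<open>
  A set of diameter at most \<open>\<delta>\<close> cannot meet two sets that are more than \<open>\<delta>\<close> apart, so a cover of the
  union splits into a cover of each of them.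
\<close>

lemma hausdorff_pre_measure_separated:
  fixes A B :: "'a::metric_space set"
  assumes sep: "\<And>x y. x \<in> A \<Longrightarrow> y \<in> B \<Longrightarrow> \<delta> < dist x y" and "0 \<le> \<delta>"
  shows "hausdorff_pre_measure d \<delta> A + hausdorff_pre_measure d \<delta> B \<le> hausdorff_pre_measure d \<delta> (A \<union> B)"
  unfolding hausdorff_pre_measure_def[of d \<delta> "A \<union> B"]
proof (rule INF_greatest)
  fix U :: "nat \<Rightarrow> 'a set"
  assume U: "U \<in> {U. (\<forall>i. bounded (U i) \<and> diameter (U i) \<le> \<delta>) \<and> A \<union> B \<subseteq> (\<Union>i. U i)}"
  define V where "V C i = (if U i \<inter> C = {} then {} else U i)" for C i
  have V: "bounded (V C i)" "diameter (V C i) \<le> \<delta>" for C i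
    using U \<open>0 \<le> \<delta>\<close> by (auto simp: V_def)
  have cov: "A \<subseteq> (\<Union>i. V A i)" "B \<subseteq> (\<Union>i. V B i)"
    using U by (fastforce simp: V_def)+
  have "V A i = {} \<or> V B i = {}" for i
  proof (rule ccontr)
    assume "\<not> ?thesis"
    then obtain x y where xy: "x \<in> U i" "x \<in> A" "y \<in> U i" "y \<in> B"
      by (auto simp: V_def split: if_splits)
    then have "dist x y \<le> diameter (U i)" using U by (intro diameter_bounded_bound) auto
    also have "\<dots> \<le> \<delta>" using U by auto
    finally show False using sep[OF xy(2,4)] by simp
  qed
  moreover have "V C i = {} \<or> V C i = U i" for C i by (simp add: V_def)
  moreover have "hausdorff_gauge d ({} :: 'a set) = 0" by (simp add: hausdorff_gauge_def)
  ultimately have le: "hausdorff_gauge d (V A i) + hausdorff_gauge d (V B i) \<le> hausdorff_gauge d (U i)" for i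
    by (metis add.left_neutral add.right_neutral order_refl zero_le)
  have "hausdorff_pre_measure d \<delta> A + hausdorff_pre_measure d \<delta> B
      \<le> (\<Sum>i. hausdorff_gauge d (V A i)) + (\<Sum>i. hausdorff_gauge d (V B i))"
    by (intro add_mono hausdorff_pre_measure_le_cover V cov)
  also have "\<dots> = (\<Sum>i. hausdorff_gauge d (V A i) + hausdorff_gauge d (V B i))"
    by (simp add: suminf_add)
  also have "\<dots> \<le> (\<Sum>i. hausdorff_gauge d (U i))" by (intro suminf_le le) auto
  finally show "hausdorff_pre_measure d \<delta> A + hausdorff_pre_measure d \<delta> B
      \<le> (\<Sum>i. hausdorff_gauge d (U i))" .
qed

lemma hausdorff_outer_measure_separated:
  fixes A B :: "'a::metric_space set"
  assumes sep: "\<And>x y. x \<in> A \<Longrightarrow> y \<in> B \<Longrightarrow> r \<le> dist x y" and "0 < r"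
  shows "hausdorff_outer_measure d A + hausdorff_outer_measure d B \<le> hausdorff_outer_measure d (A \<union> B)"
proof -
  have *: "hausdorff_pre_measure d \<delta> A + hausdorff_pre_measure d \<delta>' B \<le> hausdorff_outer_measure d (A \<union> B)"
    if "0 < \<delta>" "0 < \<delta>'" for \<delta> \<delta>'
  proof -
    define e where "e = min (r/2) (min \<delta> \<delta>')"
    have e: "0 < e" "e < r" "e \<le> \<delta>" "e \<le> \<delta>'" using that \<open>0 < r\<close> by (auto simp: e_def)
    have "hausdorff_pre_measure d \<delta> A + hausdorff_pre_measure d \<delta>' B
        \<le> hausdorff_pre_measure d e A + hausdorff_pre_measure d e B"
      using e by (intro add_mono hausdorff_pre_measure_antimono) auto
    also have "\<dots> \<le> hausdorff_pre_measure d e (A \<union> B)"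
      using e by (intro hausdorff_pre_measure_separated less_le_trans[OF _ sep]) auto
    also have "\<dots> \<le> hausdorff_outer_measure d (A \<union> B)"
      using e by (intro hausdorff_pre_measure_le_outer)
    finally show ?thesis .
  qed
  have ne: "{0<..} \<noteq> ({}::real set)" by auto
  have "hausdorff_outer_measure d A + hausdorff_pre_measure d \<delta>' B \<le> hausdorff_outer_measure d (A \<union> B)"
    if "0 < \<delta>'" for \<delta>'
    unfolding hausdorff_outer_measure_def[of d A] ennreal_SUP_add_left[OF ne, symmetric]
    using that by (intro SUP_least *) auto
  then show ?thesis
    unfolding hausdorff_outer_measure_def[of d B]
    by (subst ennreal_SUP_add_right[OF ne]) (auto intro: SUP_least)
qed

text \<open>
  Caratheodory's criterion, by the annulus argument: the part \<open>B k\<close> of \<open>A\<close> at distance at least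
  \<open>1/(k+1)\<close> from \<open>F\<close> is separated from \<open>A \<inter> F\<close>, and what \<open>B k\<close> misses in \<open>A - F\<close> is covered by the
  annuli \<open>R j\<close> with \<open>j \<ge> k\<close>. Every second annulus is separated from the next one, so their
  measures have a finite sum and the tails vanish.
\<close>

lemma closed_in_sets_hausdorff:
  fixes F :: "'a::metric_space set"
  assumes "closed F"
  shows "F \<in> sets (hausdorff_measure d)"
proof -
  let ?H = "hausdorff_outer_measure d"
  have main: "?H (A \<inter> F) + ?H (A - F) \<le> ?H A" if fin: "?H A < \<infinity>" and "F \<noteq> {}" for A :: "'a set"
  proof -
    define B where "B k = {x \<in> A. 1 / real (Suc k) \<le> infdist x F}" for k
    define R where "R k = {x \<in> A. 1 / real (Suc (Suc k)) \<le> infdist x F \<and> infdist x F < 1 / real (Suc k)}" for k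
    have sepR: "?H (R i \<union> X) \<ge> ?H (R i) + ?H X" if X: "X \<subseteq> (\<Union>j\<in>{i+2..}. R j)" for i X
    proof (rule hausdorff_outer_measure_separated)
      let ?r = "1 / real (Suc (Suc i)) - 1 / real (Suc (Suc (Suc i)))"
      show "0 < ?r" by (simp add: frac_less2)
      fix x y assume x: "x \<in> R i" and "y \<in> X"
      then obtain j where j: "j \<ge> i + 2" "y \<in> R j" using X by fastforce
      have "infdist y F < 1 / real (Suc j)" using j by (simp add: R_def)
      also have "\<dots> \<le> 1 / real (Suc (Suc (Suc i)))" using j by (intro divide_left_mono) auto
      finally have "infdist y F < 1 / real (Suc (Suc (Suc i)))" .
      moreover have "infdist x F \<ge> 1 / real (Suc (Suc i))" using x by (simp add: R_def)
      moreover have "infdist x F \<le> infdist y F + dist x y" by (rule infdist_triangle)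
      ultimately show "?r \<le> dist x y" by linarith
    qed
    have sum_le: "(\<Sum>i<m. ?H (R (p + 2 * i))) \<le> ?H A" for p m
    proof -
      have "(\<Sum>i=l..<m. ?H (R (p + 2 * i))) \<le> ?H (\<Union>i\<in>{l..<m}. R (p + 2 * i))" if "l \<le> m" for l
        using that
      proof (induction rule: inc_induct)
        case (step l)
        have "(\<Sum>i=l..<m. ?H (R (p + 2 * i))) = ?H (R (p + 2 * l)) + (\<Sum>i=Suc l..<m. ?H (R (p + 2 * i)))"
          using step by (simp add: sum.atLeast_Suc_lessThan)
        also have "\<dots> \<le> ?H (R (p + 2 * l)) + ?H (\<Union>i\<in>{Suc l..<m}. R (p + 2 * i))"
          using step by (intro add_left_mono)
        also have "\<dots> \<le> ?H (R (p + 2 * l) \<union> (\<Union>i\<in>{Suc l..<m}. R (p + 2 * i)))"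
        proof (rule sepR, intro UN_least)
          fix i assume "i \<in> {Suc l..<m}"
          then show "R (p + 2 * i) \<subseteq> (\<Union>j\<in>{p + 2 * l + 2..}. R j)"
            by (intro UN_upper) auto
        qed
        also have "R (p + 2 * l) \<union> (\<Union>i\<in>{Suc l..<m}. R (p + 2 * i)) = (\<Union>i\<in>{l..<m}. R (p + 2 * i))"
        proof -
          have "{l..<m} = insert l {Suc l..<m}" using step by auto
          then show ?thesis by simp
        qed
        finally show ?case .
      qed simp
      from this[of 0] have "(\<Sum>i<m. ?H (R (p + 2 * i))) \<le> ?H (\<Union>i\<in>{0..<m}. R (p + 2 * i))"
        by (simp add: atLeast0LessThan)
      also have "\<dots> \<le> ?H A" by (intro hausdorff_outer_measure_mono) (auto simp: R_def)
      finally show ?thesis .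
    qed
    have "(\<Sum>j<2 * m. ?H (R j)) \<le> 2 * ?H A" for m
    proof -
      have "(\<Sum>j<2 * m. ?H (R j)) = (\<Sum>i<m. ?H (R (0 + 2 * i))) + (\<Sum>i<m. ?H (R (1 + 2 * i)))"
        by (induction m) (simp_all add: algebra_simps)
      also have "\<dots> \<le> ?H A + ?H A" by (intro add_mono sum_le)
      finally show ?thesis by (simp add: mult_2)
    qed
    moreover have "(\<Sum>j<m. ?H (R j)) \<le> (\<Sum>j<2 * m. ?H (R j))" for m
      by (intro sum_mono2) auto
    ultimately have "(\<Sum>j. ?H (R j)) \<le> 2 * ?H A"
      by (intro suminf_le_const) (auto intro: order_trans)
    then have S: "(\<Sum>j. ?H (R j)) < \<infinity>"
      using fin by (simp add: ennreal_mult_less_top le_less_trans)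
    have le: "?H (A \<inter> F) + ?H (A - F) \<le> ?H A + (\<Sum>j. ?H (R (j + k)))" for k
    proof -
      have "A - F \<subseteq> B k \<union> (\<Union>j. R (j + k))"
      proof
        fix x assume x: "x \<in> A - F"
        then have pos: "0 < infdist x F"
          using in_closed_iff_infdist_zero[OF \<open>closed F\<close> \<open>F \<noteq> {}\<close>] infdist_nonneg[of x F] by force
        show "x \<in> B k \<union> (\<Union>j. R (j + k))"
        proof (cases "1 / real (Suc k) \<le> infdist x F")
          case False
          let ?P = "\<lambda>n. 1 / real (Suc n) \<le> infdist x F"
          obtain n0 where "?P n0" using pos by (metis less_imp_le nat_approx_posE)
          define n where "n = (LEAST n. ?P n)"
          have n: "?P n" unfolding n_def by (rule LeastI) fact
          have below: "\<not> ?P i" if "i < n" for i using that unfolding n_def by (rule not_less_Least)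
          have "k < n"
          proof (rule ccontr)
            assume "\<not> k < n"
            then have "1 / real (Suc k) \<le> 1 / real (Suc n)" by (intro divide_left_mono) auto
            with n False show False by linarith
          qed
          then obtain i where i: "n = Suc (i + k)" by (metis add.commute less_imp_Suc_add)
          have "x \<in> R (i + k)" using n below[of "i + k"] x unfolding R_def i by auto
          then show ?thesis by blast
        qed (use x in \<open>auto simp: B_def\<close>)
      qed
      then have "?H (A - F) \<le> ?H (B k \<union> (\<Union>j. R (j + k)))" by (rule hausdorff_outer_measure_mono)
      also have "\<dots> \<le> ?H (B k) + (\<Sum>j. ?H (R (j + k)))"
        by (intro order_trans[OF hausdorff_outer_measure_Un_le] add_left_mono hausdorff_outer_measure_UN_le)
      finally have "?H (A \<inter> F) + ?H (A - F) \<le> (?H (A \<inter> F) + ?H (B k)) + (\<Sum>j. ?H (R (j + k)))"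
        by (simp add: add.assoc add_left_mono)
      also have "?H (A \<inter> F) + ?H (B k) \<le> ?H ((A \<inter> F) \<union> B k)"
      proof (rule hausdorff_outer_measure_separated)
        fix x y assume "x \<in> A \<inter> F" "y \<in> B k"
        then show "1 / real (Suc k) \<le> dist x y"
          using infdist_le[of x F y] by (simp add: B_def dist_commute)
      qed simp
      also have "\<dots> \<le> ?H A" by (intro hausdorff_outer_measure_mono) (auto simp: B_def)
      finally show ?thesis by (simp add: add_right_mono)
    qed
    have tail: "(\<lambda>k. \<Sum>j. ?H (R (j + k))) \<longlonglongrightarrow> 0"
    proof -
      have eq: "(\<Sum>j. ?H (R (j + k))) = (\<Sum>j. ?H (R j)) - (\<Sum>j<k. ?H (R j))" for k
      proof -
        have "(\<Sum>j. ?H (R j)) = (\<Sum>j. ?H (R (j + k))) + (\<Sum>j<k. ?H (R j))"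
          by (rule suminf_offset) auto
        moreover have "(\<Sum>j<k. ?H (R j)) < \<infinity>"
          by (rule le_less_trans[OF sum_le_suminf S]) auto
        then have "(\<Sum>j<k. ?H (R j)) \<noteq> \<infinity>" by (rule less_imp_neq)
        ultimately show ?thesis by (metis ennreal_add_diff_cancel_right infinity_ennreal_def)
      qed
      have "(\<lambda>k. (\<Sum>j. ?H (R j)) - (\<Sum>j<k. ?H (R j))) \<longlonglongrightarrow> (\<Sum>j. ?H (R j)) - (\<Sum>j. ?H (R j))"
        using S by (intro tendsto_diff_ennreal summable_LIMSEQ tendsto_const) auto
      then show ?thesis using S unfolding eq by simp
    qed
    have "(\<lambda>k. ?H A + (\<Sum>j. ?H (R (j + k)))) \<longlonglongrightarrow> ?H A + 0"
      by (intro tendsto_add tendsto_const tail)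
    then show ?thesis using le by (intro LIMSEQ_le_const) auto
  qed
  have "?H (A \<inter> F) + ?H (A - F) = ?H A" for A :: "'a set"
  proof (rule antisym)
    show "?H (A \<inter> F) + ?H (A - F) \<le> ?H A"
    proof (cases "?H A = \<infinity> \<or> F = {}")
      case True then show ?thesis by auto
    next
      case False then show ?thesis by (intro main) (auto simp: top.not_eq_extremum)
    qed
    have "?H A = ?H ((A \<inter> F) \<union> (A - F))" by (rule arg_cong[where f="?H"]) auto
    then show "?H A \<le> ?H (A \<inter> F) + ?H (A - F)" using hausdorff_outer_measure_Un_le[of d "A \<inter> F" "A - F"] by simp
  qed
  then show ?thesis
    unfolding sets_hausdorff_measure algebra.lambda_system_eq[OF sigma_algebra.axioms(1)[OF sigma_algebra_Pow]]
    by auto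
qed

lemma borel_sets_hausdorff:
  "sets (borel :: 'a::metric_space measure) \<subseteq> sets (hausdorff_measure d)"
proof -
  have "sigma_sets UNIV {S::'a set. closed S} \<subseteq> sets (hausdorff_measure d)"
    using sets.sigma_sets_subset[of "{S::'a set. closed S}" "hausdorff_measure d"]
      closed_in_sets_hausdorff by (metis mem_Collect_eq space_hausdorff_measure subsetI)
  then show ?thesis by (simp add: borel_eq_closed)
qed

lemma hausdorff_null_sets:
  assumes "hausdorff_outer_measure d N = 0"
  shows "N \<in> null_sets (hausdorff_measure d :: 'a::metric_space measure)"
proof -
  let ?H = "hausdorff_outer_measure d"
  have "?H (A \<inter> N) + ?H (A - N) = ?H A" for A :: "'a set"
  proof (rule antisym)
    have "?H (A \<inter> N) = 0"
      using hausdorff_outer_measure_mono[of "A \<inter> N" N d] assms by simp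
    then show "?H (A \<inter> N) + ?H (A - N) \<le> ?H A"
      by (simp add: hausdorff_outer_measure_mono)
    have "?H A = ?H ((A \<inter> N) \<union> (A - N))" by (rule arg_cong[where f="?H"]) auto
    then show "?H A \<le> ?H (A \<inter> N) + ?H (A - N)" using hausdorff_outer_measure_Un_le[of d "A \<inter> N" "A - N"] by simp
  qed
  then have "N \<in> sets (hausdorff_measure d)"
    unfolding sets_hausdorff_measure algebra.lambda_system_eq[OF sigma_algebra.axioms(1)[OF sigma_algebra_Pow]]
    by auto
  with assms show ?thesis by (simp add: null_sets_def emeasure_hausdorff_measure)
qed

lemma hausdorff_outer_measure_isometry:
  fixes f :: "'a::metric_space \<Rightarrow> 'a"
  assumes iso: "\<And>x y. dist (f x) (f y) = dist x y"
  shows "hausdorff_outer_measure d (f ` A) \<le> hausdorff_outer_measure d A"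
  unfolding hausdorff_outer_measure_def
proof (rule SUP_mono)
  fix \<delta> :: real assume "\<delta> \<in> {0<..}"
  have diam: "diameter (f ` U) = diameter U" for U
  proof -
    have "(\<lambda>(x, y). dist x y) ` (f ` U \<times> f ` U) = (\<lambda>(x, y). dist x y) ` (U \<times> U)"
      by (force simp: iso image_iff)
    then show ?thesis by (simp add: diameter_def)
  qed
  have "hausdorff_pre_measure d \<delta> (f ` A) \<le> hausdorff_pre_measure d \<delta> A"
    unfolding hausdorff_pre_measure_def[of d \<delta> A]
  proof (rule INF_greatest)
    fix U :: "nat \<Rightarrow> 'a set"
    assume U: "U \<in> {U. (\<forall>i. bounded (U i) \<and> diameter (U i) \<le> \<delta>) \<and> A \<subseteq> (\<Union>i. U i)}"
    have bdd: "bounded (f ` U i)" for i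
      using U unfolding bounded_two_points by (fastforce simp: iso)
    have "hausdorff_pre_measure d \<delta> (f ` A) \<le> (\<Sum>i. hausdorff_gauge d (f ` U i))"
      using U bdd by (intro hausdorff_pre_measure_le_cover) (simp_all add: diam image_mono flip: image_UN)
    also have "\<dots> = (\<Sum>i. hausdorff_gauge d (U i))" unfolding hausdorff_gauge_def diam image_is_empty ..
    finally show "hausdorff_pre_measure d \<delta> (f ` A) \<le> (\<Sum>i. hausdorff_gauge d (U i))" .
  qed
  then show "\<exists>\<delta>'\<in>{0<..}. hausdorff_pre_measure d \<delta> (f ` A) \<le> hausdorff_pre_measure d \<delta>' A"
    using \<open>\<delta> \<in> {0<..}\<close> by auto
qed

section \<open>Finiteness of the area of the sphere\<close>

lemma power_diff_le:
  fixes a b :: real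
  assumes "0 \<le> b" "b \<le> a"
  shows "a ^ n - b ^ n \<le> real n * a ^ (n - 1) * (a - b)"
proof (cases n)
  case (Suc m)
  have "a ^ Suc m - b ^ Suc m = (a - b) * (\<Sum>p<Suc m. a ^ p * b ^ (m - p))"
    using power_diff_sumr2[of a "Suc m" b] by (simp add: mult.commute)
  also have "\<dots> \<le> (a - b) * (\<Sum>p<Suc m. a ^ m)"
  proof (intro mult_left_mono sum_mono)
    fix p assume p: "p \<in> {..<Suc m}"
    have "a ^ p * b ^ (m - p) \<le> a ^ p * a ^ (m - p)" using assms by (intro mult_left_mono power_mono) auto
    also have "\<dots> = a ^ m" using p by (simp flip: power_add)
    finally show "a ^ p * b ^ (m - p) \<le> a ^ m" .
  qed (use assms in auto)
  finally show ?thesis using Suc by (simp add: mult_ac)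
qed simp

text \<open>
  Volume comparison: the balls of radius \<open>\<delta>/2\<close> around the points are disjoint and lie in an annulus of
  thickness \<open>\<delta>\<close>, whose volume is at most a constant times \<open>\<delta>\<close>.
\<close>

lemma separated_subset_sphere_card_le:
  fixes T :: "'a::euclidean_space set"
  assumes T: "T \<subseteq> sphere 0 1" "finite T" and sep: "\<And>x y. x \<in> T \<Longrightarrow> y \<in> T \<Longrightarrow> x \<noteq> y \<Longrightarrow> \<delta> \<le> dist x y"
    and \<delta>: "0 < \<delta>" "\<delta> \<le> 1"
  shows "real (card T) * \<delta> ^ (DIM('a) - 1) \<le> real DIM('a) * 4 ^ DIM('a)"
proof -
  let ?n = "DIM('a)" and ?V = "unit_ball_vol (real DIM('a))"
  let ?B = "\<Union>x\<in>T. ball x (\<delta>/2)"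
  have V: "0 < ?V" by simp
  have "disjoint_family_on (\<lambda>x. ball x (\<delta>/2)) T"
  proof (unfold disjoint_family_on_def, intro ballI impI)
    fix x y assume xy: "x \<in> T" "y \<in> T" "x \<noteq> y"
    show "ball x (\<delta>/2) \<inter> ball y (\<delta>/2) = {}"
      using sep[OF xy] by (intro disjoint_ballI) simp
  qed
  moreover have "emeasure lborel (ball x (\<delta>/2)) \<noteq> \<infinity>" for x :: 'a
    using emeasure_lborel_ball_finite[of x "\<delta>/2"] by (rule less_imp_neq)
  ultimately have "measure lborel ?B = (\<Sum>x\<in>T. measure lborel (ball x (\<delta>/2)))"
    using T(2) by (intro measure_finite_Union) auto
  also have "\<dots> = real (card T) * (?V * (\<delta>/2) ^ ?n)"
    using \<delta> by (simp add: content_ball)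
  finally have eq: "measure lborel ?B = real (card T) * (?V * (\<delta>/2) ^ ?n)" .
  have disj: "?B \<inter> ball 0 (1 - \<delta>/2) = {}"
  proof -
    have False if "x \<in> T" "dist x y < \<delta>/2" "norm y < 1 - \<delta>/2" for x y
    proof -
      have "norm x \<le> norm y + dist x y" by (metis add.commute dist_0_norm dist_commute dist_triangle)
      with that T show False by auto
    qed
    then show ?thesis by auto
  qed
  have sub: "?B \<union> ball 0 (1 - \<delta>/2) \<subseteq> ball 0 (1 + \<delta>/2)"
  proof -
    have "norm y < 1 + \<delta>/2" if "x \<in> T" "dist x y < \<delta>/2" for x y
    proof -
      have "norm y \<le> norm x + dist x y" by (metis add.commute dist_0_norm dist_commute dist_triangle)
      with that T show ?thesis by auto
    qed
    then show ?thesis using \<delta> by auto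
  qed
  have fin: "emeasure lborel ?B \<noteq> \<infinity>"
  proof -
    have "emeasure lborel ?B \<le> emeasure lborel (ball (0::'a) (1 + \<delta>/2))"
      using sub by (intro emeasure_mono) auto
    also have "\<dots> < \<infinity>" by (rule emeasure_lborel_ball_finite)
    finally show ?thesis by simp
  qed
  have "measure lborel ?B + measure lborel (ball (0::'a) (1 - \<delta>/2)) = measure lborel (?B \<union> ball 0 (1 - \<delta>/2))"
    using disj fin T(2) emeasure_lborel_ball_finite[of "0::'a" "1 - \<delta>/2"]
    by (intro measure_Union[symmetric]) auto
  also have "\<dots> \<le> measure lborel (ball (0::'a) (1 + \<delta>/2))"
    using sub T(2) emeasure_lborel_ball_finite[of "0::'a" "1 + \<delta>/2"]
    by (intro measure_mono_fmeasurable fmeasurableI sets.Un sets.finite_UN) auto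
  finally have "real (card T) * (?V * (\<delta>/2) ^ ?n) + ?V * (1 - \<delta>/2) ^ ?n \<le> ?V * (1 + \<delta>/2) ^ ?n"
    using \<delta> by (simp add: eq content_ball)
  then have "?V * (real (card T) * (\<delta>/2) ^ ?n) \<le> ?V * ((1 + \<delta>/2) ^ ?n - (1 - \<delta>/2) ^ ?n)"
    by (simp add: algebra_simps)
  then have "real (card T) * (\<delta>/2) ^ ?n \<le> (1 + \<delta>/2) ^ ?n - (1 - \<delta>/2) ^ ?n"
    using V by (simp only: mult_le_cancel_left_pos)
  also have "\<dots> \<le> real ?n * (1 + \<delta>/2) ^ (?n - 1) * ((1 + \<delta>/2) - (1 - \<delta>/2))"
    using \<delta> by (intro power_diff_le) auto
  also have "\<dots> \<le> real ?n * 2 ^ (?n - 1) * \<delta>"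
    using \<delta> by (simp add: mult_left_mono power_mono)
  finally have *: "real (card T) * (\<delta>/2) ^ ?n \<le> real ?n * 2 ^ (?n - 1) * \<delta>" .
  have n: "?n = Suc (?n - 1)" using DIM_positive[where 'a='a] by simp
  have "real (card T) * \<delta> ^ (?n - 1) * (\<delta> / 2 ^ ?n) = real (card T) * (\<delta>/2) ^ ?n"
    using power_minus_mult[of ?n \<delta>] by (simp add: power_divide)
  also note *
  also have "real ?n * 2 ^ (?n - 1) * \<delta> \<le> real ?n * 4 ^ ?n * (\<delta> / 2 ^ ?n)"
  proof -
    have "(4::real) ^ ?n = 2 ^ ?n * 2 ^ ?n" by (simp flip: power_mult_distrib)
    moreover have "(2::real) ^ (?n - 1) \<le> 2 ^ ?n" by (intro power_increasing) auto
    ultimately show ?thesis using \<delta> by (simp add: mult_mono)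
  qed
  finally show ?thesis
    by (rule mult_right_le_imp_le) (use \<delta> in simp)
qed

text \<open>
  A \<open>\<delta>\<close>-separated subset of maximal size is a \<open>\<delta>\<close>-net, and its size is of the order \<open>\<delta>\<close> to the power
  \<open>1 - n\<close>; the balls around its points are efficient covers for every \<open>\<delta>\<close>.
\<close>

lemma hausdorff_outer_measure_sphere_finite:
  "hausdorff_outer_measure (DIM('a) - 1) (sphere 0 1 :: 'a::euclidean_space set) < \<infinity>"
proof -
  let ?n = "DIM('a)"
  let ?c = "unit_ball_vol (real (?n - 1))"
  let ?C = "ennreal (?c * (real ?n * 4 ^ ?n))"
  have *: "hausdorff_pre_measure (?n - 1) (2 * \<delta>) (sphere 0 1 :: 'a set) \<le> ?C"
    if \<delta>: "0 < \<delta>" "\<delta> \<le> 1" for \<delta>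
  proof -
    define P where "P m \<longleftrightarrow> (\<exists>T::'a set. T \<subseteq> sphere 0 1 \<and> finite T \<and> card T = m
      \<and> (\<forall>x\<in>T. \<forall>y\<in>T. x \<noteq> y \<longrightarrow> \<delta> \<le> dist x y))" for m
    have bound: "m \<le> nat \<lceil>real ?n * 4 ^ ?n / \<delta> ^ (?n - 1)\<rceil>" if "P m" for m
    proof -
      obtain T :: "'a set" where "T \<subseteq> sphere 0 1" "finite T" "card T = m"
        "\<forall>x\<in>T. \<forall>y\<in>T. x \<noteq> y \<longrightarrow> \<delta> \<le> dist x y" using \<open>P m\<close> unfolding P_def by blast
      with separated_subset_sphere_card_le[of T \<delta>] \<delta> have "real m * \<delta> ^ (?n - 1) \<le> real ?n * 4 ^ ?n" by auto
      then have "real m \<le> real ?n * 4 ^ ?n / \<delta> ^ (?n - 1)" using \<delta> by (simp add: field_simps)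
      then show ?thesis by linarith
    qed
    have "P 0" unfolding P_def by (intro exI[of _ "{}"]) auto
    then obtain m where m: "P m" and max: "\<And>k. P k \<Longrightarrow> k \<le> m"
      using ex_has_greatest_nat[of P 0 "\<lambda>x. x", OF _ ] bound le_imp_less_Suc by (metis (full_types) GreatestI_nat Greatest_le_nat)
    obtain T where T: "T \<subseteq> sphere (0::'a) 1" "finite T" "card T = m"
      and sep: "\<forall>x\<in>T. \<forall>y\<in>T. x \<noteq> y \<longrightarrow> \<delta> \<le> dist x y" using m unfolding P_def by blast
    have cov: "\<exists>t\<in>T. dist x t < \<delta>" if x: "x \<in> sphere 0 1" for x
    proof (rule ccontr)
      assume "\<not> ?thesis"
      then have far: "\<forall>t\<in>T. \<delta> \<le> dist x t" by auto
      then have "x \<notin> T" using \<delta> by force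
      have "P (Suc m)" unfolding P_def
        using T x \<open>x \<notin> T\<close> far sep by (intro exI[of _ "insert x T"]) (auto simp: dist_commute)
      then show False using max[of "Suc m"] by simp
    qed
    obtain f where f: "bij_betw f {..<m} T"
      using ex_bij_betw_nat_finite[OF T(2)] T(3) by (auto simp: atLeast0LessThan)
    define U where "U i = (if i < m then cball (f i) \<delta> else {})" for i
    have diam: "diameter (U i) \<le> 2 * \<delta>" for i
      using \<delta> by (auto simp: U_def diameter_cball)
    have gauge: "hausdorff_gauge (?n - 1) (U i) \<le> (if i < m then ennreal (?c * \<delta> ^ (?n - 1)) else 0)" for i
      using \<delta> by (simp add: hausdorff_gauge_def U_def diameter_cball)
    have "hausdorff_pre_measure (?n - 1) (2 * \<delta>) (sphere 0 1 :: 'a set) \<le> (\<Sum>i. hausdorff_gauge (?n - 1) (U i))"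
    proof (rule hausdorff_pre_measure_le_cover)
      show "sphere 0 1 \<subseteq> (\<Union>i. U i)"
      proof
        fix x :: 'a assume "x \<in> sphere 0 1"
        then obtain t where t: "t \<in> T" "dist x t < \<delta>" using cov by blast
        then obtain i where "i < m" "f i = t" using f by (auto simp: bij_betw_def)
        with t show "x \<in> (\<Union>i. U i)" by (auto simp: U_def dist_commute intro!: exI[of _ i])
      qed
    qed (auto simp: U_def \<open>0 < \<delta>\<close> diam[unfolded U_def])
    also have "\<dots> \<le> (\<Sum>i. if i < m then ennreal (?c * \<delta> ^ (?n - 1)) else 0)"
      by (intro suminf_le gauge) auto
    also have "\<dots> = (\<Sum>i<m. ennreal (?c * \<delta> ^ (?n - 1)))"
      by (subst suminf_finite[of "{..<m}"]) auto
    also have "\<dots> = ennreal (?c * (real m * \<delta> ^ (?n - 1)))"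
      using \<delta> by (simp add: ennreal_mult'[symmetric] ennreal_of_nat_eq_real_of_nat mult_ac)
    also have "\<dots> \<le> ?C"
      using separated_subset_sphere_card_le[of T \<delta>] T sep \<delta> by (intro ennreal_leI mult_left_mono) auto
    finally show ?thesis .
  qed
  have "hausdorff_outer_measure (?n - 1) (sphere 0 1 :: 'a set) \<le> ?C"
    unfolding hausdorff_outer_measure_def
  proof (rule SUP_least)
    fix \<delta> :: real assume "\<delta> \<in> {0<..}"
    then have "hausdorff_pre_measure (?n - 1) \<delta> (sphere 0 1 :: 'a set)
        \<le> hausdorff_pre_measure (?n - 1) (2 * min 1 (\<delta>/2)) (sphere 0 1 :: 'a set)"
      by (intro hausdorff_pre_measure_antimono) auto
    also have "\<dots> \<le> ?C" using \<open>\<delta> \<in> {0<..}\<close> by (intro *) auto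
    finally show "hausdorff_pre_measure (?n - 1) \<delta> (sphere 0 1 :: 'a set) \<le> ?C" .
  qed
  also have "\<dots> < \<infinity>" by simp
  finally show ?thesis .
qed

section \<open>Null sets of directions\<close>

text \<open>
  A bounded null set has a cover by cubes of small total volume. The numbers \<open>s i\<close> bound the
  diameters, and only these enter the Hausdorff measure.
\<close>

lemma negligible_cube_cover:
  fixes N :: "'a::euclidean_space set"
  assumes N: "negligible N" "bounded N" and "0 < \<epsilon>"
  obtains K :: "nat \<Rightarrow> 'a set" and s :: "nat \<Rightarrow> real"
  where "N \<subseteq> (\<Union>i. K i)" "\<And>i. 0 \<le> s i"
    "\<And>i x y. x \<in> K i \<Longrightarrow> y \<in> K i \<Longrightarrow> dist x y \<le> s i"
    "(\<Sum>i. ennreal (s i ^ DIM('a))) \<le> ennreal \<epsilon>"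
proof -
  let ?n = "DIM('a)"
  obtain L where L: "0 < L" "N \<subseteq> cbox (- L *\<^sub>R One) (L *\<^sub>R One)"
  proof -
    obtain a :: 'a where a: "N \<subseteq> cbox (-a) a" using bounded_subset_cbox_symmetric[OF N(2)] by blast
    define L where "L = norm a + 1"
    have "cbox (-a) a \<subseteq> cbox (- L *\<^sub>R One) (L *\<^sub>R One)"
    proof
      fix x assume x: "x \<in> cbox (-a) a"
      have "\<bar>a \<bullet> i\<bar> \<le> L" if "i \<in> Basis" for i using Basis_le_norm[OF that, of a] by (simp add: L_def)
      then show "x \<in> cbox (- L *\<^sub>R One) (L *\<^sub>R One)"
        using x by (fastforce simp: mem_box)
    qed
    with a have "N \<subseteq> cbox (- L *\<^sub>R One) (L *\<^sub>R One)" by blast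
    moreover have "0 < L" by (simp add: L_def add_nonneg_pos)
    ultimately show ?thesis using that by blast
  qed
  define e where "e = \<epsilon> / real ?n ^ ?n"
  have e: "0 < e" using \<open>0 < \<epsilon>\<close> by (simp add: e_def)
  have NL: "N \<in> lmeasurable" "measure lebesgue N = 0"
    using N(1) negligible_iff_measure by auto
  obtain \<D> where \<D>: "countable \<D>"
    "\<And>K. K \<in> \<D> \<Longrightarrow> K \<subseteq> cbox (- L *\<^sub>R One) (L *\<^sub>R One :: 'a) \<and> K \<noteq> {} \<and> (\<exists>c d. K = cbox c d)"
    "pairwise (\<lambda>A B. interior A \<inter> interior B = {}) \<D>"
    "\<And>u v. cbox u v \<in> \<D> \<Longrightarrow> \<exists>n. \<forall>i \<in> Basis. v \<bullet> i - u \<bullet> i = ((L *\<^sub>R One) \<bullet> i - (- L *\<^sub>R One) \<bullet> i)/2^n"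
    "N \<subseteq> \<Union>\<D>" "\<Union>\<D> \<in> lmeasurable" "measure lebesgue (\<Union>\<D>) \<le> measure lebesgue N + e"
    using measurable_outer_intervals_bounded[OF NL(1) L(2) e] by metis
  have "\<exists>u v t. K = cbox u v \<and> 0 < t \<and> (\<forall>i\<in>Basis. v \<bullet> i - u \<bullet> i = t)" if KD: "K \<in> \<D>" for K
  proof -
    obtain u v where K: "K = cbox u v" using \<D>(2)[OF KD] by blast
    obtain n where "\<forall>i \<in> Basis. v \<bullet> i - u \<bullet> i = ((L *\<^sub>R One) \<bullet> i - (- L *\<^sub>R One) \<bullet> i)/2^n"
      using \<D>(4) KD K by blast
    then have "\<forall>i \<in> Basis. v \<bullet> i - u \<bullet> i = 2 * L / 2 ^ n" by simp
    then show ?thesis using K L(1) by (intro exI[of _ u] exI[of _ v] exI[of _ "2 * L / 2 ^ n"]) simp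
  qed
  then obtain u v t where uvt: "\<And>K. K \<in> \<D> \<Longrightarrow> K = cbox (u K) (v K) \<and> 0 < t K \<and> (\<forall>i\<in>Basis. v K \<bullet> i - u K \<bullet> i = t K)"
    by metis
  define I where "I = to_nat_on \<D> ` \<D>"
  define K where "K i = (if i \<in> I then from_nat_into \<D> i else {})" for i
  define s where "s i = (if i \<in> I then real ?n * t (from_nat_into \<D> i) else 0)" for i
  have fromD: "from_nat_into \<D> i \<in> \<D>" if "i \<in> I" for i
    using that \<D>(1) by (auto simp: I_def)
  have UK: "(\<Union>i. K i) = \<Union>\<D>"
  proof
    show "(\<Union>i. K i) \<subseteq> \<Union>\<D>" using fromD by (auto simp: K_def split: if_splits)
    show "\<Union>\<D> \<subseteq> (\<Union>i. K i)"
    proof (rule Union_least)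
      fix X assume "X \<in> \<D>"
      then have "K (to_nat_on \<D> X) = X" using \<D>(1) by (simp add: K_def I_def)
      then show "X \<subseteq> (\<Union>i. K i)" by blast
    qed
  qed
  have disj: "disjoint_family (\<lambda>i. interior (K i))"
  proof (unfold disjoint_family_on_def, intro ballI impI)
    fix i j :: nat assume "i \<noteq> j"
    show "interior (K i) \<inter> interior (K j) = {}"
    proof (cases "i \<in> I \<and> j \<in> I")
      case True
      have "from_nat_into \<D> i \<noteq> from_nat_into \<D> j"
        using True \<open>i \<noteq> j\<close> \<D>(1) by (auto simp: I_def)
      then show ?thesis using \<D>(3) fromD True by (auto simp: K_def pairwise_def)
    qed (auto simp: K_def)
  qed
  have vol: "ennreal (s i ^ ?n) = ennreal (real ?n ^ ?n) * emeasure lborel (interior (K i))" for i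
  proof (cases "i \<in> I")
    case True
    define X where "X = from_nat_into \<D> i"
    have X: "X \<in> \<D>" "K i = X" "s i = real ?n * t X" using True fromD by (auto simp: X_def K_def s_def)
    note u = uvt[OF X(1)]
    have "emeasure lborel (interior X) = emeasure lborel (box (u X) (v X))"
      using u by (metis interior_cbox)
    also have "\<dots> = ennreal (\<Prod>b\<in>Basis. (v X - u X) \<bullet> b)"
    proof (rule emeasure_lborel_box)
      fix b :: 'a assume "b \<in> Basis"
      then show "u X \<bullet> b \<le> v X \<bullet> b" using u by (metis diff_ge_0_iff_ge less_imp_le)
    qed
    also have "(\<Prod>b\<in>Basis. (v X - u X) \<bullet> b) = t X ^ ?n"
      using u by (simp add: inner_diff_left)
    finally show ?thesis using u X by (simp add: power_mult_distrib ennreal_mult)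
  qed (auto simp: K_def s_def)
  show ?thesis
  proof
    show "N \<subseteq> (\<Union>i. K i)" using \<D>(5) UK by simp
    show "0 \<le> s i" for i using uvt fromD by (force simp: s_def)
    show "dist x y \<le> s i" if "x \<in> K i" "y \<in> K i" for x y i
    proof -
      from that have "i \<in> I" by (auto simp: K_def split: if_splits)
      define X where "X = from_nat_into \<D> i"
      have X: "X \<in> \<D>" "K i = X" "s i = real ?n * t X" using \<open>i \<in> I\<close> fromD by (auto simp: X_def K_def s_def)
      note u = uvt[OF X(1)]
      have "dist x y \<le> (\<Sum>b\<in>Basis. \<bar>(x - y) \<bullet> b\<bar>)" unfolding dist_norm by (rule norm_le_l1)
      also have "\<dots> \<le> (\<Sum>b\<in>(Basis::'a set). t X)"
      proof (rule sum_mono)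
        fix b :: 'a assume b: "b \<in> Basis"
        have "x \<in> cbox (u X) (v X)" "y \<in> cbox (u X) (v X)" using that X u by auto
        then have "u X \<bullet> b \<le> x \<bullet> b" "x \<bullet> b \<le> v X \<bullet> b" "u X \<bullet> b \<le> y \<bullet> b" "y \<bullet> b \<le> v X \<bullet> b"
          using b by (auto simp: mem_box)
        moreover have "v X \<bullet> b - u X \<bullet> b = t X" using u b by blast
        ultimately show "\<bar>(x - y) \<bullet> b\<bar> \<le> t X" by (simp add: inner_diff_left)
      qed
      also have "\<dots> = s i" using X by simp
      finally show ?thesis .
    qed
    have "(\<Sum>i. ennreal (s i ^ ?n)) = ennreal (real ?n ^ ?n) * (\<Sum>i. emeasure lborel (interior (K i)))"
      by (simp add: vol)
    also have "(\<Sum>i. emeasure lborel (interior (K i))) = emeasure lborel (\<Union>i. interior (K i))"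
      using disj by (intro suminf_emeasure) auto
    also have "\<dots> = emeasure lebesgue (\<Union>i. interior (K i))" by simp
    also have "\<dots> \<le> emeasure lebesgue (\<Union>\<D>)"
      using \<D>(6) interior_subset unfolding UK[symmetric] by (intro emeasure_mono) (auto simp: UK[symmetric] fmeasurableD)
    also have "\<dots> = ennreal (measure lebesgue (\<Union>\<D>))"
      using \<D>(6) by (simp add: emeasure_eq_measure2)
    also have "\<dots> \<le> ennreal e" using \<D>(7) NL by (intro ennreal_leI) simp
    also have "ennreal (real ?n ^ ?n) * ennreal e = ennreal \<epsilon>"
      using e by (simp add: e_def flip: ennreal_mult)
    finally show "(\<Sum>i. ennreal (s i ^ ?n)) \<le> ennreal \<epsilon>" by (simp add: mult_left_mono)
  qed
qed

text \<open>
  The easy half of Eilenberg's inequality. Cover the truncated cone over \<open>E\<close> by sets \<open>K i\<close> of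
  diameter at most \<open>s i\<close>. For \<open>1 \<le> t \<le> 2\<close> the sets among them that meet the sphere of radius \<open>t\<close> cover
  \<open>t E\<close>, and for each of them the admissible \<open>t\<close> lie in an interval of length \<open>2 s i\<close>. Integrating
  over \<open>t\<close> the bound for the pre-measure of \<open>E\<close> thus turns a sum of powers \<open>n - 1\<close> of the \<open>s i\<close> into
  a sum of powers \<open>n\<close>, which is as small as one likes.
\<close>

lemma hausdorff_null_if_cone_negligible:
  fixes E :: "'a::euclidean_space set"
  assumes E: "E \<subseteq> sphere 0 1" and neg: "negligible {t *\<^sub>R u |t u. 1 \<le> t \<and> t \<le> 2 \<and> u \<in> E}"
  shows "hausdorff_outer_measure (DIM('a) - 1) E = 0"
proof -
  let ?n = "DIM('a)" and ?N = "{t *\<^sub>R u |t u. 1 \<le> t \<and> t \<le> 2 \<and> u \<in> E}"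
  let ?c = "unit_ball_vol (real (?n - 1))"
  have n: "?n = Suc (?n - 1)" using DIM_positive[where 'a='a] by simp
  have bdd: "bounded ?N"
    unfolding bounded_iff using E by (intro exI[of _ 2]) (auto simp: dist_norm)
  have le: "hausdorff_pre_measure (?n - 1) \<delta> E \<le> ennreal (2 * ?c * \<epsilon>)"
    if "0 < \<delta>" "0 < \<epsilon>" "\<epsilon> \<le> \<delta> ^ ?n" for \<delta> \<epsilon>
  proof -
    obtain K :: "nat \<Rightarrow> 'a set" and s where K: "?N \<subseteq> (\<Union>i. K i)" "\<And>i. 0 \<le> s i"
      "\<And>i x y. x \<in> K i \<Longrightarrow> y \<in> K i \<Longrightarrow> dist x y \<le> s i"
      "(\<Sum>i. ennreal (s i ^ ?n)) \<le> ennreal \<epsilon>"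
      by (rule negligible_cube_cover[OF neg bdd \<open>0 < \<epsilon>\<close>]) (rule that, assumption+)
    (* The total volume is so small that no single diameter exceeds the admissible one. *)
    have s\<delta>: "s i \<le> \<delta>" for i
    proof (rule power_le_imp_le_base[of _ "?n - 1"])
      have "ennreal (s i ^ ?n) \<le> (\<Sum>i. ennreal (s i ^ ?n))"
        using sum_le_suminf[of "\<lambda>i. ennreal (s i ^ ?n)" "{i}"] by simp
      also note K(4)
      finally have "s i ^ ?n \<le> \<epsilon>" using \<open>0 < \<epsilon>\<close> by simp
      then show "s i ^ Suc (?n - 1) \<le> \<delta> ^ Suc (?n - 1)" using \<open>\<epsilon> \<le> _\<close> n by simp
    qed (use \<open>0 < \<delta>\<close> in auto)
    (* The radii t for which K i meets the sphere of radius t lie in J i; W t i is the part of K i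
       on that sphere, scaled back to the unit sphere. *)
    define p where "p i = (SOME x. x \<in> K i)" for i
    define J where "J i = {norm (p i) - s i .. norm (p i) + s i}" for i
    define W where "W t i = (\<lambda>x. x /\<^sub>R t) ` (K i \<inter> sphere 0 t)" for t i
    have J: "t \<in> J i" if ne: "W t i \<noteq> {}" for t i
    proof -
      obtain x where x: "x \<in> K i" "norm x = t" using ne unfolding W_def by force
      then have "p i \<in> K i" unfolding p_def by (metis someI)
      then have "dist x (p i) \<le> s i" using K(3) x by blast
      then show ?thesis using x(2) norm_triangle_ineq3[of x "p i"] by (auto simp: J_def dist_norm abs_le_iff)
    qed
    have dist_le: "dist x y \<le> s i" if t: "1 \<le> t" and xy: "x \<in> W t i" "y \<in> W t i" for t i x y
    proof -
      obtain x' y' where x': "x' \<in> K i" "x = x' /\<^sub>R t" and y': "y' \<in> K i" "y = y' /\<^sub>R t"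
        using xy by (auto simp: W_def)
      have "dist x y = dist x' y' / t"
        using t by (simp add: x'(2) y'(2) dist_norm flip: scaleR_diff_right) (simp add: divide_inverse)
      also have "\<dots> \<le> dist x' y' / 1" using t by (intro divide_left_mono) auto
      also have "\<dots> \<le> s i" using K(3) x' y' by simp
      finally show ?thesis .
    qed
    have pre: "hausdorff_pre_measure (?n - 1) \<delta> E \<le> (\<Sum>i. ennreal (?c * s i ^ (?n - 1)) * indicator (J i) t)"
      if t: "1 \<le> t" "t \<le> 2" for t
    proof -
      have diam: "diameter (W t i) \<le> s i" for i
        using dist_le[OF t(1)] K(2)[of i] by (intro diameter_le) (auto simp: dist_norm)
      have "hausdorff_pre_measure (?n - 1) \<delta> E \<le> (\<Sum>i. hausdorff_gauge (?n - 1) (W t i))"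
      proof (rule hausdorff_pre_measure_le_cover)
        show "bounded (W t i)" for i
          unfolding bounded_two_points using dist_le[OF t(1)] by blast
        show "diameter (W t i) \<le> \<delta>" for i using diam s\<delta> by (rule order_trans)
        show "E \<subseteq> (\<Union>i. W t i)"
        proof
          fix u assume u: "u \<in> E"
          then have "t *\<^sub>R u \<in> ?N" using t by blast
          then obtain i where i: "t *\<^sub>R u \<in> K i" using K(1) by blast
          have "u = (t *\<^sub>R u) /\<^sub>R t" using t by simp
          moreover have "t *\<^sub>R u \<in> sphere 0 t" using u E t by auto
          ultimately have "u \<in> W t i" using i unfolding W_def by blast
          then show "u \<in> (\<Union>i. W t i)" by blast
        qed
      qed
      also have "\<dots> \<le> (\<Sum>i. ennreal (?c * s i ^ (?n - 1)) * indicator (J i) t)"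
      proof (intro suminf_le)
        fix i
        show "hausdorff_gauge (?n - 1) (W t i) \<le> ennreal (?c * s i ^ (?n - 1)) * indicator (J i) t"
        proof (cases "W t i = {}")
          case False
          have "bounded (W t i)" unfolding bounded_two_points using dist_le[OF t(1)] by blast
          then have "(diameter (W t i) / 2) ^ (?n - 1) \<le> s i ^ (?n - 1)"
            using diam[of i] diameter_ge_0[of "W t i"] K(2)[of i] by (intro power_mono) auto
          then show ?thesis using False J[OF False]
            by (auto simp: hausdorff_gauge_def intro!: ennreal_leI mult_left_mono)
        qed (simp add: hausdorff_gauge_def)
      qed auto
      finally show ?thesis .
    qed
    have "hausdorff_pre_measure (?n - 1) \<delta> E = (\<integral>\<^sup>+t. hausdorff_pre_measure (?n - 1) \<delta> E * indicator {1..2::real} t \<partial>lborel)"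
      by (simp add: nn_integral_cmult_indicator)
    also have "\<dots> \<le> (\<integral>\<^sup>+t. (\<Sum>i. ennreal (?c * s i ^ (?n - 1)) * indicator (J i) t) \<partial>lborel)"
      using pre by (intro nn_integral_mono) (auto simp: indicator_def)
    also have "\<dots> = (\<Sum>i. \<integral>\<^sup>+t. ennreal (?c * s i ^ (?n - 1)) * indicator (J i) t \<partial>lborel)"
      by (intro nn_integral_suminf) (auto simp: J_def)
    also have "\<dots> = (\<Sum>i. ennreal (?c * s i ^ (?n - 1)) * ennreal (2 * s i))"
      using K(2) by (simp add: nn_integral_cmult_indicator J_def)
    also have "\<dots> = (\<Sum>i. ennreal (2 * ?c) * ennreal (s i ^ ?n))"
    proof (intro suminf_cong)
      fix i
      have "?c * s i ^ (?n - 1) * (2 * s i) = 2 * ?c * s i ^ ?n" using power_minus_mult[of ?n "s i"] by (simp add: mult_ac)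
      then show "ennreal (?c * s i ^ (?n - 1)) * ennreal (2 * s i) = ennreal (2 * ?c) * ennreal (s i ^ ?n)"
        using K(2)[of i] by (simp flip: ennreal_mult)
    qed
    also have "\<dots> = ennreal (2 * ?c) * (\<Sum>i. ennreal (s i ^ ?n))" by simp
    also have "\<dots> \<le> ennreal (2 * ?c) * ennreal \<epsilon>" using K(4) by (rule mult_left_mono) simp
    also have "\<dots> = ennreal (2 * ?c * \<epsilon>)" using \<open>0 < \<epsilon>\<close> by (simp add: ennreal_mult)
    finally show ?thesis .
  qed
  have "hausdorff_pre_measure (?n - 1) \<delta> E \<le> 0" if "\<delta> \<in> {0<..}" for \<delta>
  proof (rule ennreal_le_epsilon)
    fix e :: real assume "0 < e"
    define \<epsilon> where "\<epsilon> = min (\<delta> ^ ?n) (e / (2 * ?c))"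
    have c: "0 < ?c" by simp
    have "0 < \<epsilon>" "\<epsilon> \<le> \<delta> ^ ?n" using that \<open>0 < e\<close> c by (auto simp: \<epsilon>_def)
    then have "hausdorff_pre_measure (?n - 1) \<delta> E \<le> ennreal (2 * ?c * \<epsilon>)" using that by (intro le) auto
    also have "2 * ?c * \<epsilon> \<le> 2 * ?c * (e / (2 * ?c))" using c by (intro mult_left_mono) (auto simp: \<epsilon>_def)
    also have "\<dots> = e" using c by (metis less_numeral_extra(3) mult_eq_0_iff nonzero_mult_div_cancel_left times_divide_eq_right zero_neq_numeral)
    finally show "hausdorff_pre_measure (?n - 1) \<delta> E \<le> 0 + ennreal e" by (simp add: ennreal_leI)
  qed
  then have "hausdorff_outer_measure (?n - 1) E \<le> 0"
    unfolding hausdorff_outer_measure_def by (rule SUP_least)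
  then show ?thesis by simp
qed

section \<open>The surface measure of the sphere\<close>

lemma sphere_in_sets_hausdorff: "sphere c r \<in> sets (hausdorff_measure d :: 'a::euclidean_space measure)"
  by (intro closed_in_sets_hausdorff) simp

lemma space_sphere_measure [simp]: "space (sphere_measure :: 'a::euclidean_space measure) = unit_sphere"
  by (simp add: sphere_measure_def space_restrict_space)

lemma sets_sphere_measure_iff:
  "A \<in> sets (sphere_measure :: 'a::euclidean_space measure) \<longleftrightarrow>
     A \<subseteq> unit_sphere \<and> A \<in> sets (hausdorff_measure (DIM('a) - 1))"
  unfolding sphere_measure_def
  by (subst sets_restrict_space_iff) (auto simp: sphere_in_sets_hausdorff)

lemma emeasure_sphere_measure:
  assumes "A \<in> sets (sphere_measure :: 'a::euclidean_space measure)"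
  shows "emeasure sphere_measure A = hausdorff_outer_measure (DIM('a) - 1) A"
proof -
  have "emeasure (sphere_measure :: 'a measure) A = emeasure (hausdorff_measure (DIM('a) - 1)) A"
    using assms sets_sphere_measure_iff[of A] unfolding sphere_measure_def
    by (intro emeasure_restrict_space) (auto simp: sphere_in_sets_hausdorff)
  then show ?thesis using assms by (simp add: sets_sphere_measure_iff emeasure_hausdorff_measure)
qed

lemma borel_sets_sphere_measure:
  "sets (restrict_space borel (unit_sphere :: 'a::euclidean_space set)) \<subseteq> sets sphere_measure"
  using borel_sets_hausdorff by (auto simp: sphere_measure_def sets_restrict_space)

lemma measurable_sphere_measureI:
  assumes "f \<in> measurable (restrict_space borel (unit_sphere :: 'a::euclidean_space set)) N"
  shows "f \<in> measurable sphere_measure N"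
proof (rule measurableI)
  fix x :: 'a assume "x \<in> space sphere_measure"
  then show "f x \<in> space N" using measurable_space[OF assms] by (simp add: space_restrict_space)
next
  fix A assume "A \<in> sets N"
  then have "f -` A \<inter> space (restrict_space borel unit_sphere) \<in> sets (restrict_space borel (unit_sphere :: 'a set))"
    using assms by (rule measurable_sets[rotated])
  then show "f -` A \<inter> space sphere_measure \<in> sets (sphere_measure :: 'a measure)"
    using borel_sets_sphere_measure by (auto simp: space_restrict_space)
qed

lemma measurable_sphere_measure_continuous:
  fixes f :: "'a::euclidean_space \<Rightarrow> 'b::topological_space"
  assumes "continuous_on unit_sphere f"
  shows "f \<in> borel_measurable sphere_measure"
  using assms by (intro measurable_sphere_measureI borel_measurable_continuous_on_restrict)

lemma finite_sphere_measure: "finite_measure (sphere_measure :: 'a::euclidean_space measure)"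
proof
  have "(unit_sphere :: 'a set) \<in> sets sphere_measure"
    using sets.top[of "sphere_measure :: 'a measure"] by simp
  then show "emeasure (sphere_measure :: 'a measure) (space sphere_measure) \<noteq> \<infinity>"
    using hausdorff_outer_measure_sphere_finite[where 'a='a] by (simp add: emeasure_sphere_measure)
qed

lemma null_sets_sphere_measureI:
  assumes "N \<subseteq> (unit_sphere :: 'a::euclidean_space set)" "hausdorff_outer_measure (DIM('a) - 1) N = 0"
  shows "N \<in> null_sets sphere_measure"
  using assms hausdorff_null_sets[OF assms(2)]
  by (auto simp: null_sets_def sets_sphere_measure_iff emeasure_sphere_measure)

lemma complete_sphere_measure:
  assumes "N \<in> null_sets sphere_measure" "M \<subseteq> (N :: 'a::euclidean_space set)"
  shows "M \<in> null_sets sphere_measure"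
proof (rule null_sets_sphere_measureI)
  have N: "N \<in> sets sphere_measure" "emeasure sphere_measure N = 0" using assms(1) by (auto simp: null_sets_def)
  then show "M \<subseteq> unit_sphere" using assms(2) by (auto simp: sets_sphere_measure_iff)
  have "hausdorff_outer_measure (DIM('a) - 1) M \<le> hausdorff_outer_measure (DIM('a) - 1) N"
    using assms(2) by (rule hausdorff_outer_measure_mono)
  then show "hausdorff_outer_measure (DIM('a) - 1) M = 0" using N by (simp add: emeasure_sphere_measure)
qed

lemma hausdorff_outer_measure_uminus:
  "hausdorff_outer_measure d (uminus ` A) = hausdorff_outer_measure d (A :: 'a::euclidean_space set)"
proof (rule antisym)
  show le: "hausdorff_outer_measure d (uminus ` A) \<le> hausdorff_outer_measure d A" for A :: "'a set"
    by (rule hausdorff_outer_measure_isometry) (simp add: dist_norm norm_minus_commute)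
  show "hausdorff_outer_measure d A \<le> hausdorff_outer_measure d (uminus ` A)"
    using le[of "uminus ` A"] by (simp add: image_image)
qed

lemma sets_hausdorff_uminus:
  assumes "A \<in> sets (hausdorff_measure d :: 'a::euclidean_space measure)"
  shows "uminus ` A \<in> sets (hausdorff_measure d :: 'a measure)"
proof -
  let ?H = "hausdorff_outer_measure d"
  have *: "B \<in> sets (hausdorff_measure d :: 'a measure) \<longleftrightarrow> (\<forall>X. ?H (X \<inter> B) + ?H (X - B) = ?H X)" for B :: "'a set"
    unfolding sets_hausdorff_measure algebra.lambda_system_eq[OF sigma_algebra.axioms(1)[OF sigma_algebra_Pow]]
    by auto
  show ?thesis unfolding *
  proof
    fix X :: "'a set"
    have "X \<inter> uminus ` A = uminus ` (uminus ` X \<inter> A)" "X - uminus ` A = uminus ` (uminus ` X - A)"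
      by (force simp: image_iff)+
    then show "?H (X \<inter> uminus ` A) + ?H (X - uminus ` A) = ?H X"
      using assms[unfolded *] by (simp add: hausdorff_outer_measure_uminus)
  qed
qed

lemma uminus_in_sets_sphere_measure:
  fixes A :: "'a::euclidean_space set"
  assumes A: "A \<in> sets sphere_measure"
  shows "uminus -` A \<inter> unit_sphere = uminus ` A" "uminus ` A \<in> sets sphere_measure"
  using A sets_hausdorff_uminus by (force simp: image_iff sets_sphere_measure_iff)+

lemma uminus_measurable_sphere_measure:
  "uminus \<in> measurable sphere_measure (sphere_measure :: 'a::euclidean_space measure)"
  by (rule measurableI) (simp_all add: uminus_in_sets_sphere_measure)

lemma distr_sphere_measure_uminus:
  "distr sphere_measure sphere_measure uminus = (sphere_measure :: 'a::euclidean_space measure)"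
proof (rule measure_eqI)
  fix A :: "'a set" assume "A \<in> sets (distr sphere_measure sphere_measure uminus)"
  then have A: "A \<in> sets sphere_measure" by simp
  then have "emeasure (distr sphere_measure sphere_measure uminus) A = emeasure sphere_measure (uminus ` A)"
    by (simp add: emeasure_distr[OF uminus_measurable_sphere_measure] uminus_in_sets_sphere_measure)
  also have "\<dots> = emeasure sphere_measure A"
    using A uminus_in_sets_sphere_measure(2)[OF A]
    by (simp add: emeasure_sphere_measure hausdorff_outer_measure_uminus)
  finally show "emeasure (distr sphere_measure sphere_measure uminus) A = emeasure sphere_measure A" .
qed simp

text \<open>
  The reflection in the hyperplane that bisects \<open>u\<close> and \<open>v\<close>.
\<close>

lemma sphere_isometry_transitive:
  fixes u v :: "'a::euclidean_space"
  assumes "norm u = norm v"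
  obtains f :: "'a \<Rightarrow> 'a" where "\<And>x y. dist (f x) (f y) = dist x y" "f u = v" "f 0 = 0" "\<And>x. f (f x) = x"
proof (cases "u = v")
  case True
  then show ?thesis using that[of "\<lambda>x. x"] by simp
next
  case False
  define w where "w = u - v"
  define f where "f x = x - (2 * (x \<bullet> w) / (w \<bullet> w)) *\<^sub>R w" for x
  have w: "w \<bullet> w \<noteq> 0" using False by (simp add: w_def)
  have uv: "u \<bullet> u = v \<bullet> v" using assms by (simp add: norm_eq)
  have diff: "f x - f y = f (x - y)" for x y
    by (simp add: f_def inner_diff_left diff_divide_distrib algebra_simps)
  have "f x \<bullet> f x = x \<bullet> x" for x
    using w by (simp add: f_def inner_diff_left inner_diff_right inner_commute[of w x] field_simps)
  then have norm: "norm (f x) = norm x" for x by (simp add: norm_eq)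
  show ?thesis
  proof (rule that)
    show "dist (f x) (f y) = dist x y" for x y by (simp add: dist_norm diff norm)
    have uw: "2 * (u \<bullet> w) = w \<bullet> w" using uv by (simp add: w_def inner_diff_left inner_diff_right inner_commute)
    show "f u = v" using w unfolding f_def uw by (simp add: w_def)
    show "f 0 = 0" by (simp add: f_def)
    show "f (f x) = x" for x using w by (simp add: f_def inner_diff_left field_simps)
  qed
qed

text \<open>
  Reflections carry every ball of a given radius onto every other one. If one of them were null,
  then finitely many null balls would cover the sphere.
\<close>

lemma sphere_measure_ball_pos:
  fixes u :: "'a::euclidean_space"
  assumes pos: "emeasure sphere_measure (unit_sphere :: 'a set) \<noteq> 0" and u: "u \<in> unit_sphere" and "0 < r"
  shows "0 < emeasure sphere_measure (unit_sphere \<inter> ball u r)"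
proof (rule ccontr)
  assume nz: "\<not> ?thesis"
  have sets: "unit_sphere \<inter> ball v r \<in> sets sphere_measure" for v :: 'a
    using borel_sets_sphere_measure by (auto simp: sets_restrict_space)
  have zero: "hausdorff_outer_measure (DIM('a) - 1) (unit_sphere \<inter> ball u r) = 0"
    using nz sets[of u] by (simp add: emeasure_sphere_measure)
  have null: "unit_sphere \<inter> ball v r \<in> null_sets sphere_measure" if v: "v \<in> unit_sphere" for v :: 'a
  proof (rule null_sets_sphere_measureI)
    obtain f :: "'a \<Rightarrow> 'a" where f: "\<And>x y. dist (f x) (f y) = dist x y" "f u = v" "f 0 = 0" "\<And>x. f (f x) = x"
      using sphere_isometry_transitive[of u v] u v by auto
    have nf: "norm (f x) = norm x" for x using f(1)[of x 0] f(3) by simp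
    have "unit_sphere \<inter> ball v r \<subseteq> f ` (unit_sphere \<inter> ball u r)"
    proof
      fix x assume x: "x \<in> unit_sphere \<inter> ball v r"
      then have "f x \<in> unit_sphere \<inter> ball u r" using f(1)[of u "f x"] f(2,4) nf by auto
      then show "x \<in> f ` (unit_sphere \<inter> ball u r)" using f(4) by (metis imageI)
    qed
    then have "hausdorff_outer_measure (DIM('a) - 1) (unit_sphere \<inter> ball v r)
        \<le> hausdorff_outer_measure (DIM('a) - 1) (f ` (unit_sphere \<inter> ball u r))"
      by (rule hausdorff_outer_measure_mono)
    also have "\<dots> \<le> hausdorff_outer_measure (DIM('a) - 1) (unit_sphere \<inter> ball u r)"
      by (rule hausdorff_outer_measure_isometry[OF f(1)])
    finally show "hausdorff_outer_measure (DIM('a) - 1) (unit_sphere \<inter> ball v r) = 0" using zero by simp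
  qed simp
  have "(unit_sphere :: 'a set) \<subseteq> (\<Union>v\<in>unit_sphere. ball v r)" using \<open>0 < r\<close> by auto
  then obtain C :: "'a set" where C: "C \<subseteq> unit_sphere" "finite C" "unit_sphere \<subseteq> (\<Union>v\<in>C. ball v r)"
    using compactE_image[OF compact_sphere, of unit_sphere "\<lambda>v. ball v r" 0 1] by (metis open_ball)
  then have "unit_sphere = (\<Union>v\<in>C. unit_sphere \<inter> ball v r)" by auto
  moreover have "(\<Union>v\<in>C. unit_sphere \<inter> ball v r) \<in> null_sets sphere_measure"
    using C null by (intro null_sets.finite_UN) auto
  ultimately have "(unit_sphere :: 'a set) \<in> null_sets sphere_measure" by simp
  with pos show False by auto
qed

section \<open>Polar gauges, Wulff shapes and support functions\<close>

text \<open>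
  For \<open>a = 1/f\<close> with \<open>f > 0\<close> this is the Minkowski functional of the Wulff shape of \<open>f\<close>, and the
  support function of the convex hull of the vectors \<open>a(v) v\<close>. Parametrising by \<open>a\<close>
  makes the gauge a maximum of functions that are linear in \<open>a\<close>.
\<close>

definition polar_gauge :: "('a::euclidean_space \<Rightarrow> real) \<Rightarrow> 'a \<Rightarrow> real" where
  "polar_gauge a u = (SUP v\<in>unit_sphere. a v * (u \<bullet> v))"

definition wulff_shape :: "('a::euclidean_space \<Rightarrow> real) \<Rightarrow> 'a set" where
  "wulff_shape a = {x. \<forall>v\<in>unit_sphere. a v * (x \<bullet> v) \<le> 1}"

lemma unit_sphere_nonempty: "(unit_sphere :: 'a::euclidean_space set) \<noteq> {}"
  by (metis SOME_Basis mem_sphere_0 norm_Basis empty_iff)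

lemma polar_gauge_attained:
  fixes a :: "'a::euclidean_space \<Rightarrow> real"
  assumes "continuous_on unit_sphere a"
  obtains v where "v \<in> unit_sphere" "polar_gauge a u = a v * (u \<bullet> v)"
    "\<And>w. w \<in> unit_sphere \<Longrightarrow> a w * (u \<bullet> w) \<le> a v * (u \<bullet> v)"
proof -
  have "continuous_on unit_sphere (\<lambda>v. a v * (u \<bullet> v))"
    by (intro continuous_intros assms)
  then obtain v where v: "v \<in> unit_sphere" "\<forall>w\<in>unit_sphere. a w * (u \<bullet> w) \<le> a v * (u \<bullet> v)"
    using continuous_attains_sup[OF compact_sphere unit_sphere_nonempty] by blast
  have "polar_gauge a u = a v * (u \<bullet> v)"
    unfolding polar_gauge_def using v by (intro cSup_eq_maximum) auto
  then show ?thesis using v by (intro that) auto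
qed

lemma polar_gauge_upper:
  assumes "continuous_on unit_sphere a" "v \<in> unit_sphere"
  shows "a v * (u \<bullet> v) \<le> polar_gauge a u"
  using assms polar_gauge_attained[of a u] by metis

lemma polar_gauge_le_iff:
  assumes "continuous_on unit_sphere a"
  shows "polar_gauge a u \<le> c \<longleftrightarrow> (\<forall>v\<in>unit_sphere. a v * (u \<bullet> v) \<le> c)"
  using assms polar_gauge_attained[of a u] by (metis order_trans)

lemma polar_gauge_ge_self:
  assumes "continuous_on unit_sphere a" "u \<in> unit_sphere"
  shows "a u \<le> polar_gauge a u"
  using polar_gauge_upper[OF assms, of u] assms(2) by (simp add: norm_eq_1)

lemma polar_gauge_bound:
  assumes "continuous_on unit_sphere a" "\<And>v. v \<in> unit_sphere \<Longrightarrow> \<bar>a v\<bar> \<le> B"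
  shows "\<bar>polar_gauge a u\<bar> \<le> B * norm u"
proof -
  obtain v where v: "v \<in> unit_sphere" "polar_gauge a u = a v * (u \<bullet> v)"
    by (rule polar_gauge_attained[OF assms(1), of u])
  have "\<bar>a v * (u \<bullet> v)\<bar> \<le> B * norm u"
    using v assms(2)[OF v(1)] Cauchy_Schwarz_ineq2[of u v] by (auto simp: abs_mult intro!: mult_mono)
  then show ?thesis using v by simp
qed

text \<open>
  Joint continuity of the gauge, with explicit constants, in \<open>a\<close> (for the supremum norm) and in the
  point.
\<close>

lemma polar_gauge_perturb:
  assumes a: "continuous_on unit_sphere a" and b: "continuous_on unit_sphere b"
    and e: "\<And>v. v \<in> unit_sphere \<Longrightarrow> \<bar>a v - b v\<bar> \<le> e" and B: "\<And>v. v \<in> unit_sphere \<Longrightarrow> \<bar>b v\<bar> \<le> B"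
  shows "polar_gauge a u \<le> polar_gauge b w + e * norm u + B * norm (u - w)"
proof -
  obtain v where v: "v \<in> unit_sphere" "polar_gauge a u = a v * (u \<bullet> v)"
    by (rule polar_gauge_attained[OF a, of u])
  have "a v * (u \<bullet> v) = b v * (w \<bullet> v) + (a v - b v) * (u \<bullet> v) + b v * ((u - w) \<bullet> v)"
    by (simp add: algebra_simps)
  also have "b v * (w \<bullet> v) \<le> polar_gauge b w" using b v by (intro polar_gauge_upper)
  also have "(a v - b v) * (u \<bullet> v) \<le> \<bar>a v - b v\<bar> * \<bar>u \<bullet> v\<bar>" by (simp flip: abs_mult)
  also have "\<dots> \<le> e * norm u" using e[OF v(1)] v Cauchy_Schwarz_ineq2[of u v] by (intro mult_mono) auto
  also have "b v * ((u - w) \<bullet> v) \<le> \<bar>b v\<bar> * \<bar>(u - w) \<bullet> v\<bar>" by (simp flip: abs_mult)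
  also have "\<dots> \<le> B * norm (u - w)" using B[OF v(1)] v Cauchy_Schwarz_ineq2[of "u - w" v] by (intro mult_mono) auto
  finally show ?thesis using v by simp
qed

lemma continuous_on_sphere_bounded:
  fixes a :: "'a::euclidean_space \<Rightarrow> real"
  assumes "continuous_on unit_sphere a"
  obtains B where "0 < B" "\<forall>v\<in>unit_sphere. \<bar>a v\<bar> \<le> B"
proof -
  have "compact (a ` unit_sphere)" using assms by (intro compact_continuous_image) auto
  then obtain B where "0 < B" "\<forall>y\<in>a ` unit_sphere. norm y \<le> B" using compact_imp_bounded bounded_pos by metis
  then show ?thesis using that by auto
qed

lemma continuous_on_sphere_pos_lower:
  fixes a :: "'a::euclidean_space \<Rightarrow> real"
  assumes "continuous_on unit_sphere a" "\<And>v. v \<in> unit_sphere \<Longrightarrow> 0 < a v"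
  obtains m where "0 < m" "\<forall>v\<in>unit_sphere. m \<le> a v"
  using continuous_attains_inf[OF compact_sphere unit_sphere_nonempty assms(1)] assms(2) by blast

lemma polar_gauge_lipschitz:
  assumes a: "continuous_on unit_sphere a" and B: "\<And>v. v \<in> unit_sphere \<Longrightarrow> \<bar>a v\<bar> \<le> B"
  shows "\<bar>polar_gauge a u - polar_gauge a w\<bar> \<le> B * norm (u - w)"
  using polar_gauge_perturb[OF a a, of 0 B u w] polar_gauge_perturb[OF a a, of 0 B w u] B
  by (simp add: norm_minus_commute abs_le_iff)

lemma continuous_on_polar_gauge:
  assumes a: "continuous_on unit_sphere a"
  shows "continuous_on A (polar_gauge a)"
proof -
  obtain B where B: "0 < B" "\<forall>v\<in>unit_sphere. \<bar>a v\<bar> \<le> B"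
    by (rule continuous_on_sphere_bounded[OF a])
  note B = B(1) bspec[OF B(2)]
  then have "B-lipschitz_on A (polar_gauge a)"
    using polar_gauge_lipschitz[OF a B(2)] by (intro lipschitz_onI) (auto simp: dist_norm)
  then show ?thesis by (rule lipschitz_on_continuous_on)
qed

lemma wulff_shape_iff:
  assumes "continuous_on unit_sphere a"
  shows "x \<in> wulff_shape a \<longleftrightarrow> polar_gauge a x \<le> 1"
  using assms by (simp add: wulff_shape_def polar_gauge_le_iff)

lemma polar_gauge_scale:
  assumes "continuous_on unit_sphere a" "0 \<le> t"
  shows "polar_gauge a (t *\<^sub>R u) = t * polar_gauge a u"
proof -
  obtain v where v: "v \<in> unit_sphere" "polar_gauge a u = a v * (u \<bullet> v)"
    "\<And>w. w \<in> unit_sphere \<Longrightarrow> a w * (u \<bullet> w) \<le> a v * (u \<bullet> v)"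
    using polar_gauge_attained[OF assms(1), of u] by metis
  show ?thesis
  proof (rule antisym)
    show "polar_gauge a (t *\<^sub>R u) \<le> t * polar_gauge a u"
      unfolding polar_gauge_le_iff[OF assms(1)]
      using v mult_left_mono[OF v(3) assms(2)] by (simp add: mult_ac)
    show "t * polar_gauge a u \<le> polar_gauge a (t *\<^sub>R u)"
      using polar_gauge_upper[OF assms(1) v(1), of "t *\<^sub>R u"] v by (simp add: mult_ac)
  qed
qed

lemma radial_fun_wulff_shape:
  assumes a: "continuous_on unit_sphere a" "\<And>v. v \<in> unit_sphere \<Longrightarrow> 0 < a v" and u: "u \<in> unit_sphere"
  shows "radial_fun (wulff_shape a) u = 1 / polar_gauge a u"
proof -
  have p: "0 < polar_gauge a u" using polar_gauge_ge_self[OF a(1) u] a(2)[OF u] by linarith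
  have "{r. 0 \<le> r \<and> r *\<^sub>R u \<in> wulff_shape a} = {0 .. 1 / polar_gauge a u}"
    using p by (auto simp: wulff_shape_iff[OF a(1)] polar_gauge_scale[OF a(1)] field_simps)
  then show ?thesis using p by (simp add: radial_fun_def)
qed

lemma convex_body_o_wulff_shape:
  assumes a: "continuous_on unit_sphere a" "\<And>v. v \<in> unit_sphere \<Longrightarrow> 0 < a v"
  shows "convex_body_o (wulff_shape a)"
proof -
  obtain B where B: "0 < B" "\<forall>v\<in>unit_sphere. \<bar>a v\<bar> \<le> B"
    by (rule continuous_on_sphere_bounded[OF a(1)])
  note B = B(1) bspec[OF B(2)]
  obtain m where m: "0 < m" "\<forall>v\<in>unit_sphere. m \<le> a v"
    by (rule continuous_on_sphere_pos_lower[OF a])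
  note m = m(1) bspec[OF m(2)]
  have eq: "wulff_shape a = (\<Inter>v\<in>unit_sphere. {x. (a v *\<^sub>R v) \<bullet> x \<le> 1})"
    by (auto simp: wulff_shape_def inner_commute)
  have closed: "closed (wulff_shape a)" "convex (wulff_shape a)"
    unfolding eq by (intro closed_INT convex_INT ballI closed_halfspace_le convex_halfspace_le)+
  have bounded: "bounded (wulff_shape a)"
    unfolding bounded_iff
  proof (intro exI[of _ "1 / m"] ballI)
    fix x assume x: "x \<in> wulff_shape a"
    show "norm x \<le> 1 / m"
    proof (cases "x = 0")
      case False
      define u where "u = x /\<^sub>R norm x"
      have u: "u \<in> unit_sphere" "x = norm x *\<^sub>R u" using False by (auto simp: u_def)
      have eq: "norm x = x \<bullet> u" using u(1) by (subst (2) u(2)) (simp add: norm_eq_1)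
      have "m * norm x \<le> a u * norm x" using m(2)[OF u(1)] by (intro mult_right_mono) auto
      also have "a u * norm x = a u * (x \<bullet> u)" by (simp only: eq)
      also have "a u * (x \<bullet> u) \<le> 1" using x u(1) by (auto simp: wulff_shape_def)
      finally have "m * norm x \<le> 1" .
      then show ?thesis using m(1) by (simp add: field_simps)
    qed (use m in simp)
  qed
  have "ball 0 (1 / B) \<subseteq> wulff_shape a"
  proof
    fix x :: 'a assume x: "x \<in> ball 0 (1 / B)"
    have "polar_gauge a x \<le> B * norm x" using polar_gauge_bound[OF a(1) B(2), of x] by auto
    also have "\<dots> \<le> B * (1 / B)" using x B(1) by (intro mult_left_mono) auto
    also have "\<dots> = 1" using B(1) by simp
    finally show "x \<in> wulff_shape a" by (simp add: wulff_shape_iff[OF a(1)])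
  qed
  then have "ball 0 (1 / B) \<subseteq> interior (wulff_shape a)" by (rule interior_maximal) simp
  moreover have "(0::'a) \<in> ball 0 (1 / B)" using B(1) by simp
  ultimately have "0 \<in> interior (wulff_shape a)" by (rule subsetD)
  with closed bounded show ?thesis unfolding convex_body_o_def compact_eq_bounded_closed by blast
qed

lemma origin_symmetricI:
  assumes "\<And>x. x \<in> K \<Longrightarrow> - x \<in> K"
  shows "origin_symmetric K"
  unfolding origin_symmetric_def
proof
  show "K \<subseteq> uminus ` K" 
  proof
    fix x assume "x \<in> K"
    then show "x \<in> uminus ` K" using assms[of x] by (intro image_eqI[of _ _ "- x"]) auto
  qed
  show "uminus ` K \<subseteq> K" using assms by auto
qed

lemma origin_symmetricD: "origin_symmetric K \<Longrightarrow> x \<in> K \<Longrightarrow> - x \<in> K"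
  unfolding origin_symmetric_def by auto

lemma origin_symmetric_wulff_shape:
  assumes "\<And>v. v \<in> unit_sphere \<Longrightarrow> a (- v) = a v"
  shows "origin_symmetric (wulff_shape a)"
proof (rule origin_symmetricI)
  fix x assume x: "x \<in> wulff_shape a"
  show "- x \<in> wulff_shape a" unfolding wulff_shape_def
  proof (intro CollectI ballI)
    fix v :: 'a assume v: "v \<in> unit_sphere"
    then have "- v \<in> unit_sphere" by simp
    with x have "a (- v) * (x \<bullet> - v) \<le> 1" unfolding wulff_shape_def by blast
    then show "a v * (- x \<bullet> v) \<le> 1" using assms[OF v] by simp
  qed
qed

lemma support_fun_attained:
  fixes K :: "'a::euclidean_space set"
  assumes "compact K" "K \<noteq> {}"
  obtains x where "x \<in> K" "support_fun K v = v \<bullet> x" "\<forall>y\<in>K. v \<bullet> y \<le> v \<bullet> x"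
proof -
  have "continuous_on K (\<lambda>x. v \<bullet> x)" by (intro continuous_intros)
  then obtain x where x: "x \<in> K" "\<forall>y\<in>K. v \<bullet> y \<le> v \<bullet> x"
    using continuous_attains_sup[OF assms] by blast
  moreover have "support_fun K v = v \<bullet> x"
    unfolding support_fun_def using x by (intro cSup_eq_maximum) auto
  ultimately show ?thesis using that by blast
qed

lemma support_fun_upper:
  assumes "compact K" "x \<in> K"
  shows "v \<bullet> x \<le> support_fun K v"
proof -
  have "K \<noteq> {}" using assms by blast
  then obtain y where "support_fun K v = v \<bullet> y" "\<forall>z\<in>K. v \<bullet> z \<le> v \<bullet> y"
    by (rule support_fun_attained[OF assms(1)])
  then show ?thesis using assms(2) by simp
qed

lemma support_fun_lipschitz:
  assumes "compact K" "K \<noteq> {}" "\<And>x. x \<in> K \<Longrightarrow> norm x \<le> R"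
  shows "\<bar>support_fun K v - support_fun K w\<bar> \<le> R * norm (v - w)"
proof -
  have *: "support_fun K v \<le> support_fun K w + R * norm (v - w)" for v w
  proof -
    obtain x where x: "x \<in> K" "support_fun K v = v \<bullet> x" using support_fun_attained[OF assms(1,2)] by metis
    have "v \<bullet> x = w \<bullet> x + (v - w) \<bullet> x" by (simp add: inner_diff_left)
    also have "w \<bullet> x \<le> support_fun K w" using x assms by (intro support_fun_upper)
    also have "(v - w) \<bullet> x \<le> norm (v - w) * norm x" by (rule norm_cauchy_schwarz)
    also have "\<dots> \<le> norm (v - w) * R" using assms(3)[OF x(1)] by (intro mult_left_mono) auto
    finally show ?thesis using x by (simp add: mult.commute)
  qed
  show ?thesis using *[of v w] *[of w v] by (simp add: norm_minus_commute abs_le_iff)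
qed

lemma convex_body_oD:
  assumes "convex_body_o K"
  shows "compact K" "convex K" "0 \<in> interior K" "0 \<in> K" "K \<noteq> {}" "closed K"
  using assms interior_subset by (auto simp: convex_body_o_def compact_imp_closed)

lemma convex_body_o_ball:
  assumes "convex_body_o K"
  obtains r where "0 < r" "cball 0 r \<subseteq> K"
proof -
  obtain e where "0 < e" "cball 0 e \<subseteq> interior K"
    using convex_body_oD(3)[OF assms] open_contains_cball[of "interior K"] by auto
  then show ?thesis using that interior_subset by blast
qed

lemma support_fun_pos:
  assumes "convex_body_o K" "v \<in> unit_sphere"
  shows "0 < support_fun K v"
proof -
  obtain r where r: "0 < r" "cball 0 r \<subseteq> K" using convex_body_o_ball[OF assms(1)] .
  have "v \<bullet> (r *\<^sub>R v) \<le> support_fun K v"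
    using r assms by (intro support_fun_upper convex_body_oD) auto
  then show ?thesis using r(1) assms(2) by (simp add: norm_eq_1)
qed

lemma continuous_on_support_fun:
  assumes "convex_body_o K"
  shows "continuous_on A (support_fun K)"
proof -
  note K = convex_body_oD[OF assms]
  obtain R where R: "0 < R" "\<And>x. x \<in> K \<Longrightarrow> norm x \<le> R"
    using compact_imp_bounded[OF K(1)] bounded_pos by metis
  then have "R-lipschitz_on A (support_fun K)"
    using support_fun_lipschitz[OF K(1,5) R(2)] by (intro lipschitz_onI) (auto simp: dist_norm)
  then show ?thesis by (rule lipschitz_on_continuous_on)
qed

abbreviation inv_support :: "'a::euclidean_space set \<Rightarrow> 'a \<Rightarrow> real" where
  "inv_support K \<equiv> (\<lambda>v. 1 / support_fun K v)"

lemma continuous_on_inv_support: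
  assumes "convex_body_o K"
  shows "continuous_on unit_sphere (inv_support K)"
  using support_fun_pos[OF assms] by (intro continuous_intros continuous_on_support_fun assms) force

lemma inv_support_pos: "convex_body_o K \<Longrightarrow> v \<in> unit_sphere \<Longrightarrow> 0 < inv_support K v"
  using support_fun_pos by auto

text \<open>
  A closed convex set is the intersection of its supporting halfspaces.
\<close>

lemma wulff_shape_inv_support:
  assumes "convex_body_o K"
  shows "wulff_shape (inv_support K) = K"
proof
  note K = convex_body_oD[OF assms]
  show "K \<subseteq> wulff_shape (inv_support K)"
    using support_fun_upper[OF K(1)] support_fun_pos[OF assms]
    by (auto simp: wulff_shape_def divide_simps inner_commute)
  show "wulff_shape (inv_support K) \<subseteq> K"
  proof (rule ccontr)
    assume "\<not> ?thesis"
    then obtain x where x: "x \<in> wulff_shape (inv_support K)" "x \<notin> K" by blast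
    obtain a b where ab: "a \<bullet> x < b" "\<forall>y\<in>K. a \<bullet> y > b"
      using separating_hyperplane_closed_point[OF K(2,6) x(2)] by metis
    have "b < 0" using ab(2) K(4) by force
    then have "a \<noteq> 0" using ab(1) by auto
    define v where "v = - (a /\<^sub>R norm a)"
    have v: "v \<in> unit_sphere" using \<open>a \<noteq> 0\<close> by (simp add: v_def)
    obtain y where y: "y \<in> K" "support_fun K v = v \<bullet> y" using support_fun_attained[OF K(1,5)] by metis
    have "a \<bullet> x < a \<bullet> y" using ab y by force
    then have "v \<bullet> y < v \<bullet> x" using \<open>a \<noteq> 0\<close> by (simp add: v_def divide_simps)
    then have "support_fun K v < x \<bullet> v" using y by (simp add: inner_commute)
    moreover have "inv_support K v * (x \<bullet> v) \<le> 1" using x(1) v by (simp add: wulff_shape_def)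
    ultimately show False using support_fun_pos[OF assms v] by (simp add: divide_simps)
  qed
qed

lemma radial_fun_eq_polar_gauge:
  assumes "convex_body_o K" "u \<in> unit_sphere"
  shows "radial_fun K u = 1 / polar_gauge (inv_support K) u"
  using radial_fun_wulff_shape[OF continuous_on_inv_support inv_support_pos, OF assms(1) assms(1) _ assms(2)]
  by (simp add: wulff_shape_inv_support[OF assms(1)])

lemma polar_gauge_pos:
  assumes "continuous_on unit_sphere a" "\<And>v. v \<in> unit_sphere \<Longrightarrow> 0 < a v" "u \<in> unit_sphere"
  shows "0 < polar_gauge a u"
  using polar_gauge_ge_self[of a u] assms by force

text \<open>
  The outer normals in direction \<open>u\<close> are the maximisers that define the gauge at \<open>u\<close>.
\<close>

lemma outer_normal_at_iff:
  assumes K: "convex_body_o K" and u: "u \<in> unit_sphere"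
  shows "outer_normal_at K u v \<longleftrightarrow> v \<in> unit_sphere \<and> inv_support K v * (u \<bullet> v) = polar_gauge (inv_support K) u"
proof (cases "v \<in> unit_sphere")
  case True
  have "0 < polar_gauge (inv_support K) u"
    using polar_gauge_pos[OF continuous_on_inv_support inv_support_pos] K u by blast
  then show ?thesis using True support_fun_pos[OF K True]
    by (auto simp: outer_normal_at_def radial_fun_eq_polar_gauge[OF K u] field_simps inner_commute)
qed (simp add: outer_normal_at_def)

lemma support_fun_wulff_shape_le:
  assumes a: "continuous_on unit_sphere a" "\<And>v. v \<in> unit_sphere \<Longrightarrow> 0 < a v" and v: "v \<in> unit_sphere"
  shows "support_fun (wulff_shape a) v \<le> 1 / a v"
proof -
  note K = convex_body_oD[OF convex_body_o_wulff_shape[OF a]]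
  obtain x where x: "x \<in> wulff_shape a" "support_fun (wulff_shape a) v = v \<bullet> x"
    using support_fun_attained[OF K(1,5)] by metis
  then have "a v * (x \<bullet> v) \<le> 1" using v by (simp add: wulff_shape_def)
  then show ?thesis using x a(2)[OF v] by (simp add: field_simps inner_commute)
qed

text \<open>
  The support function of a Wulff shape may be strictly smaller than the function that defines it,
  but both define the same body.
\<close>

lemma polar_gauge_inv_support_wulff_shape:
  assumes a: "continuous_on unit_sphere a" "\<And>v. v \<in> unit_sphere \<Longrightarrow> 0 < a v" and u: "u \<in> unit_sphere"
  shows "polar_gauge (inv_support (wulff_shape a)) u = polar_gauge a u"
proof -
  have "1 / polar_gauge (inv_support (wulff_shape a)) u = 1 / polar_gauge a u"
    using radial_fun_eq_polar_gauge[OF convex_body_o_wulff_shape[OF a] u] radial_fun_wulff_shape[OF a u] by simp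
  then show ?thesis by (metis divide_divide_eq_right mult_1 div_by_1)
qed

lemma support_fun_uminus:
  assumes "origin_symmetric K"
  shows "support_fun K (- v) = support_fun K v"
proof -
  have "K = uminus ` K" using assms by (simp add: origin_symmetric_def)
  then have "(\<lambda>x. - v \<bullet> x) ` K = (\<lambda>x. - v \<bullet> x) ` (uminus ` K)" by (rule arg_cong)
  then show ?thesis by (simp add: support_fun_def image_image)
qed

lemma radial_fun_uminus:
  assumes "origin_symmetric K"
  shows "radial_fun K (- u) = radial_fun K u"
proof -
  have "r *\<^sub>R - u \<in> K \<longleftrightarrow> r *\<^sub>R u \<in> K" for r
    using origin_symmetricD[OF assms, of "r *\<^sub>R u"] origin_symmetricD[OF assms, of "r *\<^sub>R - u"] by auto
  then show ?thesis by (simp add: radial_fun_def)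
qed

lemma outer_normal_at_uminus:
  assumes "origin_symmetric K"
  shows "outer_normal_at K (- u) (- v) \<longleftrightarrow> outer_normal_at K u v"
  using assms by (simp add: outer_normal_at_def radial_fun_uminus support_fun_uminus)

text \<open>
  By compactness almost-maximisers converge to a unique maximiser. This gives both the continuity of
  the radial Gauss map and the differentiability of the gauge.
\<close>

lemma polar_gauge_maximizer_tendsto:
  fixes a :: "'a::euclidean_space \<Rightarrow> real"
  assumes a: "continuous_on unit_sphere a"
    and uniq: "\<And>w. w \<in> unit_sphere \<Longrightarrow> a w * (u \<bullet> w) = polar_gauge a u \<Longrightarrow> w = v"
    and vs: "\<And>k. vs k \<in> unit_sphere" and lim: "(\<lambda>k. a (vs k) * (u \<bullet> vs k)) \<longlonglongrightarrow> polar_gauge a u"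
  shows "vs \<longlonglongrightarrow> v"
proof (rule metric_LIMSEQ_I)
  fix e :: real assume "0 < e"
  define C where "C = unit_sphere - ball v e"
  show "\<exists>no. \<forall>n\<ge>no. dist (vs n) v < e"
  proof (cases "C = {}")
    case True
    then have "vs n \<in> ball v e" for n using vs[of n] by (auto simp: C_def)
    then show ?thesis by (auto simp: dist_commute)
  next
    case False
    have "compact C" unfolding C_def by (intro compact_diff) auto
    moreover have "continuous_on C (\<lambda>w. a w * (u \<bullet> w))"
      by (intro continuous_intros continuous_on_subset[OF a]) (auto simp: C_def)
    ultimately obtain w where w: "w \<in> C" "\<forall>x\<in>C. a x * (u \<bullet> x) \<le> a w * (u \<bullet> w)"
      using continuous_attains_sup False by blast
    have "w \<in> unit_sphere" "w \<noteq> v" using w(1) \<open>0 < e\<close> by (auto simp: C_def)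
    then have "a w * (u \<bullet> w) < polar_gauge a u"
      using uniq polar_gauge_upper[OF a, of w u] by force
    then have "\<forall>\<^sub>F k in sequentially. a w * (u \<bullet> w) < a (vs k) * (u \<bullet> vs k)"
      using lim by (simp add: order_tendsto_iff)
    then obtain no where "\<forall>n\<ge>no. a w * (u \<bullet> w) < a (vs n) * (u \<bullet> vs n)"
      by (auto simp: eventually_sequentially)
    then have "\<forall>n\<ge>no. vs n \<notin> C" using w(2) by force
    then show ?thesis using vs by (auto simp: C_def dist_commute)
  qed
qed

lemma continuous_on_radial_gauss:
  fixes K :: "'a::euclidean_space set"
  assumes K: "convex_body_o K" and D: "D \<subseteq> unit_sphere" and uniq: "\<And>u. u \<in> D \<Longrightarrow> \<exists>!v. outer_normal_at K u v"
  shows "continuous_on D (radial_gauss K)"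
proof (rule continuous_on_sequentiallyI)
  fix us :: "nat \<Rightarrow> 'a" and u assume us: "\<forall>n. us n \<in> D" and u: "u \<in> D" and "us \<longlonglongrightarrow> u"
  note us = us \<open>us \<longlonglongrightarrow> u\<close>
  let ?a = "inv_support K"
  note a = continuous_on_inv_support[OF K]
  have nrm: "outer_normal_at K w (radial_gauss K w)" if "w \<in> D" for w
    unfolding radial_gauss_def using uniq[OF that] by (rule theI')
  obtain B where B: "0 < B" "\<forall>v\<in>unit_sphere. \<bar>?a v\<bar> \<le> B"
    by (rule continuous_on_sphere_bounded[OF a])
  note B = B(1) bspec[OF B(2)]
  have S: "radial_gauss K (us k) \<in> unit_sphere" for k
    using nrm[of "us k"] us(1) unfolding outer_normal_at_def by blast
  show "(\<lambda>k. radial_gauss K (us k)) \<longlonglongrightarrow> radial_gauss K u"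
  proof (rule polar_gauge_maximizer_tendsto[OF a])
    show "w = radial_gauss K u" if "w \<in> unit_sphere" "?a w * (u \<bullet> w) = polar_gauge ?a u" for w
    proof -
      have "outer_normal_at K u w" using that D u by (subst outer_normal_at_iff[OF K]) auto
      then show ?thesis using uniq[OF u] nrm[OF u] by blast
    qed
    (* The normal at a direction close to u is an almost-maximiser at u. *)
    have ge: "polar_gauge ?a (us k) - B * norm (us k - u) \<le> ?a (radial_gauss K (us k)) * (u \<bullet> radial_gauss K (us k))" for k
    proof -
      let ?v = "radial_gauss K (us k)"
      have "polar_gauge ?a (us k) = ?a ?v * (us k \<bullet> ?v)"
        using nrm[of "us k"] us(1) D outer_normal_at_iff[OF K, of "us k" ?v] by (metis subsetD)
      also have "\<dots> = ?a ?v * (u \<bullet> ?v) + ?a ?v * ((us k - u) \<bullet> ?v)" by (simp add: inner_diff_left algebra_simps)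
      also have "?a ?v * ((us k - u) \<bullet> ?v) \<le> \<bar>?a ?v\<bar> * \<bar>(us k - u) \<bullet> ?v\<bar>" by (simp only: abs_mult[symmetric] abs_ge_self)
      also have "\<dots> \<le> B * norm (us k - u)"
        using B(2)[OF S] S Cauchy_Schwarz_ineq2[of "us k - u" ?v] B(1) by (intro mult_mono) auto
      finally show ?thesis by simp
    qed
    have "continuous_on UNIV (polar_gauge ?a)" by (rule continuous_on_polar_gauge[OF a])
    then have "(\<lambda>k. polar_gauge ?a (us k)) \<longlonglongrightarrow> polar_gauge ?a u"
      using us(2) by (rule continuous_on_tendsto_compose) auto
    moreover have "(\<lambda>k. B * norm (us k - u)) \<longlonglongrightarrow> B * norm (u - u)"
      by (intro tendsto_intros us)
    ultimately have "(\<lambda>k. polar_gauge ?a (us k) - B * norm (us k - u)) \<longlonglongrightarrow> polar_gauge ?a u - B * norm (u - u)"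
      by (rule tendsto_diff)
    then have lo: "(\<lambda>k. polar_gauge ?a (us k) - B * norm (us k - u)) \<longlonglongrightarrow> polar_gauge ?a u" by simp
    show "(\<lambda>k. ?a (radial_gauss K (us k)) * (u \<bullet> radial_gauss K (us k))) \<longlonglongrightarrow> polar_gauge ?a u"
      by (rule tendsto_sandwich[OF always_eventually always_eventually lo tendsto_const])
        (use ge polar_gauge_upper[OF a S] in blast)+
  qed (rule S)
qed

section \<open>Almost everywhere uniqueness of maximisers\<close>

lemma emeasure_lborel_translation:
  fixes C :: "'a::euclidean_space set"
  assumes "C \<in> sets borel"
  shows "emeasure lborel ((+) w -` C) = emeasure lborel C"
proof -
  have "emeasure lborel C = emeasure (distr lborel borel ((+) w)) C" by (simp only: lborel_distr_plus)
  also have "\<dots> = emeasure lborel ((+) w -` C \<inter> space lborel)" using assms by (intro emeasure_distr) auto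
  finally show ?thesis by simp
qed

text \<open>
  A substitute for Fubini's theorem: \<open>M\<close> translates of a bounded part of \<open>B\<close> by different multiples
  of \<open>e\<close> cover no point more than \<open>N\<close> times, so \<open>M\<close> times its measure is bounded independently of
  \<open>M\<close>.
\<close>

lemma null_if_few_points_on_lines:
  fixes B :: "'a::euclidean_space set" and e :: 'a
  assumes B: "B \<in> sets borel" and few: "\<And>x. finite {t. x + t *\<^sub>R e \<in> B} \<and> card {t. x + t *\<^sub>R e \<in> B} \<le> N"
  shows "B \<in> null_sets lborel"
proof -
  have zero: "emeasure lborel (B \<inter> cball 0 r) = 0" for r
  proof (rule ccontr)
    let ?C = "B \<inter> cball 0 r" and ?D = "cball (0::'a) (r + norm e)"
    assume nz: "emeasure lborel ?C \<noteq> 0"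
    have Cfin: "emeasure lborel ?C < \<infinity>"
      using emeasure_lborel_cball_finite[of "0::'a" r] emeasure_mono[of ?C "cball 0 r" lborel] by (metis Int_lower2 le_less_trans sets_lborel borel_closed closed_cball)
    have Dfin: "emeasure lborel ?D < \<infinity>" by (rule emeasure_lborel_cball_finite)
    have CB: "?C \<in> sets borel" using B by auto
    have le: "of_nat M * emeasure lborel ?C \<le> of_nat N * emeasure lborel ?D" for M :: nat
    proof -
      define t where "t j = real j / real M" for j
      let ?T = "\<lambda>j. (+) (t j *\<^sub>R e) -` ?C"
      have TB: "?T j \<in> sets borel" for j
      proof -
        have "(+) (t j *\<^sub>R e) -` ?C \<inter> space borel \<in> sets borel"
          by (rule measurable_sets[OF _ CB]) simp
        then show ?thesis by simp
      qed
      have sum_le: "(\<Sum>j<M. indicator (?T j) x) \<le> of_nat N * (indicator ?D x :: ennreal)" for x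
      proof -
        let ?J = "{j. j < M \<and> t j *\<^sub>R e + x \<in> ?C}"
        have sum_eq: "(\<Sum>j<M. indicator (?T j) x) = (of_nat (card ?J) :: ennreal)"
          by (simp add: indicator_def sum.If_cases Int_def conj_commute flip: card_eq_sum)
        have "card ?J = card (t ` ?J)"
          by (rule card_image[symmetric]) (auto simp: inj_on_def t_def)
        also have "\<dots> \<le> card {t. x + t *\<^sub>R e \<in> B}"
          using few[of x] by (intro card_mono) (auto simp: add.commute)
        also have "\<dots> \<le> N" using few[of x] by simp
        finally have J: "card ?J \<le> N" .
        show ?thesis
        proof (cases "x \<in> ?D")
          case True
          then show ?thesis using J unfolding sum_eq by simp
        next
          case False
          have "?J = {}"
          proof (rule ccontr)
            assume "?J \<noteq> {}"
            then obtain j where j: "j < M" "t j *\<^sub>R e + x \<in> ?C" by blast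
            have "norm x \<le> norm (t j *\<^sub>R e + x) + norm (t j *\<^sub>R e)"
              using norm_triangle_ineq4[of "t j *\<^sub>R e + x" "t j *\<^sub>R e"] by simp
            also have "norm (t j *\<^sub>R e) \<le> 1 * norm e"
              unfolding norm_scaleR using j(1) by (intro mult_right_mono) (auto simp: t_def)
            finally show False using j(2) False by simp
          qed
          then show ?thesis unfolding sum_eq by (simp only: card.empty of_nat_0 zero_le)
        qed
      qed
      have "of_nat M * emeasure lborel ?C = (\<Sum>j<M. emeasure lborel (?T j))"
        by (subst emeasure_lborel_translation[OF CB]) simp
      also have "\<dots> = (\<Sum>j<M. \<integral>\<^sup>+x. indicator (?T j) x \<partial>lborel)" using TB by simp
      also have "\<dots> = (\<integral>\<^sup>+x. (\<Sum>j<M. indicator (?T j) x) \<partial>lborel)"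
        using TB by (intro nn_integral_sum[symmetric]) simp
      also have "\<dots> \<le> (\<integral>\<^sup>+x. of_nat N * indicator ?D x \<partial>lborel)"
        by (intro nn_integral_mono sum_le)
      also have "\<dots> = of_nat N * emeasure lborel ?D"
        by (simp add: nn_integral_cmult_indicator)
      finally show ?thesis .
    qed
    obtain c where c: "0 < c" "emeasure lborel ?C = ennreal c"
      using nz Cfin by (cases "emeasure lborel ?C") (auto simp: less_le)
    obtain d where d: "0 \<le> d" "emeasure lborel ?D = ennreal d"
      using Dfin by (cases "emeasure lborel ?D") auto
    have "real M * c \<le> real N * d" for M
    proof -
      have "ennreal (real M * c) \<le> ennreal (real N * d)"
        using le[of M] c d by (simp add: ennreal_mult ennreal_of_nat_eq_real_of_nat)
      then show ?thesis using d by simp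
    qed
    moreover obtain M where "real N * d < real M * c" using reals_Archimedean3[OF c(1)] by blast
    ultimately show False by (meson not_le)
  qed
  have "B = (\<Union>n. B \<inter> cball 0 (real n))"
  proof -
    have "\<exists>n. norm x \<le> real n" for x :: 'a by (rule real_arch_simple)
    then show ?thesis by auto
  qed
  moreover have "(\<Union>n. B \<inter> cball 0 (real n)) \<in> null_sets lborel"
    using zero B by (intro null_sets_UN) (auto simp: null_sets_def)
  ultimately show ?thesis by simp
qed

text \<open>
  Let \<open>B e m\<close> be the set of all \<open>x\<close> with two maximisers whose components along \<open>e\<close> differ by at least
  \<open>1/(m+1)\<close>. If \<open>x\<close> moves in direction \<open>e\<close>, the \<open>e\<close>-components of its maximisers increase, and they
  jump by at least \<open>1/(m+1)\<close> at each point of \<open>B e m\<close>. As they stay bounded, every line in direction \<open>e\<close>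
  meets \<open>B e m\<close> in a bounded number of points.
\<close>

lemma negligible_nonunique_maximizer:
  fixes Q :: "'a::euclidean_space set"
  assumes Q: "compact Q"
  shows "negligible {x. \<exists>w\<in>Q. \<exists>w'\<in>Q. w \<noteq> w' \<and> (\<forall>y\<in>Q. x \<bullet> y \<le> x \<bullet> w) \<and> (\<forall>y\<in>Q. x \<bullet> y \<le> x \<bullet> w')}"
proof -
  define mx where "mx x w \<longleftrightarrow> w \<in> Q \<and> (\<forall>y\<in>Q. x \<bullet> y \<le> x \<bullet> w)" for x w
  define B where "B e m = {x. \<exists>w w'. mx x w \<and> mx x w' \<and> 1 / real (Suc m) \<le> (w' - w) \<bullet> e}" for e m
  obtain L where L: "0 < L" "\<forall>w\<in>Q. norm w \<le> L" using compact_imp_bounded[OF Q] bounded_pos by metis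
  have closed: "closed (B e m)" for e m
  proof -
    let ?T = "{p. (\<forall>y\<in>Q. snd p \<bullet> y \<le> snd p \<bullet> fst (fst p)) \<and> (\<forall>y\<in>Q. snd p \<bullet> y \<le> snd p \<bullet> snd (fst p))
        \<and> 1 / real (Suc m) \<le> (snd (fst p) - fst (fst p)) \<bullet> e} :: (('a \<times> 'a) \<times> 'a) set"
    have T: "?T = (\<Inter>y\<in>Q. {p. snd p \<bullet> y \<le> snd p \<bullet> fst (fst p)}) \<inter> (\<Inter>y\<in>Q. {p. snd p \<bullet> y \<le> snd p \<bullet> snd (fst p)})
        \<inter> {p. 1 / real (Suc m) \<le> (snd (fst p) - fst (fst p)) \<bullet> e}" by auto
    have "closed ?T" unfolding T
      by (intro closed_Int closed_INT ballI closed_Collect_le continuous_intros)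
    then have "closed {x. \<exists>p. p \<in> Q \<times> Q \<and> (p, x) \<in> ?T}"
      by (intro closed_compact_projection compact_Times Q)
    also have "{x. \<exists>p. p \<in> Q \<times> Q \<and> (p, x) \<in> ?T} = B e m"
      unfolding B_def mx_def by auto
    finally show ?thesis .
  qed
  have null: "B e m \<in> null_sets lborel" if e: "e \<in> Basis" for e m
  proof (rule null_if_few_points_on_lines[where e=e])
    show "B e m \<in> sets borel" using closed by (intro borel_closed)
    fix x
    let ?S = "{t. x + t *\<^sub>R e \<in> B e m}"
    let ?k = "real (Suc m)"
    let ?I = "{\<lfloor>- (?k * L)\<rfloor>..\<lfloor>?k * L\<rfloor>}"
    have "\<forall>t\<in>?S. \<exists>p. mx (x + t *\<^sub>R e) (fst p) \<and> mx (x + t *\<^sub>R e) (snd p) \<and> 1 / ?k \<le> (snd p - fst p) \<bullet> e"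
      unfolding B_def by auto
    then obtain p where p: "\<And>t. t \<in> ?S \<Longrightarrow> mx (x + t *\<^sub>R e) (fst (p t)) \<and> mx (x + t *\<^sub>R e) (snd (p t)) \<and> 1 / ?k \<le> (snd (p t) - fst (p t)) \<bullet> e"
      by metis
    define F where "F t = \<lfloor>?k * (snd (p t) \<bullet> e)\<rfloor>" for t
    (* Adding the two maximality inequalities shows that maximisers are monotone along the line.
       Rounding makes the counting of the jumps an injection into an integer interval. *)
    have mono: "F t < F s" if t: "t \<in> ?S" and s: "s \<in> ?S" and "t < s" for t s
    proof -
      have "(x + s *\<^sub>R e) \<bullet> snd (p t) \<le> (x + s *\<^sub>R e) \<bullet> fst (p s)"
        "(x + t *\<^sub>R e) \<bullet> fst (p s) \<le> (x + t *\<^sub>R e) \<bullet> snd (p t)"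
        using p[OF t] p[OF s] unfolding mx_def by blast+
      then have "0 \<le> (s - t) * ((fst (p s) - snd (p t)) \<bullet> e)"
        by (simp add: inner_add_left inner_diff_left inner_commute[of _ e] algebra_simps)
      then have "snd (p t) \<bullet> e \<le> fst (p s) \<bullet> e"
        using \<open>t < s\<close> by (simp add: zero_le_mult_iff inner_diff_left)
      moreover have "1 / ?k \<le> snd (p s) \<bullet> e - fst (p s) \<bullet> e" using p[OF s] by (simp add: inner_diff_left)
      ultimately have "snd (p t) \<bullet> e + 1 / ?k \<le> snd (p s) \<bullet> e" by linarith
      then have "?k * (snd (p t) \<bullet> e + 1 / ?k) \<le> ?k * (snd (p s) \<bullet> e)" by (rule mult_left_mono) simp
      then have "?k * (snd (p t) \<bullet> e) + 1 \<le> ?k * (snd (p s) \<bullet> e)" by (simp add: distrib_left)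
      then have "\<lfloor>?k * (snd (p t) \<bullet> e) + 1\<rfloor> \<le> F s" unfolding F_def by (rule floor_mono)
      then show ?thesis unfolding F_def by simp
    qed
    have inj: "inj_on F ?S"
      by (rule linorder_inj_onI') (metis mono less_irrefl)
    have "F ` ?S \<subseteq> ?I"
    proof (rule image_subsetI)
      fix t assume t: "t \<in> ?S"
      have "snd (p t) \<in> Q" using p[OF t] by (simp add: mx_def)
      then have "\<bar>snd (p t) \<bullet> e\<bar> \<le> L" using Basis_le_norm[OF e, of "snd (p t)"] L(2) by force
      then have "?k * (snd (p t) \<bullet> e) \<le> ?k * L" "?k * (- L) \<le> ?k * (snd (p t) \<bullet> e)"
        by (intro mult_left_mono; simp add: abs_le_iff)+
      then have "F t \<le> \<lfloor>?k * L\<rfloor>" "\<lfloor>?k * (- L)\<rfloor> \<le> F t" 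
        unfolding F_def using floor_mono by blast+
      then show "F t \<in> ?I" by simp
    qed
    then have "finite ?S \<and> card ?S \<le> card ?I"
      using inj by (metis card_inj_on_le finite_atLeastAtMost_int inj_on_finite)
    then show "finite ?S \<and> card ?S \<le> card ?I" .
  qed
  have "{x. \<exists>w\<in>Q. \<exists>w'\<in>Q. w \<noteq> w' \<and> (\<forall>y\<in>Q. x \<bullet> y \<le> x \<bullet> w) \<and> (\<forall>y\<in>Q. x \<bullet> y \<le> x \<bullet> w')}
      \<subseteq> (\<Union>e\<in>Basis. \<Union>m. B e m)"
  proof
    fix x assume "x \<in> {x. \<exists>w\<in>Q. \<exists>w'\<in>Q. w \<noteq> w' \<and> (\<forall>y\<in>Q. x \<bullet> y \<le> x \<bullet> w) \<and> (\<forall>y\<in>Q. x \<bullet> y \<le> x \<bullet> w')}"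
    then obtain w w' where w: "w \<noteq> w'" "mx x w" "mx x w'" unfolding mx_def by blast
    obtain e where e: "e \<in> Basis" "w \<bullet> e \<noteq> w' \<bullet> e" using w(1) euclidean_eqI by blast
    obtain w1 w2 where w12: "mx x w1" "mx x w2" "0 < (w2 - w1) \<bullet> e"
    proof (cases "w \<bullet> e < w' \<bullet> e")
      case True then show ?thesis using w that[of w w'] by (simp add: inner_diff_left)
    next
      case False then show ?thesis using w e that[of w' w] by (simp add: inner_diff_left)
    qed
    obtain m where "1 / real (Suc m) < (w2 - w1) \<bullet> e" using w12(3) nat_approx_posE by blast
    then have "x \<in> B e m" unfolding B_def using w12 less_imp_le by blast
    then show "x \<in> (\<Union>e\<in>Basis. \<Union>m. B e m)" using e(1) by blast
  qed
  moreover have "negligible (\<Union>e\<in>Basis. \<Union>m. B e m)"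
  proof -
    have "negligible (B e m)" if "e \<in> Basis" for e m
      using null[OF that] by (simp add: negligible_iff_null_sets null_sets_completionI)
    then show ?thesis by (intro negligible_Union) (auto intro!: negligible_countable_Union)
  qed
  ultimately show ?thesis using negligible_subset by blast
qed

section \<open>The radial Gauss map and the curvature density\<close>

definition regular_directions :: "'a::euclidean_space set \<Rightarrow> 'a set" where
  "regular_directions K = {u \<in> unit_sphere. \<exists>!v. outer_normal_at K u v}"

lemma outer_normal_at_exists:
  assumes K: "convex_body_o K" and u: "u \<in> unit_sphere"
  shows "\<exists>v. outer_normal_at K u v"
proof -
  obtain v where "v \<in> unit_sphere" "polar_gauge (inv_support K) u = inv_support K v * (u \<bullet> v)"
    by (rule polar_gauge_attained[OF continuous_on_inv_support[OF K]])
  then show ?thesis using outer_normal_at_iff[OF K u] by metis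
qed

text \<open>
  Two normals \<open>v\<close> give two maximisers \<open>v / h(v)\<close> of the same linear functional over the compact set of
  all these vectors; they are distinct because a unit vector is determined by its positive multiples.
\<close>

lemma irregular_directions_null:
  fixes K :: "'a::euclidean_space set"
  assumes K: "convex_body_o K"
  shows "unit_sphere - regular_directions K \<in> null_sets sphere_measure"
proof -
  let ?a = "inv_support K"
  define Q where "Q = (\<lambda>v. ?a v *\<^sub>R v) ` unit_sphere"
  let ?N = "{x. \<exists>w\<in>Q. \<exists>w'\<in>Q. w \<noteq> w' \<and> (\<forall>y\<in>Q. x \<bullet> y \<le> x \<bullet> w) \<and> (\<forall>y\<in>Q. x \<bullet> y \<le> x \<bullet> w')}"
  note a = continuous_on_inv_support[OF K]
  have "compact Q" unfolding Q_def
    by (intro compact_continuous_image continuous_intros a) auto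
  then have N: "negligible ?N" by (rule negligible_nonunique_maximizer)
  have sub: "{t *\<^sub>R u |t u. 1 \<le> t \<and> t \<le> 2 \<and> u \<in> unit_sphere - regular_directions K} \<subseteq> ?N"
  proof
    fix x assume "x \<in> {t *\<^sub>R u |t u. 1 \<le> t \<and> t \<le> 2 \<and> u \<in> unit_sphere - regular_directions K}"
    then obtain t u where x: "x = t *\<^sub>R u" "1 \<le> t" "u \<in> unit_sphere" "\<not> (\<exists>!v. outer_normal_at K u v)"
      unfolding regular_directions_def by blast
    obtain v v' where v: "outer_normal_at K u v" "outer_normal_at K u v'" "v \<noteq> v'"
      using x(4) outer_normal_at_exists[OF K x(3)] by blast
    have max: "?a w *\<^sub>R w \<in> Q \<and> (\<forall>y\<in>Q. x \<bullet> y \<le> x \<bullet> (?a w *\<^sub>R w))" if w: "outer_normal_at K u w" for w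
    proof -
      have w': "w \<in> unit_sphere" "?a w * (u \<bullet> w) = polar_gauge ?a u"
        using w outer_normal_at_iff[OF K x(3)] by auto
      have "x \<bullet> (?a y *\<^sub>R y) \<le> x \<bullet> (?a w *\<^sub>R w)" if "y \<in> unit_sphere" for y
      proof -
        have "t * (?a y * (u \<bullet> y)) \<le> t * (?a w * (u \<bullet> w))"
          using x(2) polar_gauge_upper[OF a that, of u] unfolding w'(2) by (intro mult_left_mono) auto
        then show ?thesis unfolding x(1) by (simp add: mult_ac)
      qed
      then show ?thesis using w'(1) unfolding Q_def by blast
    qed
    have "?a v *\<^sub>R v \<noteq> ?a v' *\<^sub>R v'"
    proof
      assume eq: "?a v *\<^sub>R v = ?a v' *\<^sub>R v'"
      have S: "v \<in> unit_sphere" "v' \<in> unit_sphere" using v by (auto simp: outer_normal_at_def)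
      have pos: "0 < ?a v" "0 < ?a v'" using inv_support_pos[OF K] S by auto
      have "norm (?a v *\<^sub>R v) = norm (?a v' *\<^sub>R v')" using eq by simp
      then have "?a v = ?a v'" using S pos by simp
      then show False using eq pos v(3) by simp
    qed
    then show "x \<in> ?N" using max[OF v(1)] max[OF v(2)] by blast
  qed
  show ?thesis
    by (intro null_sets_sphere_measureI hausdorff_null_if_cone_negligible negligible_subset[OF N sub]) auto
qed

lemma radial_gauss_normal:
  assumes "u \<in> regular_directions K"
  shows "outer_normal_at K u (radial_gauss K u)" "radial_gauss K u \<in> unit_sphere"
    "outer_normal_at K u v \<Longrightarrow> v = radial_gauss K u"
proof -
  have ex: "\<exists>!v. outer_normal_at K u v" using assms by (simp add: regular_directions_def)
  show n: "outer_normal_at K u (radial_gauss K u)" unfolding radial_gauss_def using ex by (rule theI')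
  then show "radial_gauss K u \<in> unit_sphere" by (simp add: outer_normal_at_def)
  show "outer_normal_at K u v \<Longrightarrow> v = radial_gauss K u" using ex n by blast
qed

lemma regular_directions_subset: "regular_directions K \<subseteq> unit_sphere"
  by (auto simp: regular_directions_def)

lemma continuous_on_radial_gauss_regular:
  assumes "convex_body_o K"
  shows "continuous_on (regular_directions K) (radial_gauss K)"
  by (rule continuous_on_radial_gauss[OF assms regular_directions_subset]) (simp add: regular_directions_def)

lemma AE_regular:
  fixes K :: "'a::euclidean_space set"
  assumes "convex_body_o K" "\<And>u. u \<in> regular_directions K \<Longrightarrow> P u"
  shows "AE u in sphere_measure. P u"
  using irregular_directions_null[OF assms(1)] by (rule AE_I') (use assms(2) in auto)

lemma borel_Int_sphere_sets:
  fixes V :: "'a::euclidean_space set"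
  assumes "V \<in> sets borel"
  shows "V \<inter> unit_sphere \<in> sets sphere_measure"
  using assms by (intro subsetD[OF borel_sets_sphere_measure]) (auto simp: sets_restrict_space)

text \<open>
  Continuity off a null set suffices because the surface measure is complete.
\<close>

lemma measurable_AE_continuous:
  fixes f :: "'a::euclidean_space \<Rightarrow> 'b::topological_space"
  assumes D: "D \<subseteq> unit_sphere" "unit_sphere - D \<in> null_sets sphere_measure" and f: "continuous_on D f"
  shows "f \<in> borel_measurable sphere_measure"
proof (rule borel_measurableI)
  fix U :: "'b set" assume "open U"
  then obtain V where V: "open V" "V \<inter> D = f -` U \<inter> D"
    using f unfolding continuous_on_open_invariant by blast
  have "f -` U \<inter> space sphere_measure = (V \<inter> unit_sphere - (V \<inter> (unit_sphere - D))) \<union> (f -` U \<inter> (unit_sphere - D))"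
    using V D(1) by auto
  moreover have "V \<inter> unit_sphere \<in> sets sphere_measure"
    using V(1) by (intro borel_Int_sphere_sets) simp
  moreover have "V \<inter> (unit_sphere - D) \<in> null_sets sphere_measure" "f -` U \<inter> (unit_sphere - D) \<in> null_sets sphere_measure"
    by (rule complete_sphere_measure[OF D(2)], blast)+
  ultimately show "f -` U \<inter> space sphere_measure \<in> sets sphere_measure"
    by (metis null_setsD2 sets.Diff sets.Un)
qed

lemma measurable_regular:
  fixes f :: "'a::euclidean_space \<Rightarrow> 'b::topological_space"
  assumes "convex_body_o K" "continuous_on (regular_directions K) f"
  shows "f \<in> borel_measurable sphere_measure"
  by (rule measurable_AE_continuous[OF regular_directions_subset irregular_directions_null[OF assms(1)] assms(2)])

lemma radial_gauss_measurable:
  "convex_body_o K \<Longrightarrow> radial_gauss K \<in> borel_measurable sphere_measure"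
  by (rule measurable_regular[OF _ continuous_on_radial_gauss_regular])

lemma reverse_radial_gauss_regular_iff:
  assumes u: "u \<in> regular_directions K"
  shows "u \<in> reverse_radial_gauss K E \<longleftrightarrow> radial_gauss K u \<in> E"
proof
  assume "u \<in> reverse_radial_gauss K E"
  then obtain v where "v \<in> E" "outer_normal_at K u v" unfolding reverse_radial_gauss_def by blast
  then show "radial_gauss K u \<in> E" using radial_gauss_normal(3)[OF u] by blast
next
  assume "radial_gauss K u \<in> E"
  then show "u \<in> reverse_radial_gauss K E"
    using radial_gauss_normal(1)[OF u] u regular_directions_subset unfolding reverse_radial_gauss_def by blast
qed

lemma reverse_radial_gauss_sets:
  fixes K :: "'a::euclidean_space set"
  assumes K: "convex_body_o K" and E: "E \<in> sets borel"
  shows "reverse_radial_gauss K E \<in> sets sphere_measure"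
proof -
  let ?D = "regular_directions K"
  have eq: "reverse_radial_gauss K E
      = (radial_gauss K -` E \<inter> space sphere_measure - radial_gauss K -` E \<inter> (unit_sphere - ?D)) \<union> (reverse_radial_gauss K E \<inter> (unit_sphere - ?D))"
    using reverse_radial_gauss_regular_iff[of _ K E] regular_directions_subset[of K]
    by (auto simp: reverse_radial_gauss_def)
  have "radial_gauss K -` E \<inter> space sphere_measure \<in> sets sphere_measure"
    using radial_gauss_measurable[OF K] E by (rule measurable_sets)
  moreover have "radial_gauss K -` E \<inter> (unit_sphere - ?D) \<in> null_sets sphere_measure"
    "reverse_radial_gauss K E \<inter> (unit_sphere - ?D) \<in> null_sets sphere_measure"
    by (rule complete_sphere_measure[OF irregular_directions_null[OF K]], blast)+
  ultimately show ?thesis by (subst eq) (metis null_setsD2 sets.Diff sets.Un)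
qed

lemma radial_fun_continuous:
  assumes "convex_body_o K"
  shows "continuous_on unit_sphere (radial_fun K)"
proof -
  have "continuous_on unit_sphere (\<lambda>u. 1 / polar_gauge (inv_support K) u)"
    using polar_gauge_pos[OF continuous_on_inv_support inv_support_pos] assms
    by (intro continuous_intros continuous_on_polar_gauge continuous_on_inv_support) force+
  then show ?thesis by (rule continuous_on_eq) (simp add: radial_fun_eq_polar_gauge[OF assms])
qed

lemma radial_fun_pos:
  assumes "convex_body_o K" "u \<in> unit_sphere"
  shows "0 < radial_fun K u"
  using polar_gauge_pos[OF continuous_on_inv_support inv_support_pos] assms
  by (simp add: radial_fun_eq_polar_gauge)

lemma regular_directions_uminus:
  assumes "origin_symmetric K" "u \<in> regular_directions K"
  shows "- u \<in> regular_directions K" "radial_gauss K (- u) = - radial_gauss K u"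
proof -
  have *: "outer_normal_at K (- u) v \<longleftrightarrow> outer_normal_at K u (- v)" for v
    using outer_normal_at_uminus[OF assms(1), of u "- v"] by simp
  have "outer_normal_at K (- u) v \<longleftrightarrow> v = - radial_gauss K u" for v
    unfolding * using radial_gauss_normal[OF assms(2)] by (metis minus_minus)
  then have ex: "\<exists>!v. outer_normal_at K (- u) v" by auto
  then show D: "- u \<in> regular_directions K"
    using assms(2) by (simp add: regular_directions_def)
  have "outer_normal_at K (- u) (- radial_gauss K u)"
    unfolding * using radial_gauss_normal(1)[OF assms(2)] by simp
  then show "radial_gauss K (- u) = - radial_gauss K u" using radial_gauss_normal(3)[OF D] by metis
qed

lemma integral_sphere_measure_uminus:
  fixes f :: "'a::euclidean_space \<Rightarrow> real"
  assumes "f \<in> borel_measurable sphere_measure"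
  shows "(\<integral>u. f (- u) \<partial>sphere_measure) = (\<integral>u. f u \<partial>sphere_measure)"
proof -
  have "(\<integral>u. f u \<partial>distr sphere_measure sphere_measure uminus) = (\<integral>u. f (- u) \<partial>sphere_measure)"
    by (rule integral_distr[OF uminus_measurable_sphere_measure assms])
  then show ?thesis by (simp add: distr_sphere_measure_uminus)
qed

text \<open>
  That the sphere is not null is assumed here; for the given \<open>G\<close> it follows from the blow-up of the
  integrals over caps.
\<close>

locale dual_orlicz =
  fixes G :: "real \<Rightarrow> 'a::euclidean_space \<Rightarrow> real" and \<psi> :: "real \<Rightarrow> real"
  assumes G_pos: "\<And>t u. 0 < t \<Longrightarrow> u \<in> unit_sphere \<Longrightarrow> 0 < G t u"
    and G_cont: "continuous_on ({0<..} \<times> unit_sphere) (\<lambda>(t, u). G t u)"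
    and G_diff: "\<And>t u. 0 < t \<Longrightarrow> u \<in> unit_sphere \<Longrightarrow> (\<lambda>s. G s u) differentiable (at t)"
    and Gt_cont: "continuous_on ({0<..} \<times> unit_sphere) (\<lambda>(t, u). partial_t G t u)"
    and Gt_neg: "\<And>t u. 0 < t \<Longrightarrow> u \<in> unit_sphere \<Longrightarrow> partial_t G t u < 0"
    and Gt_even: "\<And>t u. 0 < t \<Longrightarrow> u \<in> unit_sphere \<Longrightarrow> partial_t G t (- u) = partial_t G t u"
    and sphere_nonnull: "emeasure sphere_measure (unit_sphere :: 'a set) \<noteq> 0"
    and \<psi>_pos: "\<And>t. 0 < t \<Longrightarrow> 0 < \<psi> t"
    and \<psi>_cont: "continuous_on {0<..} \<psi>"
begin

definition curvature_density :: "'a set \<Rightarrow> 'a \<Rightarrow> real" where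
  "curvature_density K u =
     radial_fun K u * partial_t G (radial_fun K u) u / \<psi> (support_fun K (radial_gauss K u))"

lemma continuous_on_G_comp:
  assumes "continuous_on A r" "A \<subseteq> unit_sphere" "\<And>u. u \<in> A \<Longrightarrow> 0 < r u"
  shows "continuous_on A (\<lambda>u. G (r u) u)" "continuous_on A (\<lambda>u. partial_t G (r u) u)"
proof -
  have "continuous_on A (\<lambda>u. (r u, u))" by (intro continuous_intros assms)
  moreover have "(\<lambda>u. (r u, u)) ` A \<subseteq> {0<..} \<times> unit_sphere" using assms by auto
  ultimately show "continuous_on A (\<lambda>u. G (r u) u)" "continuous_on A (\<lambda>u. partial_t G (r u) u)"
    using continuous_on_compose2[OF G_cont, of A "\<lambda>u. (r u, u)"]
      continuous_on_compose2[OF Gt_cont, of A "\<lambda>u. (r u, u)"] by (simp_all only: prod.case)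
qed

context
  fixes K :: "'a set"
  assumes K: "convex_body_o K"
begin

lemma radial_factor_bounded:
  obtains B where "0 < B" "\<forall>u\<in>unit_sphere. \<bar>radial_fun K u * partial_t G (radial_fun K u) u\<bar> \<le> B"
proof (rule continuous_on_sphere_bounded)
  show "continuous_on unit_sphere (\<lambda>u. radial_fun K u * partial_t G (radial_fun K u) u)"
    by (intro continuous_intros radial_fun_continuous[OF K] continuous_on_G_comp radial_fun_pos[OF K]) auto
qed

lemma psi_support_continuous: "continuous_on unit_sphere (\<lambda>v. \<psi> (support_fun K v))"
  by (rule continuous_on_compose2[OF \<psi>_cont continuous_on_support_fun[OF K]])
    (auto intro: support_fun_pos[OF K])

lemma psi_support_gauss_continuous:
  "continuous_on (regular_directions K) (\<lambda>u. \<psi> (support_fun K (radial_gauss K u)))"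
  by (rule continuous_on_compose2[OF psi_support_continuous continuous_on_radial_gauss_regular[OF K]])
    (use radial_gauss_normal(2) in blast)

lemma psi_support_gauss_pos:
  "u \<in> regular_directions K \<Longrightarrow> 0 < \<psi> (support_fun K (radial_gauss K u))"
  by (intro \<psi>_pos support_fun_pos[OF K] radial_gauss_normal)

lemma curvature_density_neg:
  assumes "u \<in> regular_directions K"
  shows "curvature_density K u < 0"
proof -
  have u: "u \<in> unit_sphere" using assms regular_directions_subset by blast
  have "radial_fun K u * partial_t G (radial_fun K u) u < 0"
    using radial_fun_pos[OF K u] Gt_neg[OF _ u] by (simp add: mult_less_0_iff)
  then show ?thesis using psi_support_gauss_pos[OF assms] by (simp add: curvature_density_def divide_less_0_iff)
qed

lemma radial_factor_continuous:
  "continuous_on unit_sphere (\<lambda>u. radial_fun K u * partial_t G (radial_fun K u) u)"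
  by (intro continuous_intros radial_fun_continuous[OF K] continuous_on_G_comp radial_fun_pos[OF K]) auto

lemma curvature_density_measurable [measurable]: "curvature_density K \<in> borel_measurable sphere_measure"
proof (rule measurable_regular[OF K])
  show "continuous_on (regular_directions K) (curvature_density K)"
    unfolding curvature_density_def
    using psi_support_gauss_pos
    by (intro continuous_intros psi_support_gauss_continuous
        continuous_on_subset[OF radial_factor_continuous regular_directions_subset]) force
qed

lemma curvature_density_integrable: "integrable sphere_measure (curvature_density K)"
proof -
  obtain B where B: "0 < B" "\<forall>u\<in>unit_sphere. \<bar>radial_fun K u * partial_t G (radial_fun K u) u\<bar> \<le> B"
    by (rule radial_factor_bounded)
  have "0 < \<psi> (support_fun K v)" if "v \<in> unit_sphere" for v
    using that by (intro \<psi>_pos support_fun_pos[OF K])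
  then obtain m where m: "0 < m" "\<forall>v\<in>unit_sphere. m \<le> \<psi> (support_fun K v)"
    by (rule continuous_on_sphere_pos_lower[OF psi_support_continuous])
  have "AE u in sphere_measure. norm (curvature_density K u) \<le> B / m"
  proof (rule AE_regular[OF K])
    fix u assume u: "u \<in> regular_directions K"
    then have "u \<in> unit_sphere" using regular_directions_subset by blast
    then have "\<bar>radial_fun K u * partial_t G (radial_fun K u) u\<bar> / \<psi> (support_fun K (radial_gauss K u)) \<le> B / m"
      using B(1) bspec[OF B(2), of u] m(1) bspec[OF m(2), of "radial_gauss K u"] radial_gauss_normal(2)[OF u]
      by (intro frac_le) auto
    then show "norm (curvature_density K u) \<le> B / m"
      using psi_support_gauss_pos[OF u] by (simp add: curvature_density_def)
  qed
  then show ?thesis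
    by (rule finite_measure.integrable_const_bound[OF finite_sphere_measure]) simp
qed

lemma curvature_integrable:
  fixes g :: "'a \<Rightarrow> real"
  assumes [measurable]: "g \<in> borel_measurable borel" and g: "\<And>v. v \<in> unit_sphere \<Longrightarrow> \<bar>g v\<bar> \<le> B"
  shows "integrable sphere_measure (\<lambda>u. g (radial_gauss K u) * curvature_density K u)"
proof (rule Bochner_Integration.integrable_bound)
  note radial_gauss_measurable[OF K, measurable]
  show "integrable sphere_measure (\<lambda>u. B * curvature_density K u)"
    by (intro integrable_mult_right curvature_density_integrable)
  show "(\<lambda>u. g (radial_gauss K u) * curvature_density K u) \<in> borel_measurable sphere_measure"
    by measurable
  show "AE u in sphere_measure. norm (g (radial_gauss K u) * curvature_density K u) \<le> norm (B * curvature_density K u)"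
  proof (rule AE_regular[OF K])
    fix u assume "u \<in> regular_directions K"
    then have "\<bar>g (radial_gauss K u)\<bar> \<le> \<bar>B\<bar>" using g[OF radial_gauss_normal(2)] by fastforce
    then show "norm (g (radial_gauss K u) * curvature_density K u) \<le> norm (B * curvature_density K u)"
      by (simp add: abs_mult mult_right_mono)
  qed
qed

lemma dual_orlicz_curvature_eq:
  assumes [measurable]: "E \<in> sets borel"
  shows "dual_orlicz_curvature G \<psi> K E =
    1 / real DIM('a) * (\<integral>u. indicator E (radial_gauss K u) * curvature_density K u \<partial>sphere_measure)"
proof -
  note radial_gauss_measurable[OF K, measurable]
  have "(LINT u : reverse_radial_gauss K E | sphere_measure. curvature_density K u)
      = (\<integral>u. indicator E (radial_gauss K u) * curvature_density K u \<partial>sphere_measure)"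
    unfolding set_lebesgue_integral_def
  proof (rule integral_cong_AE)
    show "AE u in sphere_measure. indicat_real (reverse_radial_gauss K E) u *\<^sub>R curvature_density K u
        = indicator E (radial_gauss K u) * curvature_density K u"
    proof (rule AE_regular[OF K])
      fix u assume u: "u \<in> regular_directions K"
      then have "u \<in> reverse_radial_gauss K E \<longleftrightarrow> radial_gauss K u \<in> E"
        by (rule reverse_radial_gauss_regular_iff)
      then show "indicat_real (reverse_radial_gauss K E) u *\<^sub>R curvature_density K u
        = indicator E (radial_gauss K u) * curvature_density K u" by (simp add: indicator_def)
    qed
    show "(\<lambda>u. indicat_real (reverse_radial_gauss K E) u *\<^sub>R curvature_density K u) \<in> borel_measurable sphere_measure"
      by (intro borel_measurable_scaleR borel_measurable_indicator reverse_radial_gauss_sets[OF K assms]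
          curvature_density_measurable)
    show "(\<lambda>u. indicator E (radial_gauss K u) * curvature_density K u) \<in> borel_measurable sphere_measure"
      by measurable
  qed
  then show ?thesis unfolding dual_orlicz_curvature_def curvature_density_def by (rule arg_cong)
qed

lemma curvature_integral_reflect:
  fixes g :: "'a \<Rightarrow> real"
  assumes [measurable]: "g \<in> borel_measurable borel" and sym: "origin_symmetric K"
  shows "(\<integral>u. g (- radial_gauss K u) * curvature_density K u \<partial>sphere_measure)
    = (\<integral>u. g (radial_gauss K u) * curvature_density K u \<partial>sphere_measure)"
proof -
  note radial_gauss_measurable[OF K, measurable]
  note uminus_measurable_sphere_measure[measurable]
  have "(\<integral>u. g (radial_gauss K u) * curvature_density K u \<partial>sphere_measure)
      = (\<integral>u. g (radial_gauss K (- u)) * curvature_density K (- u) \<partial>sphere_measure)"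
    by (rule integral_sphere_measure_uminus[symmetric]) measurable
  also have "\<dots> = (\<integral>u. g (- radial_gauss K u) * curvature_density K u \<partial>sphere_measure)"
  proof (rule integral_cong_AE)
    show "AE u in sphere_measure. g (radial_gauss K (- u)) * curvature_density K (- u)
        = g (- radial_gauss K u) * curvature_density K u"
    proof (rule AE_regular[OF K])
      fix u assume u: "u \<in> regular_directions K"
      then have S: "u \<in> unit_sphere" using regular_directions_subset by blast
      show "g (radial_gauss K (- u)) * curvature_density K (- u) = g (- radial_gauss K u) * curvature_density K u"
        using regular_directions_uminus(2)[OF sym u] Gt_even[OF radial_fun_pos[OF K S] S]
        by (simp add: curvature_density_def radial_fun_uminus[OF sym] support_fun_uminus[OF sym])
    qed
  qed measurable
  finally show ?thesis ..
qed

lemma dual_orlicz_curvature_even: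
  assumes "E \<in> sets borel" "origin_symmetric K"
  shows "dual_orlicz_curvature G \<psi> K (uminus ` E) = dual_orlicz_curvature G \<psi> K E"
proof -
  have img: "uminus ` E = uminus -` E" by (force simp: image_iff)
  then have "uminus ` E \<in> sets borel" using measurable_sets[of uminus borel borel E] assms(1) by simp
  moreover have "indicator (uminus ` E) (v::'a) = (indicator E (- v) :: real)" for v
    by (auto simp: img indicator_def)
  ultimately show ?thesis
    using curvature_integral_reflect[of "indicator E"] assms by (simp add: dual_orlicz_curvature_eq)
qed

text \<open>
  If \<open>K\<close> contains the ball of radius \<open>r\<close> and lies in the ball of radius \<open>R\<close>, then every normal \<open>w\<close> in
  direction \<open>u\<close> satisfies \<open>\<langle>u,w\<rangle> \<ge> r/R\<close>. Hence the normals in directions closer to \<open>v\<close> than \<open>r/R\<close> have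
  a positive inner product with \<open>v\<close>, and these directions have positive measure.
\<close>

lemma dual_orlicz_curvature_open_hemisphere_neg:
  assumes v: "v \<in> unit_sphere"
  shows "dual_orlicz_curvature G \<psi> K {u \<in> unit_sphere. 0 < u \<bullet> v} < 0"
proof -
  let ?E = "{u \<in> unit_sphere. 0 < u \<bullet> v}"
  note radial_gauss_measurable[OF K, measurable]
  have E [measurable]: "?E \<in> sets borel"
  proof -
    have "?E = unit_sphere \<inter> {u. 0 < u \<bullet> v}" by auto
    moreover have "open {u. 0 < u \<bullet> v}" by (intro open_Collect_less continuous_intros)
    ultimately show ?thesis by (metis borel_closed borel_open closed_sphere sets.Int)
  qed
  obtain r where r: "0 < r" "cball 0 r \<subseteq> K" using convex_body_o_ball[OF K] by blast
  obtain R where R: "0 < R" "\<forall>x\<in>K. norm x \<le> R"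
    using compact_imp_bounded[OF convex_body_oD(1)[OF K]] bounded_pos by metis
  have near: "radial_gauss K u \<in> ?E" if u: "u \<in> regular_directions K" "u \<in> ball v (r / R)" for u
  proof -
    let ?w = "radial_gauss K u" and ?a = "inv_support K"
    have S: "u \<in> unit_sphere" using u regular_directions_subset by blast
    have w: "?w \<in> unit_sphere" "outer_normal_at K u ?w" by (rule radial_gauss_normal(2)[OF u(1)], rule radial_gauss_normal(1)[OF u(1)])
    have "r *\<^sub>R ?w \<in> K" using r w(1) by auto
    then have "?w \<bullet> (r *\<^sub>R ?w) \<le> support_fun K ?w" by (rule support_fun_upper[OF convex_body_oD(1)[OF K]])
    then have h: "r \<le> support_fun K ?w" using w(1) by (simp add: norm_eq_1)
    have a: "support_fun K u \<le> R"
    proof -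
      obtain x where x: "x \<in> K" "support_fun K u = u \<bullet> x"
        using support_fun_attained[OF convex_body_oD(1,5)[OF K]] by blast
      have "u \<bullet> x \<le> norm u * norm x" by (rule norm_cauchy_schwarz)
      then show ?thesis using x R(2) S by force
    qed
    have "?a u \<le> polar_gauge ?a u" by (rule polar_gauge_ge_self[OF continuous_on_inv_support[OF K] S])
    also have "\<dots> = ?a ?w * (u \<bullet> ?w)" using w outer_normal_at_iff[OF K S] by simp
    finally have le: "1 / support_fun K u \<le> (u \<bullet> ?w) / support_fun K ?w" by simp
    have pos: "0 < support_fun K u" "0 < support_fun K ?w" using support_fun_pos[OF K] S w(1) by auto
    have "r / R \<le> support_fun K ?w / support_fun K u"
      using h a pos r R by (intro frac_le) auto
    also have "\<dots> \<le> u \<bullet> ?w" using le pos by (simp add: field_simps)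
    finally have "r / R \<le> u \<bullet> ?w" .
    also have "u \<bullet> ?w = v \<bullet> ?w + (u - v) \<bullet> ?w" by (simp add: inner_diff_left)
    also have "(u - v) \<bullet> ?w \<le> norm (u - v) * norm ?w" by (rule norm_cauchy_schwarz)
    also have "norm (u - v) * norm ?w < r / R" using u(2) w(1) by (simp add: dist_norm norm_minus_commute)
    finally show ?thesis using w(1) by (simp add: inner_commute)
  qed
  have int: "integrable sphere_measure (\<lambda>u. indicator ?E (radial_gauss K u) * curvature_density K u)"
    by (rule curvature_integrable[where B=1]) (auto simp: indicator_def)
  have "(\<integral>u. indicator ?E (radial_gauss K u) * curvature_density K u \<partial>sphere_measure)
      < (\<integral>u. 0 \<partial>(sphere_measure :: 'a measure))"
  proof (rule finite_measure.integral_less_AE[OF finite_sphere_measure int integrable_zero])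
    show "emeasure sphere_measure (unit_sphere \<inter> ball v (r / R)) \<noteq> 0"
      using sphere_measure_ball_pos[OF sphere_nonnull v, of "r / R"] r R by simp
    show "unit_sphere \<inter> ball v (r / R) \<in> sets sphere_measure"
      using borel_Int_sphere_sets[of "ball v (r / R)"] by (simp add: Int_commute)
    show "AE u in sphere_measure. u \<in> unit_sphere \<inter> ball v (r / R) \<longrightarrow>
        indicator ?E (radial_gauss K u) * curvature_density K u \<noteq> 0"
    proof (rule AE_regular[OF K], intro impI)
      fix u assume "u \<in> regular_directions K" "u \<in> unit_sphere \<inter> ball v (r / R)"
      then show "indicator ?E (radial_gauss K u) * curvature_density K u \<noteq> 0"
        using near[of u] curvature_density_neg[of u] by simp
    qed
    show "AE u in sphere_measure. indicator ?E (radial_gauss K u) * curvature_density K u \<le> 0"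
      by (rule AE_regular[OF K]) (auto simp: indicator_def dest: curvature_density_neg)
  qed
  then have "(\<integral>u. indicator ?E (radial_gauss K u) * curvature_density K u \<partial>sphere_measure) < 0" by simp
  then show ?thesis unfolding dual_orlicz_curvature_eq[OF E] by (rule mult_pos_neg[rotated]) simp
qed

end

end

section \<open>First variation of the dual volume\<close>

text \<open>
  Differentiation under the integral sign along a sequence of perturbations \<open>s k\<close> of \<open>s0\<close> that are
  differentiable only almost everywhere. The mean value theorem gives the constant \<open>B C\<close> as an
  integrable bound for the difference quotients.
\<close>

lemma difference_quotient_integral_tendsto:
  fixes F F' :: "real \<Rightarrow> 'b \<Rightarrow> real" and s :: "nat \<Rightarrow> 'b \<Rightarrow> real" and s0 s' :: "'b \<Rightarrow> real"
  assumes M: "finite_measure M" and t: "\<And>k. 0 < t k" "t \<longlonglongrightarrow> 0"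
    and s: "\<And>k u. u \<in> space M \<Longrightarrow> s k u \<in> {a..b}" "\<And>u. u \<in> space M \<Longrightarrow> s0 u \<in> {a..b}"
    and deriv: "\<And>x u. u \<in> space M \<Longrightarrow> x \<in> {a..b} \<Longrightarrow> ((\<lambda>x. F x u) has_real_derivative F' x u) (at x)"
    and bound: "\<And>x u. u \<in> space M \<Longrightarrow> x \<in> {a..b} \<Longrightarrow> \<bar>F' x u\<bar> \<le> B"
    and lip: "\<And>k u. u \<in> space M \<Longrightarrow> \<bar>s k u - s0 u\<bar> \<le> C * t k"
    and quot: "AE u in M. (\<lambda>k. (s k u - s0 u) / t k) \<longlonglongrightarrow> s' u"
    and int: "\<And>k. integrable M (\<lambda>u. F (s k u) u)" "integrable M (\<lambda>u. F (s0 u) u)"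
    and meas: "(\<lambda>u. F' (s0 u) u * s' u) \<in> borel_measurable M"
  shows "(\<lambda>k. ((\<integral>u. F (s k u) u \<partial>M) - (\<integral>u. F (s0 u) u \<partial>M)) / t k) \<longlonglongrightarrow> (\<integral>u. F' (s0 u) u * s' u \<partial>M)"
proof -
  let ?q = "\<lambda>k u. (F (s k u) u - F (s0 u) u) / t k"
  have "(\<lambda>k. \<integral>u. ?q k u \<partial>M) \<longlonglongrightarrow> (\<integral>u. F' (s0 u) u * s' u \<partial>M)"
  proof (rule integral_dominated_convergence[where w="\<lambda>_. B * C"])
    show "(\<lambda>u. F' (s0 u) u * s' u) \<in> borel_measurable M" by (rule meas)
    show "?q k \<in> borel_measurable M" for k using int by (intro borel_measurable_integrable) auto
    show "integrable M (\<lambda>_. B * C)" using M by (rule finite_measure.integrable_const)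
    show "AE u in M. norm (?q k u) \<le> B * C" for k
    proof (rule AE_I2)
      fix u assume u: "u \<in> space M"
      have B: "0 \<le> B" using bound[OF u s(2)[OF u]] by linarith
      have "norm (F (s k u) u - F (s0 u) u) \<le> B * norm (s k u - s0 u)"
        using deriv[OF u] bound[OF u] s[OF u]
        by (intro field_differentiable_bound[where S="{a..b}" and f'="\<lambda>x. F' x u"]) (auto intro: has_field_derivative_at_within)
      also have "\<dots> \<le> B * (C * t k)" using lip[OF u] B by (intro mult_left_mono) auto
      finally show "norm (?q k u) \<le> B * C" using t(1)[of k] by (simp add: field_simps)
    qed
    have t0: "(\<lambda>k. C * t k) \<longlonglongrightarrow> 0" using tendsto_mult_right_zero[OF t(2), of C] .
    show "AE u in M. (\<lambda>k. ?q k u) \<longlonglongrightarrow> F' (s0 u) u * s' u"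
      using quot AE_space
    proof eventually_elim
      case (elim u)
      then have u: "u \<in> space M" by simp
      (* The Caratheodory form of the derivative avoids a division by s k u - s0 u, which may vanish. *)
      obtain g where g: "\<And>z. F z u - F (s0 u) u = g z * (z - s0 u)" "isCont g (s0 u)" "g (s0 u) = F' (s0 u) u"
        using deriv[OF u s(2)[OF u]] unfolding CARAT_DERIV by auto
      have "(\<lambda>k. s k u - s0 u) \<longlonglongrightarrow> 0"
        using lip[OF u] by (intro tendsto_0_le[OF t0, where K=1]) (auto intro!: always_eventually simp: abs_le_iff intro: order_trans[OF _ abs_ge_self])
      then have "(\<lambda>k. s k u) \<longlonglongrightarrow> s0 u" by (simp add: LIM_zero_iff)
      then have "(\<lambda>k. g (s k u)) \<longlonglongrightarrow> g (s0 u)" using g(2) by (rule isCont_tendsto_compose[rotated])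
      then have "(\<lambda>k. g (s k u) * ((s k u - s0 u) / t k)) \<longlonglongrightarrow> g (s0 u) * s' u"
        using elim(1) by (rule tendsto_mult)
      then show ?case by (simp add: g)
    qed
  qed
  moreover have eq: "(\<integral>u. ?q k u \<partial>M) = ((\<integral>u. F (s k u) u \<partial>M) - (\<integral>u. F (s0 u) u \<partial>M)) / t k" for k
    using int by (simp add: Bochner_Integration.integral_diff)
  ultimately show ?thesis unfolding eq by blast
qed

text \<open>
  Danskin's theorem for the gauge. The maximiser \<open>w\<close> at \<open>t = 0\<close> gives the lower bound \<open>p (1 + t g(w))\<close>
  for the perturbed maximum, and a maximiser \<open>v\<^sub>t\<close> of the perturbed problem gives the upper bound
  \<open>p (1 + t g(v\<^sub>t))\<close>. The \<open>v\<^sub>t\<close> are almost-maximisers of the original problem, so they tend to \<open>w\<close>.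
\<close>

lemma polar_gauge_variation:
  fixes K :: "'a::euclidean_space set"
  assumes K: "convex_body_o K" and u: "u \<in> regular_directions K"
    and g: "continuous_on unit_sphere g" "\<And>v. v \<in> unit_sphere \<Longrightarrow> \<bar>g v\<bar> \<le> B"
    and t: "\<And>k. 0 < t k" "t \<longlonglongrightarrow> 0"
  shows "(\<lambda>k. (polar_gauge (\<lambda>v. inv_support K v * (1 + t k * g v)) u - polar_gauge (inv_support K) u) / t k)
    \<longlonglongrightarrow> polar_gauge (inv_support K) u * g (radial_gauss K u)"
proof -
  let ?a = "inv_support K" and ?b = "\<lambda>k v. inv_support K v * (1 + t k * g v)" and ?w = "radial_gauss K u"
  let ?p = "polar_gauge ?a u" and ?q = "\<lambda>k. polar_gauge (?b k) u"
  note a = continuous_on_inv_support[OF K]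
  have uS: "u \<in> unit_sphere" using u regular_directions_subset by blast
  have w: "?w \<in> unit_sphere" by (rule radial_gauss_normal(2)[OF u])
  have aw: "?a ?w * (u \<bullet> ?w) = ?p"
    using radial_gauss_normal(1)[OF u] outer_normal_at_iff[OF K uS] by blast
  have b: "continuous_on unit_sphere (?b k)" for k by (intro continuous_on_mult a continuous_intros g)
  have p: "0 < ?p" by (rule polar_gauge_pos[OF a inv_support_pos[OF K] uS])
  have "\<exists>v. v \<in> unit_sphere \<and> ?q k = ?b k v * (u \<bullet> v)" for k
    using polar_gauge_attained[OF b[of k], of u] by blast
  then obtain vs where vs: "\<And>k. vs k \<in> unit_sphere" "\<And>k. ?q k = ?b k (vs k) * (u \<bullet> vs k)" by metis
  have lower: "?p * (1 + t k * g ?w) \<le> ?q k" for k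
  proof -
    have "?b k ?w * (u \<bullet> ?w) = ?a ?w * (u \<bullet> ?w) * (1 + t k * g ?w)" by (simp only: mult_ac)
    also have "\<dots> = ?p * (1 + t k * g ?w)" by (simp only: aw)
    finally show ?thesis using polar_gauge_upper[OF b[of k] w, of u] by (simp only:)
  qed
  have B: "0 \<le> B" using g(2)[OF w] by linarith
  have small: "\<forall>\<^sub>F k in sequentially. t k * B < 1/2"
    using order_tendstoD(2)[OF tendsto_mult_left_zero[OF t(2), of B], of "1/2"] by simp
  have upper: "\<forall>\<^sub>F k in sequentially. 0 < 1 + t k * g (vs k) \<and> ?a (vs k) * (u \<bullet> vs k) * (1 + t k * g (vs k)) = ?q k
     \<and> ?q k \<le> ?p * (1 + t k * g (vs k))"
    using small
  proof eventually_elim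
    case (elim k)
    have "\<bar>t k * g (vs k)\<bar> \<le> t k * B" using g(2)[OF vs(1)] t(1)[of k] by (simp add: abs_mult)
    then have pos: "0 < 1 + t k * g (vs k)" using elim by linarith
    have eq: "?a (vs k) * (u \<bullet> vs k) * (1 + t k * g (vs k)) = ?q k" unfolding vs(2)[of k] by (simp only: mult_ac)
    show ?case using pos eq mult_right_mono[OF polar_gauge_upper[OF a vs(1)[of k], of u], of "1 + t k * g (vs k)"] by simp
  qed
  have tg: "(\<lambda>k. t k * g (f k)) \<longlonglongrightarrow> 0" if "\<And>k. f k \<in> unit_sphere" for f
  proof (rule tendsto_0_le[OF t(2), where K=B])
    show "\<forall>\<^sub>F k in sequentially. norm (t k * g (f k)) \<le> norm (t k) * B"
      using g(2)[OF that] by (intro always_eventually allI) (simp add: abs_mult mult_left_mono)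
  qed
  have "vs \<longlonglongrightarrow> ?w"
  proof (rule polar_gauge_maximizer_tendsto[OF a])
    show "v = ?w" if "v \<in> unit_sphere" "?a v * (u \<bullet> v) = ?p" for v
    proof -
      have "outer_normal_at K u v" using that outer_normal_at_iff[OF K uS] by blast
      then show ?thesis by (rule radial_gauss_normal(3)[OF u])
    qed
    have lo: "(\<lambda>k. ?p * (1 + t k * g ?w) / (1 + t k * g (vs k))) \<longlonglongrightarrow> ?p * (1 + 0) / (1 + 0)"
      using w vs(1) by (intro tendsto_intros tg) auto
    show "(\<lambda>k. ?a (vs k) * (u \<bullet> vs k)) \<longlonglongrightarrow> ?p"
    proof (rule tendsto_sandwich[OF _ _ _ tendsto_const])
      show "(\<lambda>k. ?p * (1 + t k * g ?w) / (1 + t k * g (vs k))) \<longlonglongrightarrow> ?p" using lo by simp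
      show "\<forall>\<^sub>F k in sequentially. ?p * (1 + t k * g ?w) / (1 + t k * g (vs k)) \<le> ?a (vs k) * (u \<bullet> vs k)"
        using upper
      proof eventually_elim
        case (elim k)
        then show ?case using lower[of k] by (subst pos_divide_le_eq) auto
      qed
      show "\<forall>\<^sub>F k in sequentially. ?a (vs k) * (u \<bullet> vs k) \<le> ?p"
        using polar_gauge_upper[OF a vs(1)] by (intro always_eventually allI)
    qed
  qed (rule vs)
  then have gv: "(\<lambda>k. ?p * g (vs k)) \<longlonglongrightarrow> ?p * g ?w"
    using vs(1) w by (intro tendsto_intros continuous_on_tendsto_compose[OF g(1)]) auto
  show ?thesis
  proof (rule tendsto_sandwich[OF _ _ tendsto_const gv])
    show "\<forall>\<^sub>F k in sequentially. ?p * g ?w \<le> (?q k - ?p) / t k"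
    proof (intro always_eventually allI)
      fix k show "?p * g ?w \<le> (?q k - ?p) / t k"
        using lower[of k] t(1)[of k] by (simp add: field_simps)
    qed
    show "\<forall>\<^sub>F k in sequentially. (?q k - ?p) / t k \<le> ?p * g (vs k)"
      using upper
    proof eventually_elim
      case (elim k)
      then have "?q k \<le> ?p * (1 + t k * g (vs k))" by blast
      then show ?case using t(1)[of k] by (simp add: field_simps)
    qed
  qed
qed

context dual_orlicz
begin

definition dual_volume :: "('a \<Rightarrow> real) \<Rightarrow> real" where
  "dual_volume a = (\<integral>u. G (1 / polar_gauge a u) u \<partial>sphere_measure)"

lemma dual_volume_integrand_continuous:
  assumes a: "continuous_on unit_sphere a" "\<And>v. v \<in> unit_sphere \<Longrightarrow> 0 < a v"
  shows "continuous_on unit_sphere (\<lambda>u. G (1 / polar_gauge a u) u)"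
  using polar_gauge_pos[OF a]
  by (intro continuous_on_G_comp continuous_intros continuous_on_polar_gauge a) force+

lemma integrable_continuous_sphere:
  fixes f :: "'a \<Rightarrow> real"
  assumes "continuous_on unit_sphere f"
  shows "integrable sphere_measure f"
proof -
  obtain B where B: "0 < B" "\<forall>v\<in>unit_sphere. \<bar>f v\<bar> \<le> B" by (rule continuous_on_sphere_bounded[OF assms])
  have "AE u in sphere_measure. norm (f u) \<le> B" by (rule AE_I2) (use B in auto)
  then show ?thesis
    by (rule finite_measure.integrable_const_bound[OF finite_sphere_measure _ measurable_sphere_measure_continuous[OF assms]])
qed

lemma G_deriv:
  assumes "0 < t" "u \<in> unit_sphere"
  shows "((\<lambda>s. G s u) has_real_derivative partial_t G t u) (at t)"
  using G_diff[OF assms] unfolding partial_t_def by (simp add: DERIV_deriv_iff_real_differentiable)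

text \<open>
  As \<open>1/\<rho>\<close> is the gauge, \<open>\<rho>\<close> changes at the rate \<open>-\<rho> g(\<alpha>)\<close>. The bound \<open>t k * B \<le> 1/2\<close> keeps the
  perturbed functions, and with them the radial functions, in a fixed compact subset of the positive
  reals, where \<open>G\<^sub>t\<close> is bounded.
\<close>

lemma dual_volume_variation:
  assumes K: "convex_body_o K" and g: "continuous_on unit_sphere g" "\<And>v. v \<in> unit_sphere \<Longrightarrow> \<bar>g v\<bar> \<le> B"
    and t: "\<And>k. 0 < t k" "t \<longlonglongrightarrow> 0" "\<And>k. t k * B \<le> 1/2"
  shows "(\<lambda>k. (dual_volume (\<lambda>v. inv_support K v * (1 + t k * g v)) - dual_volume (inv_support K)) / t k)
    \<longlonglongrightarrow> - (\<integral>u. radial_fun K u * partial_t G (radial_fun K u) u * g (radial_gauss K u) \<partial>sphere_measure)"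
proof -
  define a where "a = inv_support K"
  let ?b = "\<lambda>k v. a v * (1 + t k * g v)"
  have a: "continuous_on unit_sphere a" unfolding a_def by (rule continuous_on_inv_support[OF K])
  have apos: "0 < a v" if "v \<in> unit_sphere" for v unfolding a_def by (rule inv_support_pos[OF K that])
  have b: "continuous_on unit_sphere (?b k)" for k by (intro continuous_on_mult a continuous_intros g)
  have tgB: "\<bar>t k * g v\<bar> \<le> t k * B" if "v \<in> unit_sphere" for k v
    using g(2)[OF that] t(1)[of k] by (simp add: abs_mult)
  have tg: "\<bar>t k * g v\<bar> \<le> 1/2" if "v \<in> unit_sphere" for k v
    using tgB[OF that] t(3)[of k] by (rule order_trans)
  obtain m where m: "0 < m" "\<forall>v\<in>unit_sphere. m \<le> a v" by (rule continuous_on_sphere_pos_lower[OF a apos])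
  obtain A where A: "0 < A" "\<forall>v\<in>unit_sphere. \<bar>a v\<bar> \<le> A" by (rule continuous_on_sphere_bounded[OF a])
  have lo: "m / 2 \<le> ?b k v" "?b k v \<le> 2 * A" if v: "v \<in> unit_sphere" for k v
  proof -
    have av: "m \<le> a v" "a v \<le> A" using bspec[OF m(2) v] bspec[OF A(2) v] by (simp_all only: abs_le_iff)
    have "m * (1/2) \<le> a v * (1 + t k * g v)" using av m(1) tg[OF v, of k] by (intro mult_mono) (auto simp: abs_le_iff)
    then show "m / 2 \<le> ?b k v" by simp
    have "a v * (1 + t k * g v) \<le> A * 2" using av m(1) tg[OF v, of k] by (intro mult_mono) (auto simp: abs_le_iff)
    then show "?b k v \<le> 2 * A" by simp
  qed
  have bpos: "0 < ?b k v" if "v \<in> unit_sphere" for k v using lo(1)[OF that, of k] m(1) by linarith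
  have pb: "m / 2 \<le> polar_gauge (?b k) u" "polar_gauge (?b k) u \<le> 2 * A" if u: "u \<in> unit_sphere" for k u
  proof -
    show "m / 2 \<le> polar_gauge (?b k) u" using polar_gauge_ge_self[OF b u] lo(1)[OF u] order_trans by blast
    have "\<bar>?b k v\<bar> \<le> 2 * A" if "v \<in> unit_sphere" for v using lo[OF that, of k] m(1) by linarith
    then have "\<bar>polar_gauge (?b k) u\<bar> \<le> 2 * A * norm u" by (rule polar_gauge_bound[OF b])
    then show "polar_gauge (?b k) u \<le> 2 * A" using u by simp
  qed
  have pa: "m / 2 \<le> polar_gauge a u" "polar_gauge a u \<le> 2 * A" if u: "u \<in> unit_sphere" for u
  proof -
    have "m \<le> a u" using m(2) u by blast
    then show "m / 2 \<le> polar_gauge a u" using polar_gauge_ge_self[OF a u] m(1) by linarith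
    have "\<bar>polar_gauge a u\<bar> \<le> A * norm u" using A(2) by (intro polar_gauge_bound[OF a]) blast
    then show "polar_gauge a u \<le> 2 * A" using u A(1) by simp
  qed
  define x0 x1 where "x0 = 1 / (2 * A)" and "x1 = 2 / m"
  have x0: "0 < x0" using A(1) by (simp add: x0_def)
  have inv_mem: "1 / p \<in> {x0..x1}" if "m / 2 \<le> p" "p \<le> 2 * A" for p
    using that m(1) A(1) by (auto simp: x0_def x1_def field_simps)
  have "compact ({x0..x1} \<times> (unit_sphere :: 'a set))" by (intro compact_Times compact_sphere compact_Icc)
  moreover have "continuous_on ({x0..x1} \<times> (unit_sphere :: 'a set)) (\<lambda>(t, u). partial_t G t u)"
    using x0 by (intro continuous_on_subset[OF Gt_cont]) auto
  ultimately have "compact ((\<lambda>(t, u). partial_t G t u) ` ({x0..x1} \<times> (unit_sphere :: 'a set)))"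
    by (rule compact_continuous_image[rotated])
  then obtain D where D: "\<forall>y\<in>(\<lambda>(t, u). partial_t G t u) ` ({x0..x1} \<times> (unit_sphere :: 'a set)). norm y \<le> D"
    using compact_imp_bounded bounded_iff by blast
  have perturb: "\<bar>polar_gauge (?b k) u - polar_gauge a u\<bar> \<le> A * (t k * B)" if u: "u \<in> unit_sphere" for k u
  proof -
    have d: "\<bar>?b k v - a v\<bar> \<le> A * (t k * B)" if v: "v \<in> unit_sphere" for v
    proof -
      have "\<bar>?b k v - a v\<bar> = \<bar>a v\<bar> * \<bar>t k * g v\<bar>" by (simp add: algebra_simps flip: abs_mult)
      also have "\<dots> \<le> A * (t k * B)" using A v tgB[OF v, of k] by (intro mult_mono) auto
      finally show ?thesis .
    qed
    have "polar_gauge (?b k) u \<le> polar_gauge a u + A * (t k * B) * norm u + A * norm (u - u)"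
      using d A(2) by (intro polar_gauge_perturb[OF b a]) auto
    moreover have "polar_gauge a u \<le> polar_gauge (?b k) u + A * (t k * B) * norm u + (2 * A) * norm (u - u)"
    proof (intro polar_gauge_perturb[OF a b])
      show "\<bar>a v - ?b k v\<bar> \<le> A * (t k * B)" if "v \<in> unit_sphere" for v using d[OF that] by (simp add: abs_minus_commute)
      show "\<bar>?b k v\<bar> \<le> 2 * A" if "v \<in> unit_sphere" for v using lo[OF that, of k] m(1) by linarith
    qed
    ultimately show ?thesis using u by (simp add: abs_le_iff)
  qed
  have main: "(\<lambda>k. ((\<integral>u. G (1 / polar_gauge (?b k) u) u \<partial>sphere_measure) - (\<integral>u. G (1 / polar_gauge a u) u \<partial>sphere_measure)) / t k)
    \<longlonglongrightarrow> (\<integral>u. partial_t G (1 / polar_gauge a u) u * (- (1 / polar_gauge a u) * g (radial_gauss K u)) \<partial>sphere_measure)"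
  proof (rule difference_quotient_integral_tendsto[where a=x0 and b=x1 and B=D and C="A * B * 4 / m\<^sup>2"])
    show "finite_measure (sphere_measure :: 'a measure)" by (rule finite_sphere_measure)
    show "1 / polar_gauge (?b k) u \<in> {x0..x1}" if "u \<in> space sphere_measure" for k u
      using that pb by (intro inv_mem) auto
    show "1 / polar_gauge a u \<in> {x0..x1}" if "u \<in> space sphere_measure" for u
      using that pa by (intro inv_mem) auto
    show "((\<lambda>x. G x u) has_real_derivative partial_t G x u) (at x)" if "u \<in> space sphere_measure" "x \<in> {x0..x1}" for x u
      using that x0 by (intro G_deriv) auto
    show "\<bar>partial_t G x u\<bar> \<le> D" if "u \<in> space sphere_measure" "x \<in> {x0..x1}" for x u
      using that D by force
    show "\<bar>1 / polar_gauge (?b k) u - 1 / polar_gauge a u\<bar> \<le> A * B * 4 / m\<^sup>2 * t k" if "u \<in> space sphere_measure" for k u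
    proof -
      have u: "u \<in> unit_sphere" using that by simp
      let ?p = "polar_gauge a u" and ?q = "polar_gauge (?b k) u"
      have pq: "m / 2 \<le> ?p" "m / 2 \<le> ?q" using pa pb u by blast+
      then have pos: "0 < ?p" "0 < ?q" using m(1) by linarith+
      have "\<bar>1 / ?q - 1 / ?p\<bar> = \<bar>?q - ?p\<bar> / (?q * ?p)"
      proof -
        have "1 / ?q - 1 / ?p = - (?q - ?p) / (?q * ?p)" using pos by (simp add: field_simps)
        then show ?thesis using pos by (simp add: abs_mult abs_minus_commute)
      qed
      also have "\<dots> \<le> (A * (t k * B)) / ((m / 2) * (m / 2))"
        using perturb[OF u, of k] pq m(1) by (intro frac_le mult_mono) auto
      also have "\<dots> = A * B * 4 / m\<^sup>2 * t k" by (simp add: power2_eq_square)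
      finally show ?thesis .
    qed
    show "AE u in sphere_measure. (\<lambda>k. (1 / polar_gauge (?b k) u - 1 / polar_gauge a u) / t k)
        \<longlonglongrightarrow> - (1 / polar_gauge a u) * g (radial_gauss K u)"
    proof (rule AE_regular[OF K])
      fix u assume ur: "u \<in> regular_directions K"
      then have u: "u \<in> unit_sphere" using regular_directions_subset by blast
      let ?p = "polar_gauge a u" and ?q = "\<lambda>k. polar_gauge (?b k) u"
      have pos: "0 < ?p" "0 < ?q k" for k using pa(1)[OF u] pb(1)[OF u, of k] m(1) by linarith+
      have lim: "(\<lambda>k. (?q k - ?p) / t k) \<longlonglongrightarrow> ?p * g (radial_gauss K u)"
        using polar_gauge_variation[OF K ur g t(1,2)] unfolding a_def .
      then have "(\<lambda>k. (?q k - ?p) / t k * t k) \<longlonglongrightarrow> ?p * g (radial_gauss K u) * 0"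
        by (rule tendsto_mult[OF _ t(2)])
      moreover have "(?q k - ?p) / t k * t k = ?q k - ?p" for k using t(1)[of k] by simp
      ultimately have "(\<lambda>k. ?q k - ?p) \<longlonglongrightarrow> 0" by simp
      then have q: "?q \<longlonglongrightarrow> ?p" by (simp add: LIM_zero_iff)
      have "(\<lambda>k. - ((?q k - ?p) / t k) / (?q k * ?p)) \<longlonglongrightarrow> - (?p * g (radial_gauss K u)) / (?p * ?p)"
        using pos(1) by (intro tendsto_intros lim q) auto
      moreover have "- ((?q k - ?p) / t k) / (?q k * ?p) = (1 / ?q k - 1 / ?p) / t k" for k
        using pos(1) pos(2)[of k] t(1)[of k] by (simp add: field_simps)
      moreover have "- (?p * g (radial_gauss K u)) / (?p * ?p) = - (1 / ?p) * g (radial_gauss K u)"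
        using pos(1) by simp
      ultimately show "(\<lambda>k. (1 / ?q k - 1 / ?p) / t k) \<longlonglongrightarrow> - (1 / ?p) * g (radial_gauss K u)" by simp
    qed
    show "integrable sphere_measure (\<lambda>u. G (1 / polar_gauge (?b k) u) u)" for k
      by (intro integrable_continuous_sphere dual_volume_integrand_continuous b bpos)
    show "integrable sphere_measure (\<lambda>u. G (1 / polar_gauge a u) u)"
      by (intro integrable_continuous_sphere dual_volume_integrand_continuous a apos)
    show "(\<lambda>u. partial_t G (1 / polar_gauge a u) u * (- (1 / polar_gauge a u) * g (radial_gauss K u))) \<in> borel_measurable sphere_measure"
    proof (intro borel_measurable_times borel_measurable_uminus)
      have c: "continuous_on unit_sphere (\<lambda>u. 1 / polar_gauge a u)"
        using polar_gauge_pos[OF a apos] by (intro continuous_intros continuous_on_polar_gauge a) force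
      then show "(\<lambda>u. 1 / polar_gauge a u) \<in> borel_measurable sphere_measure"
        by (rule measurable_sphere_measure_continuous)
      show "(\<lambda>u. partial_t G (1 / polar_gauge a u) u) \<in> borel_measurable sphere_measure"
        using c polar_gauge_pos[OF a apos] by (intro measurable_sphere_measure_continuous continuous_on_G_comp) auto
      show "(\<lambda>u. g (radial_gauss K u)) \<in> borel_measurable sphere_measure"
      proof (rule measurable_regular[OF K])
        show "continuous_on (regular_directions K) (\<lambda>u. g (radial_gauss K u))"
          using radial_gauss_normal(2)
          by (intro continuous_on_compose2[OF g(1) continuous_on_radial_gauss_regular[OF K]]) blast
      qed
    qed
  qed (use t in auto)
  have "(\<integral>u. partial_t G (1 / polar_gauge a u) u * (- (1 / polar_gauge a u) * g (radial_gauss K u)) \<partial>sphere_measure)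
     = (\<integral>u. - (radial_fun K u * partial_t G (radial_fun K u) u * g (radial_gauss K u)) \<partial>sphere_measure)"
    by (intro Bochner_Integration.integral_cong refl) (simp add: radial_fun_eq_polar_gauge[OF K] a_def mult_ac)
  then show ?thesis using main unfolding dual_volume_def a_def by simp
qed

end

section \<open>The constrained minimisation problem\<close>

locale dual_orlicz_minimization = dual_orlicz G \<psi> for G :: "real \<Rightarrow> 'a::euclidean_space \<Rightarrow> real" and \<psi> +
  fixes \<phi> :: "real \<Rightarrow> real" and \<mu> :: "'a measure" and \<epsilon> :: real
  assumes \<phi>_deriv: "\<And>t. 0 < t \<Longrightarrow> (\<phi> has_real_derivative \<psi> t / t) (at t)"
    and \<phi>_nonneg: "\<And>t. 0 < t \<Longrightarrow> 0 \<le> \<phi> t"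
    and \<phi>_top: "filterlim \<phi> at_top at_top"
    and \<mu>_borel: "finite_borel_on_sphere \<mu>"
    and \<mu>_spread: "not_concentrated_on_closed_hemisphere \<mu>"
    and \<epsilon>_pos: "0 < \<epsilon>"
    and G_blowup: "\<And>v. v \<in> unit_sphere \<Longrightarrow>
       filterlim (\<lambda>t. LINT u : cap \<epsilon> v | sphere_measure. G t u) at_top (at_right 0)"
begin

lemma sets_\<mu>: "sets \<mu> = sets (restrict_space borel unit_sphere)"
  and finite_\<mu>: "finite_measure \<mu>"
  using \<mu>_borel by (auto simp: finite_borel_on_sphere_def)

lemma space_\<mu> [simp]: "space \<mu> = unit_sphere"
  using sets_eq_imp_space_eq[OF sets_\<mu>] by (simp add: space_restrict_space)

lemma measurable_\<mu>_continuous: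
  fixes f :: "'a \<Rightarrow> 'b::topological_space"
  assumes "continuous_on unit_sphere f"
  shows "f \<in> borel_measurable \<mu>"
  using borel_measurable_continuous_on_restrict[OF assms] measurable_cong_sets[OF sets_\<mu> refl] by blast

lemma integrable_\<mu>_continuous:
  fixes f :: "'a \<Rightarrow> real"
  assumes "continuous_on unit_sphere f"
  shows "integrable \<mu> f"
proof -
  obtain B where B: "0 < B" "\<forall>v\<in>unit_sphere. \<bar>f v\<bar> \<le> B" by (rule continuous_on_sphere_bounded[OF assms])
  have "AE u in \<mu>. norm (f u) \<le> B" by (rule AE_I2) (use B in auto)
  then show ?thesis
    by (rule finite_measure.integrable_const_bound[OF finite_\<mu> _ measurable_\<mu>_continuous[OF assms]])
qed

lemma \<phi>_strict_mono: "0 < s \<Longrightarrow> s < t \<Longrightarrow> \<phi> s < \<phi> t"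
  by (rule DERIV_pos_imp_increasing) (auto intro!: exI \<phi>_deriv divide_pos_pos \<psi>_pos)

lemma \<phi>_mono: "0 < s \<Longrightarrow> s \<le> t \<Longrightarrow> \<phi> s \<le> \<phi> t"
  using \<phi>_strict_mono[of s t] by (cases "s = t") auto

lemma \<phi>_isCont: "0 < t \<Longrightarrow> isCont \<phi> t"
  using \<phi>_deriv by (rule DERIV_isCont)

lemma continuous_on_\<phi>_comp:
  assumes "continuous_on A f" "\<And>x. x \<in> A \<Longrightarrow> 0 < f x"
  shows "continuous_on A (\<lambda>x. \<phi> (f x))"
proof (rule continuous_on_compose2[OF _ assms(1)])
  show "continuous_on {0<..} \<phi>" by (intro continuous_at_imp_continuous_on ballI \<phi>_isCont) simp
qed (use assms(2) in auto)

lemma G_antimono: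
  assumes "0 < s" "s \<le> t" "u \<in> unit_sphere"
  shows "G t u \<le> G s u"
proof (cases "s = t")
  case False
  have "\<exists>y. ((\<lambda>s. G s u) has_real_derivative y) (at x) \<and> y < 0" if "s \<le> x" "x \<le> t" for x
    using that assms G_deriv[of x u] Gt_neg[of x u] by (intro exI[of _ "partial_t G x u"]) auto
  then show ?thesis using DERIV_neg_imp_decreasing[of s t "\<lambda>s. G s u"] False assms by force
qed simp

definition energy :: "('a \<Rightarrow> real) \<Rightarrow> real" where
  "energy a = (\<integral>v. \<phi> (1 / a v) \<partial>\<mu>)"

lemma energy_integrable:
  assumes "continuous_on unit_sphere a" "\<And>v. v \<in> unit_sphere \<Longrightarrow> 0 < a v"
  shows "integrable \<mu> (\<lambda>v. \<phi> (1 / a v))"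
  using assms by (intro integrable_\<mu>_continuous continuous_on_\<phi>_comp continuous_intros) force+

lemma energy_nonneg:
  assumes "\<And>v. v \<in> unit_sphere \<Longrightarrow> 0 < a v"
  shows "0 \<le> energy a"
  unfolding energy_def using assms by (intro integral_nonneg_AE AE_I2 \<phi>_nonneg) simp

lemma energy_mono:
  assumes "continuous_on unit_sphere a" "\<And>v. v \<in> unit_sphere \<Longrightarrow> 0 < a v"
    "continuous_on unit_sphere b" "\<And>v. v \<in> unit_sphere \<Longrightarrow> a v \<le> b v"
  shows "energy b \<le> energy a"
  unfolding energy_def
proof (rule integral_mono)
  have b: "0 < b v" if "v \<in> unit_sphere" for v using assms(2,4)[OF that] by linarith
  show "integrable \<mu> (\<lambda>v. \<phi> (1 / b v))" by (rule energy_integrable[OF assms(3) b])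
  show "integrable \<mu> (\<lambda>v. \<phi> (1 / a v))" by (rule energy_integrable[OF assms(1,2)])
  show "\<phi> (1 / b v) \<le> \<phi> (1 / a v)" if "v \<in> space \<mu>" for v
    using that assms(2,4)[of v] b[of v] by (intro \<phi>_mono frac_le) auto
qed

lemma energy_variation:
  assumes K: "convex_body_o K" and g: "continuous_on unit_sphere g" "\<And>v. v \<in> unit_sphere \<Longrightarrow> \<bar>g v\<bar> \<le> B"
    and t: "\<And>k. 0 < t k" "t \<longlonglongrightarrow> 0" "\<And>k. t k * B \<le> 1/2"
  shows "(\<lambda>k. (energy (\<lambda>v. inv_support K v * (1 + t k * g v)) - energy (inv_support K)) / t k)
    \<longlonglongrightarrow> - (\<integral>v. \<psi> (support_fun K v) * g v \<partial>\<mu>)"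
proof -
  define h where "h = support_fun K"
  have h: "continuous_on unit_sphere h" unfolding h_def by (rule continuous_on_support_fun[OF K])
  have hpos: "0 < h v" if "v \<in> unit_sphere" for v unfolding h_def by (rule support_fun_pos[OF K that])
  let ?s = "\<lambda>k v. h v / (1 + t k * g v)"
  have tgB: "\<bar>t k * g v\<bar> \<le> t k * B" if "v \<in> unit_sphere" for k v
    using g(2)[OF that] t(1)[of k] by (simp add: abs_mult)
  have tg: "1/2 \<le> 1 + t k * g v" "1 + t k * g v \<le> 2" if v: "v \<in> unit_sphere" for k v
    using tgB[OF v, of k] t(3)[of k] by (auto simp: abs_le_iff)
  obtain m where m: "0 < m" "\<forall>v\<in>unit_sphere. m \<le> h v" by (rule continuous_on_sphere_pos_lower[OF h hpos])
  obtain A where A: "0 < A" "\<forall>v\<in>unit_sphere. \<bar>h v\<bar> \<le> A" by (rule continuous_on_sphere_bounded[OF h])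
  have hb: "m \<le> h v" "h v \<le> A" if "v \<in> unit_sphere" for v
    using bspec[OF m(2) that] bspec[OF A(2) that] by auto
  define x0 x1 where "x0 = m / 2" and "x1 = 2 * A"
  have x0: "0 < x0" using m(1) by (simp add: x0_def)
  have "continuous_on {x0..x1} (\<lambda>x. \<psi> x / x)"
    using x0 by (intro continuous_intros continuous_on_subset[OF \<psi>_cont]) auto
  then have "compact ((\<lambda>x. \<psi> x / x) ` {x0..x1})" by (intro compact_continuous_image) auto
  then obtain D where D: "\<forall>y\<in>(\<lambda>x. \<psi> x / x) ` {x0..x1}. norm y \<le> D"
    using compact_imp_bounded bounded_iff by blast
  have main: "(\<lambda>k. ((\<integral>v. \<phi> (?s k v) \<partial>\<mu>) - (\<integral>v. \<phi> (h v) \<partial>\<mu>)) / t k)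
    \<longlonglongrightarrow> (\<integral>v. \<psi> (h v) / h v * (- (h v * g v)) \<partial>\<mu>)"
  proof (rule difference_quotient_integral_tendsto[where a=x0 and b=x1 and B=D and C="A * B * 2"
        and F="\<lambda>x v. \<phi> x" and F'="\<lambda>x v. \<psi> x / x"])
    show "?s k v \<in> {x0..x1}" if "v \<in> space \<mu>" for k v
    proof -
      have v: "v \<in> unit_sphere" using that by simp
      have "h v / (1 + t k * g v) \<le> A / (1/2)" using hb[OF v] tg[OF v, of k] m(1) by (intro frac_le) auto
      moreover have "m / 2 \<le> h v / (1 + t k * g v)" using hb[OF v] tg[OF v, of k] m(1) by (intro frac_le) auto
      ultimately show ?thesis by (simp add: x0_def x1_def)
    qed
    show "h v \<in> {x0..x1}" if "v \<in> space \<mu>" for v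
      using that hb[of v] m(1) by (simp add: x0_def x1_def)
    show "(\<phi> has_real_derivative \<psi> x / x) (at x)" if "x \<in> {x0..x1}" for x
      using that x0 by (intro \<phi>_deriv) auto
    show "\<bar>\<psi> x / x\<bar> \<le> D" if "x \<in> {x0..x1}" for x using that D by force
    have diff: "?s k v - h v = - (h v * (t k * g v)) / (1 + t k * g v)" if "v \<in> unit_sphere" for k v
      using tg[OF that, of k] by (simp add: field_simps)
    show "\<bar>?s k v - h v\<bar> \<le> A * B * 2 * t k" if "v \<in> space \<mu>" for k v
    proof -
      have v: "v \<in> unit_sphere" using that by simp
      have "\<bar>?s k v - h v\<bar> = \<bar>h v\<bar> * \<bar>t k * g v\<bar> / (1 + t k * g v)"
        unfolding diff[OF v] using tg[OF v, of k] by (simp add: abs_mult)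
      also have "\<dots> \<le> (A * (t k * B)) / (1/2)"
        using A v tgB[OF v, of k] tg[OF v, of k] by (intro frac_le mult_mono) auto
      finally show ?thesis by (simp add: mult_ac)
    qed
    show "AE v in \<mu>. (\<lambda>k. (?s k v - h v) / t k) \<longlonglongrightarrow> - (h v * g v)"
    proof (rule AE_I2)
      fix v assume "v \<in> space \<mu>"
      then have v: "v \<in> unit_sphere" by simp
      have "(\<lambda>k. - (h v * g v) / (1 + t k * g v)) \<longlonglongrightarrow> - (h v * g v) / (1 + 0 * g v)"
        by (intro tendsto_intros t) simp
      moreover have "- (h v * g v) / (1 + t k * g v) = (?s k v - h v) / t k" for k
        unfolding diff[OF v] using t(1)[of k] by simp
      ultimately show "(\<lambda>k. (?s k v - h v) / t k) \<longlonglongrightarrow> - (h v * g v)" by simp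
    qed
    show "integrable \<mu> (\<lambda>v. \<phi> (?s k v))" for k
    proof (intro integrable_\<mu>_continuous continuous_on_\<phi>_comp)
      show "continuous_on unit_sphere (?s k)" using tg[of _ k] by (intro continuous_intros h g) force
      show "0 < ?s k v" if "v \<in> unit_sphere" for v using hpos[OF that] tg[OF that, of k] by (intro divide_pos_pos) auto
    qed
    show "integrable \<mu> (\<lambda>v. \<phi> (h v))" by (intro integrable_\<mu>_continuous continuous_on_\<phi>_comp h hpos)
    have "continuous_on unit_sphere (\<lambda>v. \<psi> (h v))"
      by (rule continuous_on_compose2[OF \<psi>_cont h]) (use hpos in auto)
    then show "(\<lambda>v. \<psi> (h v) / h v * (- (h v * g v))) \<in> borel_measurable \<mu>"
      using hpos by (intro measurable_\<mu>_continuous continuous_intros h g) force+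
  qed (use t finite_\<mu> in auto)
  have "(\<integral>v. \<psi> (h v) / h v * (- (h v * g v)) \<partial>\<mu>) = (\<integral>v. - (\<psi> (h v) * g v) \<partial>\<mu>)"
    by (intro Bochner_Integration.integral_cong refl) (use hpos in force)
  then have "(\<lambda>k. ((\<integral>v. \<phi> (?s k v) \<partial>\<mu>) - (\<integral>v. \<phi> (h v) \<partial>\<mu>)) / t k) \<longlonglongrightarrow> - (\<integral>v. \<psi> (h v) * g v \<partial>\<mu>)"
    using main by simp
  then show ?thesis by (simp add: energy_def h_def)
qed

definition admissible :: "real \<Rightarrow> ('a \<Rightarrow> real) \<Rightarrow> bool" where
  "admissible c b \<longleftrightarrow> continuous_on unit_sphere b \<and> (\<forall>v\<in>unit_sphere. 0 < b v \<and> b (- v) = b v) \<and> dual_volume b \<le> c"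

text \<open>
  The competitors are all admissible functions and not only the functions \<open>1/h\<close> of convex bodies, so
  that the perturbations \<open>(1 + tg)/h\<close> are allowed.
\<close>

definition minimal_body :: "real \<Rightarrow> 'a set \<Rightarrow> bool" where
  "minimal_body c K \<longleftrightarrow> convex_body_o K \<and> origin_symmetric K \<and> dual_volume (inv_support K) \<le> c \<and>
     (\<forall>b. admissible c b \<longrightarrow> energy (inv_support K) \<le> energy b)"

text \<open>
  Up to the sign, the derivatives of the dual volume and of the energy along \<open>(1 + tg)/h\<close> at \<open>t = 0\<close>.
\<close>

definition volume_slope :: "'a set \<Rightarrow> ('a \<Rightarrow> real) \<Rightarrow> real" where
  "volume_slope K g = (\<integral>u. radial_fun K u * partial_t G (radial_fun K u) u * g (radial_gauss K u) \<partial>sphere_measure)"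

definition energy_slope :: "'a set \<Rightarrow> ('a \<Rightarrow> real) \<Rightarrow> real" where
  "energy_slope K g = (\<integral>v. \<psi> (support_fun K v) * g v \<partial>\<mu>)"

lemma minimal_body_no_descent:
  assumes min: "minimal_body c K" and g: "continuous_on unit_sphere g" "\<And>v. v \<in> unit_sphere \<Longrightarrow> g (- v) = g v"
  shows "\<not> (0 < volume_slope K g \<and> 0 < energy_slope K g)"
proof
  assume slopes: "0 < volume_slope K g \<and> 0 < energy_slope K g"
  have K: "convex_body_o K" "origin_symmetric K" using min by (auto simp: minimal_body_def)
  obtain B where B: "0 < B" "\<forall>v\<in>unit_sphere. \<bar>g v\<bar> \<le> B" by (rule continuous_on_sphere_bounded[OF g(1)])
  define t where "t k = 1 / (2 * B) * (1 / real (Suc k))" for k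
  have t: "0 < t k" for k using B(1) by (simp add: t_def)
  have "(\<lambda>k. 1 / (2 * B) * inverse (real (Suc k))) \<longlonglongrightarrow> 0"
    by (rule tendsto_mult_right_zero[OF LIMSEQ_inverse_real_of_nat])
  moreover have "t = (\<lambda>k. 1 / (2 * B) * inverse (real (Suc k)))"
    by (rule ext) (simp only: t_def inverse_eq_divide)
  ultimately have t0: "t \<longlonglongrightarrow> 0" by (simp only:)
  have tB: "t k * B \<le> 1/2" for k
  proof -
    have "t k * B = 1 / 2 * (1 / real (Suc k))" using B(1) by (simp add: t_def)
    also have "\<dots> \<le> 1 / 2 * 1" by (intro mult_left_mono) auto
    finally show ?thesis by simp
  qed
  define b where "b k v = inv_support K v * (1 + t k * g v)" for k v
  have "(\<lambda>k. (dual_volume (b k) - dual_volume (inv_support K)) / t k) \<longlonglongrightarrow> - volume_slope K g"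
    unfolding b_def volume_slope_def by (rule dual_volume_variation[OF K(1) g(1) _ t t0 tB]) (use B(2) in blast)
  then have ev1: "\<forall>\<^sub>F k in sequentially. (dual_volume (b k) - dual_volume (inv_support K)) / t k < 0"
    using slopes by (intro order_tendstoD(2)) auto
  have "(\<lambda>k. (energy (b k) - energy (inv_support K)) / t k) \<longlonglongrightarrow> - energy_slope K g"
    unfolding b_def energy_slope_def by (rule energy_variation[OF K(1) g(1) _ t t0 tB]) (use B(2) in blast)
  then have ev2: "\<forall>\<^sub>F k in sequentially. (energy (b k) - energy (inv_support K)) / t k < 0"
    using slopes by (intro order_tendstoD(2)) auto
  obtain k where k: "(dual_volume (b k) - dual_volume (inv_support K)) / t k < 0"
    "(energy (b k) - energy (inv_support K)) / t k < 0"
    using eventually_happens'[OF _ eventually_conj[OF ev1 ev2]] by auto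
  have vol: "dual_volume (b k) < dual_volume (inv_support K)" and en: "energy (b k) < energy (inv_support K)"
    using k t[of k] by (simp_all add: divide_less_0_iff)
  have "admissible c (b k)" unfolding admissible_def
  proof (intro conjI ballI)
    show "continuous_on unit_sphere (b k)" unfolding b_def
      by (intro continuous_on_mult continuous_on_inv_support K continuous_intros g)
    show "dual_volume (b k) \<le> c" using vol min by (simp add: minimal_body_def)
    fix v :: 'a assume v: "v \<in> unit_sphere"
    have "\<bar>t k * g v\<bar> \<le> t k * B" using B(2) v t[of k] by (simp add: abs_mult)
    then have "0 < 1 + t k * g v" using tB[of k] by linarith
    then show "0 < b k v" using support_fun_pos[OF K(1) v] by (simp add: b_def)
    show "b k (- v) = b k v" using g(2)[OF v] by (simp add: b_def support_fun_uminus[OF K(2)])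
  qed
  then have "energy (inv_support K) \<le> energy (b k)" using min by (simp add: minimal_body_def)
  with en show False by simp
qed

lemma volume_slope_integrable:
  assumes K: "convex_body_o K" and g: "continuous_on unit_sphere g"
  shows "integrable sphere_measure (\<lambda>u. radial_fun K u * partial_t G (radial_fun K u) u * g (radial_gauss K u))"
proof -
  obtain B where B: "0 < B" "\<forall>v\<in>unit_sphere. \<bar>g v\<bar> \<le> B" by (rule continuous_on_sphere_bounded[OF g])
  obtain A where A: "0 < A" "\<forall>u\<in>unit_sphere. \<bar>radial_fun K u * partial_t G (radial_fun K u) u\<bar> \<le> A"
    by (rule radial_factor_bounded[OF K])
  have "AE u in sphere_measure. norm (radial_fun K u * partial_t G (radial_fun K u) u * g (radial_gauss K u)) \<le> A * B"
  proof (rule AE_regular[OF K])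
    fix u assume u: "u \<in> regular_directions K"
    then have "u \<in> unit_sphere" using regular_directions_subset by blast
    then have "\<bar>radial_fun K u * partial_t G (radial_fun K u) u\<bar> \<le> A" using A(2) by blast
    moreover have "\<bar>g (radial_gauss K u)\<bar> \<le> B" using bspec[OF B(2) radial_gauss_normal(2)[OF u]] .
    ultimately have "\<bar>radial_fun K u * partial_t G (radial_fun K u) u\<bar> * \<bar>g (radial_gauss K u)\<bar> \<le> A * B"
      using A(1) by (intro mult_mono) auto
    then show "norm (radial_fun K u * partial_t G (radial_fun K u) u * g (radial_gauss K u)) \<le> A * B"
      unfolding real_norm_def abs_mult[of "_ * _" "g _"] .
  qed
  moreover have "continuous_on (regular_directions K) (\<lambda>u. radial_fun K u * partial_t G (radial_fun K u) u * g (radial_gauss K u))"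
  proof (rule continuous_on_mult)
    show "continuous_on (regular_directions K) (\<lambda>u. radial_fun K u * partial_t G (radial_fun K u) u)"
      by (rule continuous_on_subset[OF radial_factor_continuous[OF K] regular_directions_subset])
    show "continuous_on (regular_directions K) (\<lambda>u. g (radial_gauss K u))"
      using radial_gauss_normal(2)
      by (intro continuous_on_compose2[OF g continuous_on_radial_gauss_regular[OF K]]) blast
  qed
  then have "(\<lambda>u. radial_fun K u * partial_t G (radial_fun K u) u * g (radial_gauss K u)) \<in> borel_measurable sphere_measure"
    by (rule measurable_regular[OF K])
  ultimately show ?thesis by (rule finite_measure.integrable_const_bound[OF finite_sphere_measure])
qed

lemma energy_slope_integrable:
  assumes K: "convex_body_o K" and g: "continuous_on unit_sphere g"
  shows "integrable \<mu> (\<lambda>v. \<psi> (support_fun K v) * g v)"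
  by (intro integrable_\<mu>_continuous continuous_intros psi_support_continuous[OF K] g)

lemma \<mu>_nonzero: "measure \<mu> unit_sphere \<noteq> 0"
proof
  assume "measure \<mu> unit_sphere = 0"
  then have "emeasure \<mu> (space \<mu>) = 0" using finite_measure.emeasure_eq_measure[OF finite_\<mu>] by simp
  then have ae: "AE u in \<mu>. P u" for P using sets.top[of \<mu>] by (intro AE_I[where N="space \<mu>"]) auto
  obtain v :: 'a where v: "v \<in> unit_sphere" using unit_sphere_nonempty by blast
  have "(LINT u|\<mu>. max (u \<bullet> v) 0) = 0" by (rule integral_eq_zero_AE[OF ae])
  moreover have "0 < (LINT u|\<mu>. max (u \<bullet> v) 0)"
    using \<mu>_spread v unfolding not_concentrated_on_closed_hemisphere_def by (rule bspec)
  ultimately show False by simp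
qed

lemma volume_slope_one_neg:
  assumes K: "convex_body_o K"
  shows "volume_slope K (\<lambda>_. 1) < 0"
proof -
  let ?f = "\<lambda>u. radial_fun K u * partial_t G (radial_fun K u) u * 1"
  have "?f u < 0" if "u \<in> unit_sphere" for u
    using radial_fun_pos[OF K that] Gt_neg[OF radial_fun_pos[OF K that] that] by (simp add: mult_less_0_iff)
  then have "AE u in sphere_measure. ?f u < 0" by (intro AE_I2) simp
  then have "(\<integral>u. ?f u \<partial>sphere_measure) < (\<integral>u. 0 \<partial>(sphere_measure :: 'a measure))"
    using sphere_nonnull volume_slope_integrable[OF K, of "\<lambda>_. 1"]
    by (intro finite_measure.integral_less_AE_space[OF finite_sphere_measure]) auto
  then show ?thesis unfolding volume_slope_def by simp
qed

lemma energy_slope_one_pos: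
  assumes K: "convex_body_o K"
  shows "0 < energy_slope K (\<lambda>_. 1)"
proof -
  let ?f = "\<lambda>v. \<psi> (support_fun K v) * 1"
  have "AE v in \<mu>. 0 < ?f v"
    by (rule AE_I2) (use \<psi>_pos[OF support_fun_pos[OF K]] in simp)
  moreover have "emeasure \<mu> (space \<mu>) \<noteq> 0" using \<mu>_nonzero by (auto simp: measure_def)
  ultimately have "(\<integral>v. 0 \<partial>\<mu>) < (\<integral>v. ?f v \<partial>\<mu>)"
    using energy_slope_integrable[OF K, of "\<lambda>_. 1"]
    by (intro finite_measure.integral_less_AE_space[OF finite_\<mu>]) auto
  then show ?thesis unfolding energy_slope_def by simp
qed

text \<open>
  Lagrange's rule. Shift \<open>g\<close> by a constant \<open>s\<close> slightly below the one that annihilates the volume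
  slope. Then the volume slope is positive, so the energy slope is not, and in the limit the energy
  slope of \<open>g\<close> is at most \<open>\<tau>\<close> times its volume slope. The same for \<open>-g\<close> gives equality.
\<close>

lemma minimal_body_multiplier:
  assumes min: "minimal_body c K"
  obtains \<tau> where "\<tau> < 0"
    "\<forall>g. continuous_on unit_sphere g \<and> (\<forall>v\<in>unit_sphere. g (- v) = g v) \<longrightarrow> energy_slope K g = \<tau> * volume_slope K g"
proof -
  have K: "convex_body_o K" using min by (simp add: minimal_body_def)
  let ?V = "volume_slope K" and ?E = "energy_slope K"
  have V1: "?V (\<lambda>_. 1) < 0" and E1: "0 < ?E (\<lambda>_. 1)"
    by (rule volume_slope_one_neg[OF K], rule energy_slope_one_pos[OF K])
  define \<tau> where "\<tau> = ?E (\<lambda>_. 1) / ?V (\<lambda>_. 1)"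
  have V_add: "?V (\<lambda>v. g v + s) = ?V g + s * ?V (\<lambda>_. 1)" if "continuous_on unit_sphere g" for g s
  proof -
    have "?V (\<lambda>v. g v + s) = (\<integral>u. radial_fun K u * partial_t G (radial_fun K u) u * g (radial_gauss K u)
        + s * (radial_fun K u * partial_t G (radial_fun K u) u * 1) \<partial>sphere_measure)"
      unfolding volume_slope_def by (simp add: algebra_simps)
    also have "\<dots> = ?V g + s * ?V (\<lambda>_. 1)"
      unfolding volume_slope_def
      using volume_slope_integrable[OF K that] volume_slope_integrable[OF K, of "\<lambda>_. 1"]
      by (subst Bochner_Integration.integral_add) auto
    finally show ?thesis .
  qed
  have E_add: "?E (\<lambda>v. g v + s) = ?E g + s * ?E (\<lambda>_. 1)" if "continuous_on unit_sphere g" for g s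
  proof -
    have "?E (\<lambda>v. g v + s) = (\<integral>v. \<psi> (support_fun K v) * g v + s * (\<psi> (support_fun K v) * 1) \<partial>\<mu>)"
      unfolding energy_slope_def by (simp add: algebra_simps)
    also have "\<dots> = ?E g + s * ?E (\<lambda>_. 1)"
      unfolding energy_slope_def
      using energy_slope_integrable[OF K that] energy_slope_integrable[OF K, of "\<lambda>_. 1"]
      by (subst Bochner_Integration.integral_add) auto
    finally show ?thesis .
  qed
  have le: "?E g \<le> \<tau> * ?V g" if g: "continuous_on unit_sphere g" "\<forall>v\<in>unit_sphere. g (- v) = g v" for g
  proof (rule field_le_epsilon)
    fix e :: real assume "0 < e"
    define d where "d = e / ?E (\<lambda>_. 1)"
    have d: "0 < d" using \<open>0 < e\<close> E1 by (simp add: d_def)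
    define s where "s = - ?V g / ?V (\<lambda>_. 1) - d"
    have "?V (\<lambda>v. g v + s) = - d * ?V (\<lambda>_. 1)"
      unfolding V_add[OF g(1)] s_def using V1 by (simp add: field_simps)
    then have Vp: "0 < ?V (\<lambda>v. g v + s)" using V1 d by (simp add: mult_pos_neg)
    have "\<not> (0 < ?V (\<lambda>v. g v + s) \<and> 0 < ?E (\<lambda>v. g v + s))"
      using g by (intro minimal_body_no_descent[OF min] continuous_intros) auto
    then have "?E g + s * ?E (\<lambda>_. 1) \<le> 0" using Vp unfolding E_add[OF g(1)] by simp
    then have "?E g \<le> (?V g / ?V (\<lambda>_. 1) + d) * ?E (\<lambda>_. 1)" by (simp add: s_def algebra_simps)
    also have "\<dots> = \<tau> * ?V g + e" using E1 by (simp add: \<tau>_def d_def distrib_right)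
    finally show "?E g \<le> \<tau> * ?V g + e" .
  qed
  show ?thesis
  proof (rule that)
    show "\<tau> < 0" using V1 E1 by (simp add: \<tau>_def divide_less_0_iff)
    show "\<forall>g. continuous_on unit_sphere g \<and> (\<forall>v\<in>unit_sphere. g (- v) = g v) \<longrightarrow> ?E g = \<tau> * ?V g"
    proof (intro allI impI, elim conjE)
      fix g :: "'a \<Rightarrow> real" assume g: "continuous_on unit_sphere g" "\<forall>v\<in>unit_sphere. g (- v) = g v"
      have "?E (\<lambda>v. - g v) \<le> \<tau> * ?V (\<lambda>v. - g v)"
        using g by (intro le continuous_intros) auto
      then have "\<tau> * ?V g \<le> ?E g" by (simp add: energy_slope_def volume_slope_def)
      with le[OF g] show "?E g = \<tau> * ?V g" by simp
    qed
  qed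
qed

end

section \<open>Existence of a minimiser\<close>

context dual_orlicz_minimization
begin

lemma \<mu>_cap_sets: "{u \<in> unit_sphere. \<kappa> \<le> u \<bullet> v} \<in> sets \<mu>"
proof -
  have "{u \<in> unit_sphere. \<kappa> \<le> u \<bullet> v} = unit_sphere \<inter> {u. \<kappa> \<le> u \<bullet> v}" by blast
  moreover have "closed {u. \<kappa> \<le> u \<bullet> v}" by (intro closed_Collect_le continuous_intros)
  then have "{u. \<kappa> \<le> u \<bullet> v} \<in> sets borel" by (rule borel_closed)
  ultimately show ?thesis unfolding sets_\<mu> sets_restrict_space by (simp only: imageI)
qed

lemma \<mu>_integral_indicator:
  assumes "E \<in> sets \<mu>"
  shows "(\<integral>u. indicat_real E u \<partial>\<mu>) = measure \<mu> E"
  by (subst Bochner_Integration.integral_indicator) (simp only: Int_absorb2[OF sets.sets_into_space[OF assms]])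

text \<open>
  The integral of \<open>\<langle>u,v\<rangle>\<^sub>+\<close> is continuous and positive in \<open>v\<close>, hence bounded below by some \<open>j > 0\<close>. At
  most half of it comes from points \<open>u\<close> with \<open>\<langle>u,v\<rangle> \<le> \<kappa>\<close> if \<open>\<kappa> = j / (2 \<mu>(S))\<close>.
\<close>

lemma \<mu>_cap_mass:
  obtains \<kappa> \<delta> where "0 < \<kappa>" "0 < \<delta>" "\<forall>v\<in>unit_sphere. \<delta> \<le> measure \<mu> {u \<in> unit_sphere. \<kappa> \<le> u \<bullet> v}"
proof -
  define J where "J v = (\<integral>u. max (u \<bullet> v) 0 \<partial>\<mu>)" for v
  let ?m = "measure \<mu> unit_sphere"
  have J_int: "integrable \<mu> (\<lambda>u. max (u \<bullet> v) 0)" for v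
    by (intro integrable_\<mu>_continuous continuous_intros)
  have cint: "integrable \<mu> (\<lambda>_. c)" for c :: real using finite_\<mu> by (rule finite_measure.integrable_const)
  have "?m-lipschitz_on unit_sphere J"
  proof (rule lipschitz_onI)
    fix v w :: 'a
    have "dist (J v) (J w) = \<bar>\<integral>u. max (u \<bullet> v) 0 - max (u \<bullet> w) 0 \<partial>\<mu>\<bar>"
      unfolding J_def dist_real_def by (simp add: Bochner_Integration.integral_diff[OF J_int J_int])
    also have "\<dots> \<le> (\<integral>u. dist v w \<partial>\<mu>)"
    proof (rule integral_abs_bound_integral)
      show "integrable \<mu> (\<lambda>u. max (u \<bullet> v) 0 - max (u \<bullet> w) 0)" using J_int by simp
      show "integrable \<mu> (\<lambda>u. dist v w)" by (rule cint)
      fix u assume "u \<in> space \<mu>"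
      have "\<bar>max (u \<bullet> v) 0 - max (u \<bullet> w) 0\<bar> \<le> \<bar>u \<bullet> (v - w)\<bar>" by (simp add: inner_diff_right max_def)
      also have "\<dots> \<le> norm u * norm (v - w)" by (rule Cauchy_Schwarz_ineq2)
      finally show "\<bar>max (u \<bullet> v) 0 - max (u \<bullet> w) 0\<bar> \<le> dist v w" using \<open>u \<in> space \<mu>\<close> by (simp add: dist_norm)
    qed
    also have "\<dots> = ?m * dist v w" by simp
    finally show "dist (J v) (J w) \<le> ?m * dist v w" .
  qed simp
  then have J: "continuous_on unit_sphere J" by (rule lipschitz_on_continuous_on)
  have "0 < J v" if "v \<in> unit_sphere" for v
    using \<mu>_spread that unfolding not_concentrated_on_closed_hemisphere_def J_def by blast
  then obtain j where j: "0 < j" "\<forall>v\<in>unit_sphere. j \<le> J v" by (rule continuous_on_sphere_pos_lower[OF J])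
  have m: "0 < ?m" using \<mu>_nonzero by (simp add: less_le)
  define \<kappa> where "\<kappa> = j / (2 * ?m)"
  have k: "0 < \<kappa>" using j m by (simp add: \<kappa>_def)
  have mass: "j / 2 \<le> measure \<mu> {u \<in> unit_sphere. \<kappa> \<le> u \<bullet> v}" if v: "v \<in> unit_sphere" for v
  proof -
    let ?E = "{u \<in> unit_sphere. \<kappa> \<le> u \<bullet> v}"
    have E: "?E \<in> sets \<mu>" by (rule \<mu>_cap_sets)
    have Eint: "integrable \<mu> (indicat_real ?E)"
      using finite_measure.emeasure_finite[OF finite_\<mu>, of ?E] E by (intro integrable_real_indicator) (auto simp: less_top)
    have "j \<le> J v" using j(2) v by blast
    also have "J v \<le> (\<integral>u. \<kappa> + indicat_real ?E u \<partial>\<mu>)"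
      unfolding J_def
    proof (rule integral_mono[OF J_int])
      show "integrable \<mu> (\<lambda>u. \<kappa> + indicat_real ?E u)" using cint Eint by (rule Bochner_Integration.integrable_add)
      fix u assume u: "u \<in> space \<mu>"
      have "u \<bullet> v \<le> norm u * norm v" by (rule norm_cauchy_schwarz)
      then show "max (u \<bullet> v) 0 \<le> \<kappa> + indicat_real ?E u" using u v k by (auto simp: indicator_def)
    qed
    also have "\<dots> = \<kappa> * ?m + measure \<mu> ?E"
      using \<mu>_integral_indicator[OF E] by (subst Bochner_Integration.integral_add[OF cint Eint]) simp
    also have "\<kappa> * ?m = j / 2" using m by (simp add: \<kappa>_def)
    finally show ?thesis by simp
  qed
  show ?thesis by (rule that[OF k, of "j / 2"]) (use j mass in auto)
qed

text \<open>
  If \<open>x\<close> lies in the body, then \<open>1/a(u) \<ge> \<langle>x,u\<rangle>\<close>, which is at least \<open>|x| \<kappa>\<close> on a cap of mass at least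
  \<open>\<delta>\<close>. So the energy is at least \<open>\<delta> \<phi>(|x| \<kappa>)\<close>, and \<open>\<phi>\<close> is unbounded.
\<close>

lemma energy_bounds_wulff_shape:
  obtains R where "0 < R"
    "\<forall>a. continuous_on unit_sphere a \<and> (\<forall>v\<in>unit_sphere. 0 < a v) \<and> energy a \<le> C \<longrightarrow> (\<forall>x\<in>wulff_shape a. norm x \<le> R)"
proof -
  obtain \<kappa> \<delta> where k: "0 < \<kappa>" "0 < \<delta>" "\<forall>v\<in>unit_sphere. \<delta> \<le> measure \<mu> {u \<in> unit_sphere. \<kappa> \<le> u \<bullet> v}"
    by (rule \<mu>_cap_mass)
  obtain T where T: "\<And>t. T \<le> t \<Longrightarrow> C / \<delta> + 1 \<le> \<phi> t"
    using \<phi>_top by (auto simp: filterlim_at_top eventually_at_top_linorder)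
  define R where "R = max T 1 / \<kappa>"
  have R: "0 < R" using k(1) by (simp add: R_def)
  have "norm x \<le> R" if a: "continuous_on unit_sphere a" "\<And>v. v \<in> unit_sphere \<Longrightarrow> 0 < a v"
    and C: "energy a \<le> C" and x: "x \<in> wulff_shape a" for a x
  proof (rule ccontr)
    assume "\<not> norm x \<le> R"
    then have xR: "R < norm x" by simp
    define v where "v = x /\<^sub>R norm x"
    have x0: "x \<noteq> 0" using xR R by auto
    have v: "v \<in> unit_sphere" "x = norm x *\<^sub>R v" using x0 by (auto simp: v_def)
    let ?E = "{u \<in> unit_sphere. \<kappa> \<le> u \<bullet> v}"
    have "max T 1 < norm x * \<kappa>" using xR k(1) by (simp add: R_def field_simps)
    then have xk: "T \<le> norm x * \<kappa>" "0 < norm x * \<kappa>" by auto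
    then have big: "C / \<delta> + 1 \<le> \<phi> (norm x * \<kappa>)" by (intro T)
    have E: "?E \<in> sets \<mu>" by (rule \<mu>_cap_sets)
    have "\<phi> (norm x * \<kappa>) * \<delta> \<le> \<phi> (norm x * \<kappa>) * measure \<mu> ?E"
      using k(3) v(1) \<phi>_nonneg[OF xk(2)] by (intro mult_left_mono) auto
    also have "\<dots> = (\<integral>u. \<phi> (norm x * \<kappa>) * indicat_real ?E u \<partial>\<mu>)"
      by (simp only: integral_mult_right_zero \<mu>_integral_indicator[OF E])
    also have "\<dots> \<le> energy a" unfolding energy_def
    proof (rule integral_mono)
      show "integrable \<mu> (\<lambda>u. \<phi> (norm x * \<kappa>) * indicat_real ?E u)"
        using finite_measure.emeasure_finite[OF finite_\<mu>, of ?E] E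
        by (intro integrable_mult_right integrable_real_indicator) (auto simp: less_top)
      show "integrable \<mu> (\<lambda>v. \<phi> (1 / a v))" by (rule energy_integrable[OF a])
      fix u assume "u \<in> space \<mu>"
      then have u: "u \<in> unit_sphere" by simp
      show "\<phi> (norm x * \<kappa>) * indicat_real ?E u \<le> \<phi> (1 / a u)"
      proof (cases "u \<in> ?E")
        case True
        have "a u * (x \<bullet> u) \<le> 1" using x u by (simp add: wulff_shape_def)
        then have "x \<bullet> u \<le> 1 / a u" using a(2)[OF u] by (simp add: field_simps)
        moreover have "x \<bullet> u = norm x * (u \<bullet> v)" by (subst v(2)) (simp add: inner_commute)
        moreover have "norm x * \<kappa> \<le> norm x * (u \<bullet> v)" using True by (intro mult_left_mono) auto
        ultimately have "norm x * \<kappa> \<le> 1 / a u" by linarith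
        then show ?thesis using \<phi>_mono[OF xk(2)] True by simp
      next
        case False
        then have "indicat_real ?E u = 0" by (rule indicator_simps(2))
        then show ?thesis using \<phi>_nonneg[of "1 / a u"] a(2)[OF u] by (simp only: mult_zero_right zero_less_divide_1_iff)
      qed
    qed
    also note C
    finally have "\<phi> (norm x * \<kappa>) \<le> C / \<delta>" using k(2) by (simp add: field_simps)
    with big show False by simp
  qed
  then show ?thesis using that[OF R] by blast
qed

lemma dual_volume_tendsto:
  assumes b: "\<And>n. continuous_on unit_sphere (b n)" and b0: "continuous_on unit_sphere b0"
    and m: "0 < m" "\<And>n v. v \<in> unit_sphere \<Longrightarrow> m \<le> b n v" "\<And>n v. v \<in> unit_sphere \<Longrightarrow> b n v \<le> M"
      "\<And>v. v \<in> unit_sphere \<Longrightarrow> m \<le> b0 v"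
    and lim: "\<And>e. 0 < e \<Longrightarrow> \<forall>\<^sub>F n in sequentially. \<forall>v\<in>unit_sphere. \<bar>b n v - b0 v\<bar> \<le> e"
  shows "(\<lambda>n. dual_volume (b n)) \<longlonglongrightarrow> dual_volume b0"
  unfolding dual_volume_def
proof (rule integral_dominated_convergence[where w="\<lambda>u. G (1 / M) u"])
  obtain v0 :: 'a where v0: "v0 \<in> unit_sphere" using unit_sphere_nonempty by blast
  have M: "0 < M" using m(1) m(2,3)[OF v0, of 0] by linarith
  have bpos: "0 < b n v" if "v \<in> unit_sphere" for n v using m(1) m(2)[OF that, of n] by linarith
  have b0pos: "0 < b0 v" if "v \<in> unit_sphere" for v using m(1) m(4)[OF that] by linarith
  show "(\<lambda>u. G (1 / polar_gauge b0 u) u) \<in> borel_measurable sphere_measure"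
    by (intro measurable_sphere_measure_continuous dual_volume_integrand_continuous b0 b0pos)
  show "(\<lambda>u. G (1 / polar_gauge (b n) u) u) \<in> borel_measurable sphere_measure" for n
    by (intro measurable_sphere_measure_continuous dual_volume_integrand_continuous b bpos)
  show "integrable sphere_measure (G (1 / M))"
    using M by (intro integrable_continuous_sphere continuous_on_G_comp continuous_on_const) auto
  show "AE u in sphere_measure. norm (G (1 / polar_gauge (b n) u) u) \<le> G (1 / M) u" for n
  proof (rule AE_I2)
    fix u :: 'a assume "u \<in> space sphere_measure"
    then have u: "u \<in> unit_sphere" by simp
    have p: "0 < polar_gauge (b n) u" by (rule polar_gauge_pos[OF b bpos u])
    have "\<bar>b n v\<bar> \<le> M" if "v \<in> unit_sphere" for v using bpos[OF that, of n] m(3)[OF that, of n] by linarith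
    then have "\<bar>polar_gauge (b n) u\<bar> \<le> M * norm u" by (rule polar_gauge_bound[OF b])
    then have "polar_gauge (b n) u \<le> M" using u by simp
    then have "1 / M \<le> 1 / polar_gauge (b n) u" using p by (intro divide_left_mono) (auto intro: mult_pos_pos M)
    then have "G (1 / polar_gauge (b n) u) u \<le> G (1 / M) u" using M by (intro G_antimono u) auto
    moreover have "0 < G (1 / polar_gauge (b n) u) u" using p by (intro G_pos u) auto
    ultimately show "norm (G (1 / polar_gauge (b n) u) u) \<le> G (1 / M) u" by simp
  qed
  show "AE u in sphere_measure. (\<lambda>n. G (1 / polar_gauge (b n) u) u) \<longlonglongrightarrow> G (1 / polar_gauge b0 u) u"
  proof (rule AE_I2)
    fix u :: 'a assume "u \<in> space sphere_measure"
    then have u: "u \<in> unit_sphere" by simp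
    have p0: "0 < polar_gauge b0 u" by (rule polar_gauge_pos[OF b0 b0pos u])
    have "(\<lambda>n. polar_gauge (b n) u) \<longlonglongrightarrow> polar_gauge b0 u"
    proof (rule metric_LIMSEQ_I)
      fix e :: real assume "0 < e"
      then obtain N where N: "\<forall>n\<ge>N. \<forall>v\<in>unit_sphere. \<bar>b n v - b0 v\<bar> \<le> e / 2"
        using lim[of "e / 2"] by (auto simp: eventually_sequentially)
      obtain B0 where B0: "0 < B0" "\<forall>v\<in>unit_sphere. \<bar>b0 v\<bar> \<le> B0" by (rule continuous_on_sphere_bounded[OF b0])
      have "dist (polar_gauge (b n) u) (polar_gauge b0 u) < e" if n: "N \<le> n" for n
      proof -
        obtain B where B: "0 < B" "\<forall>v\<in>unit_sphere. \<bar>b n v\<bar> \<le> B" by (rule continuous_on_sphere_bounded[OF b])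
        have "polar_gauge (b n) u \<le> polar_gauge b0 u + e / 2 * norm u + B0 * norm (u - u)"
          using N n B0(2) by (intro polar_gauge_perturb[OF b b0]) auto
        moreover have "polar_gauge b0 u \<le> polar_gauge (b n) u + e / 2 * norm u + B * norm (u - u)"
          using N n B(2) by (intro polar_gauge_perturb[OF b0 b]) (auto simp: abs_minus_commute)
        ultimately have "\<bar>polar_gauge (b n) u - polar_gauge b0 u\<bar> \<le> e / 2"
          using u unfolding abs_le_iff by auto
        then show ?thesis using \<open>0 < e\<close> by (simp add: dist_real_def)
      qed
      then show "\<exists>no. \<forall>n\<ge>no. dist (polar_gauge (b n) u) (polar_gauge b0 u) < e" by blast
    qed
    then have "(\<lambda>n. 1 / polar_gauge (b n) u) \<longlonglongrightarrow> 1 / polar_gauge b0 u"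
      using p0 by (intro tendsto_intros) auto
    moreover have "isCont (\<lambda>s. G s u) (1 / polar_gauge b0 u)"
      using p0 by (intro DERIV_isCont[OF G_deriv] u) auto
    ultimately show "(\<lambda>n. G (1 / polar_gauge (b n) u) u) \<longlonglongrightarrow> G (1 / polar_gauge b0 u) u"
      by (rule isCont_tendsto_compose[rotated])
  qed
qed

lemma energy_tendsto:
  assumes h: "\<And>n. continuous_on unit_sphere (h n)" "continuous_on unit_sphere h0"
    and b: "\<And>n v. v \<in> unit_sphere \<Longrightarrow> 0 < h n v" "\<And>n v. v \<in> unit_sphere \<Longrightarrow> h n v \<le> M" "\<And>v. v \<in> unit_sphere \<Longrightarrow> 0 < h0 v"
    and lim: "\<And>v. v \<in> unit_sphere \<Longrightarrow> (\<lambda>n. h n v) \<longlonglongrightarrow> h0 v"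
  shows "(\<lambda>n. energy (\<lambda>v. 1 / h n v)) \<longlonglongrightarrow> energy (\<lambda>v. 1 / h0 v)"
  unfolding energy_def
proof (rule integral_dominated_convergence[where w="\<lambda>_. \<phi> M"])
  show "(\<lambda>v. \<phi> (1 / (1 / h0 v))) \<in> borel_measurable \<mu>"
    by (simp, intro measurable_\<mu>_continuous continuous_on_\<phi>_comp h b)
  show "(\<lambda>v. \<phi> (1 / (1 / h n v))) \<in> borel_measurable \<mu>" for n
    by (simp, intro measurable_\<mu>_continuous continuous_on_\<phi>_comp h b)
  show "integrable \<mu> (\<lambda>_. \<phi> M)" using finite_\<mu> by (rule finite_measure.integrable_const)
  show "AE v in \<mu>. norm (\<phi> (1 / (1 / h n v))) \<le> \<phi> M" for n
    by (rule AE_I2) (use \<phi>_mono[OF b(1,2)] \<phi>_nonneg[OF b(1)] in auto)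
  show "AE v in \<mu>. (\<lambda>n. \<phi> (1 / (1 / h n v))) \<longlonglongrightarrow> \<phi> (1 / (1 / h0 v))"
    by (rule AE_I2) (use isCont_tendsto_compose[OF \<phi>_isCont[OF b(3)] lim] in auto)
qed

text \<open>
  The direct method. The support functions \<open>h\<close> of the Wulff shapes of a minimising sequence are
  bounded by the energy and hence equi-Lipschitz; by the Arzela-Ascoli theorem a subsequence converges
  uniformly to some \<open>h0\<close>. Once \<open>h0\<close> is known to be positive, dual volume and energy pass to the limit,
  and the Wulff shape of \<open>h0\<close> is a minimal body.
\<close>

lemma minimal_body_exists: "\<exists>K. minimal_body (dual_volume (\<lambda>_. 1)) K"
proof -
  define c where "c = dual_volume (\<lambda>_. 1)"
  define I where "I = Inf (energy ` Collect (admissible c))"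
  have bdd: "bdd_below (energy ` Collect (admissible c))"
    by (rule bdd_belowI[of _ 0]) (auto simp: admissible_def intro!: energy_nonneg)
  have adm1: "admissible c (\<lambda>_. 1)" by (simp add: admissible_def c_def)
  have I_le: "I \<le> energy b" if "admissible c b" for b
    unfolding I_def using that by (intro cInf_lower bdd) auto
  have "\<exists>a. admissible c a \<and> energy a < I + 1 / real (Suc i)" for i
    using cInf_lessD[of "energy ` Collect (admissible c)" "I + 1 / real (Suc i)"] adm1
    unfolding I_def by auto
  then obtain a where a: "\<And>i. admissible c (a i)" "\<And>i. energy (a i) < I + 1 / real (Suc i)" by metis
  have ac: "continuous_on unit_sphere (a i)" for i using a(1) by (auto simp: admissible_def)
  have apos: "0 < a i v" if "v \<in> unit_sphere" for i v using a(1)[of i] that by (auto simp: admissible_def)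
  have aeven: "a i (- v) = a i v" if "v \<in> unit_sphere" for i v using a(1)[of i] that by (auto simp: admissible_def)
  have avol: "dual_volume (a i) \<le> c" for i using a(1) by (auto simp: admissible_def)
  define L where "L i = wulff_shape (a i)" for i
  have L: "convex_body_o (L i)" for i unfolding L_def by (rule convex_body_o_wulff_shape[OF ac apos])
  have Lsym: "origin_symmetric (L i)" for i unfolding L_def by (rule origin_symmetric_wulff_shape) (rule aeven)
  define h where "h i = support_fun (L i)" for i
  have h: "continuous_on unit_sphere (h i)" for i unfolding h_def by (rule continuous_on_support_fun[OF L])
  have hpos: "0 < h i v" if "v \<in> unit_sphere" for i v unfolding h_def by (rule support_fun_pos[OF L that])
  have hne: "\<forall>v\<in>unit_sphere. h i v \<noteq> 0" for i
    using hpos[of _ i] by (intro ballI less_imp_neq[THEN not_sym])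
  have h_le: "h i v \<le> 1 / a i v" if "v \<in> unit_sphere" for i v
    unfolding h_def L_def by (rule support_fun_wulff_shape_le[OF ac apos that])
  have gauge_h: "polar_gauge (\<lambda>v. 1 / h i v) u = polar_gauge (a i) u" if "u \<in> unit_sphere" for i u
    unfolding h_def L_def by (rule polar_gauge_inv_support_wulff_shape[OF ac apos that])
  obtain R where R: "0 < R" and "\<forall>a. continuous_on unit_sphere a \<and> (\<forall>v\<in>unit_sphere. 0 < a v) \<and> energy a \<le> I + 1
      \<longrightarrow> (\<forall>x\<in>wulff_shape a. norm x \<le> R)"
    by (rule energy_bounds_wulff_shape[of "I + 1"])
  moreover have "energy (a i) \<le> I + 1" for i
  proof -
    have "1 / real (Suc i) \<le> 1" by simp
    then show ?thesis using a(2)[of i] by linarith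
  qed
  ultimately have LR: "norm x \<le> R" if "x \<in> L i" for i x using that ac apos unfolding L_def by blast
  have hlip: "\<bar>h i v - h i w\<bar> \<le> R * norm (v - w)" for i v w
    unfolding h_def using LR by (intro support_fun_lipschitz convex_body_oD[OF L])
  have hR: "h i v \<le> R" if v: "v \<in> unit_sphere" for i v
  proof -
    obtain x where x: "x \<in> L i" "h i v = v \<bullet> x"
      using support_fun_attained[OF convex_body_oD(1,5)[OF L]] unfolding h_def by blast
    have "v \<bullet> x \<le> norm v * norm x" by (rule norm_cauchy_schwarz)
    then show ?thesis using x LR[OF x(1)] v by simp
  qed
  obtain h0 k where h0: "continuous_on unit_sphere h0" and k: "strict_mono (k :: nat \<Rightarrow> nat)"
    and unif: "\<And>e. 0 < e \<Longrightarrow> \<exists>N. \<forall>n x. n \<ge> N \<and> x \<in> unit_sphere \<longrightarrow> norm (h (k n) x - h0 x) < e"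
  proof (rule Arzela_Ascoli[of "unit_sphere :: 'a set" h R])
    show "norm (h n x) \<le> R" if "x \<in> unit_sphere" for n x using hR[OF that, of n] hpos[OF that, of n] by simp
    show "\<exists>d>0. \<forall>n y. y \<in> unit_sphere \<and> norm (x - y) < d \<longrightarrow> norm (h n x - h n y) < e"
      if "x \<in> unit_sphere" "0 < e" for x e
    proof (intro exI[of _ "e / R"] conjI allI impI)
      show "0 < e / R" using \<open>0 < e\<close> R by simp
      fix n and y :: 'a assume "y \<in> unit_sphere \<and> norm (x - y) < e / R"
      then have "R * norm (x - y) < e" using R by (simp add: field_simps)
      then show "norm (h n x - h n y) < e" using hlip[of n x y] by simp
    qed
  qed auto
  have ptw: "(\<lambda>n. h (k n) v) \<longlonglongrightarrow> h0 v" if "v \<in> unit_sphere" for v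
    unfolding lim_sequentially dist_real_def using unif that by (metis real_norm_def)
  have h0_nonneg: "0 \<le> h0 v" if "v \<in> unit_sphere" for v
    by (rule LIMSEQ_le_const[OF ptw[OF that]]) (use hpos[OF that] less_imp_le in blast)
  have h0_even: "h0 (- v) = h0 v" if v: "v \<in> unit_sphere" for v
  proof (rule LIMSEQ_unique)
    show "(\<lambda>n. h (k n) v) \<longlonglongrightarrow> h0 v" by (rule ptw[OF v])
    have "- v \<in> unit_sphere" using v by simp
    from ptw[OF this] show "(\<lambda>n. h (k n) v) \<longlonglongrightarrow> h0 (- v)"
      unfolding h_def support_fun_uminus[OF Lsym] .
  qed
  have h0_pos: "0 < h0 v" if v: "v \<in> unit_sphere" for v
  proof (rule ccontr)
    assume "\<not> ?thesis"
    then have z: "h0 v = 0" using h0_nonneg[OF v] by simp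
    have cap_sets: "cap \<epsilon> v \<in> sets sphere_measure"
    proof -
      have "cap \<epsilon> v = {u. \<epsilon> \<le> u \<bullet> v} \<inter> unit_sphere" by (auto simp: cap_def)
      moreover have "closed {u. \<epsilon> \<le> u \<bullet> v}" by (intro closed_Collect_le continuous_intros)
      ultimately show ?thesis using borel_Int_sphere_sets[OF borel_closed] by simp
    qed
    have "(\<lambda>n. h (k n) v / \<epsilon>) \<longlonglongrightarrow> 0 / \<epsilon>" using ptw[OF v] \<epsilon>_pos unfolding z by (intro tendsto_intros) auto
    then have lim0: "(\<lambda>n. h (k n) v / \<epsilon>) \<longlonglongrightarrow> 0" by simp
    have pos: "h (k n) v / \<epsilon> \<in> {0<..} \<and> h (k n) v / \<epsilon> \<noteq> 0" for n
      using hpos[OF v, of "k n"] \<epsilon>_pos by simp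
    have "filterlim (\<lambda>n. h (k n) v / \<epsilon>) (at_right 0) sequentially"
      unfolding filterlim_at by (intro conjI always_eventually allI pos lim0)
    then have "filterlim (\<lambda>n. LINT u : cap \<epsilon> v | sphere_measure. G (h (k n) v / \<epsilon>) u) at_top sequentially"
      by (rule filterlim_compose[OF G_blowup[OF v]])
    then have "\<forall>\<^sub>F n in sequentially. c + 1 \<le> (LINT u : cap \<epsilon> v | sphere_measure. G (h (k n) v / \<epsilon>) u)"
      by (simp add: filterlim_at_top)
    then obtain n where n: "c + 1 \<le> (LINT u : cap \<epsilon> v | sphere_measure. G (h (k n) v / \<epsilon>) u)"
      unfolding eventually_sequentially by blast
    let ?i = "k n"
    (* On the cap around v the radial function is at most h(v) / \<langle>u,v\<rangle>, hence at most
       h(v) / \<epsilon>, which tends to 0 along the subsequence. *)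
    have "(LINT u : cap \<epsilon> v | sphere_measure. G (h ?i v / \<epsilon>) u) \<le> dual_volume (a ?i)"
      unfolding set_lebesgue_integral_def dual_volume_def
    proof (rule integral_mono)
      have hp: "0 < h ?i v / \<epsilon>" using hpos[OF v] \<epsilon>_pos by simp
      have gi: "integrable sphere_measure (\<lambda>u. G (h ?i v / \<epsilon>) u)"
        using hp by (intro integrable_continuous_sphere continuous_on_G_comp continuous_on_const) auto
      show "integrable sphere_measure (\<lambda>u. indicat_real (cap \<epsilon> v) u *\<^sub>R G (h ?i v / \<epsilon>) u)"
        by (rule integrable_mult_indicator[OF cap_sets gi])
      show "integrable sphere_measure (\<lambda>u. G (1 / polar_gauge (a ?i) u) u)"
        by (intro integrable_continuous_sphere dual_volume_integrand_continuous ac apos)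
      fix u :: 'a assume "u \<in> space sphere_measure"
      then have u: "u \<in> unit_sphere" by simp
      have p: "0 < polar_gauge (a ?i) u" by (rule polar_gauge_pos[OF ac apos u])
      show "indicat_real (cap \<epsilon> v) u *\<^sub>R G (h ?i v / \<epsilon>) u \<le> G (1 / polar_gauge (a ?i) u) u"
      proof (cases "u \<in> cap \<epsilon> v")
        case True
        then have uv: "\<epsilon> \<le> u \<bullet> v" by (simp add: cap_def)
        have "\<epsilon> / h ?i v \<le> (u \<bullet> v) / h ?i v" using uv hpos[OF v, of ?i] by (intro divide_right_mono) auto
        also have "\<dots> = 1 / h ?i v * (u \<bullet> v)" by simp
        also have "\<dots> \<le> polar_gauge (\<lambda>v. 1 / h ?i v) u"
          by (intro polar_gauge_upper v continuous_on_divide continuous_on_const h hne)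
        also have "\<dots> = polar_gauge (a ?i) u" by (rule gauge_h[OF u])
        finally have "\<epsilon> / h ?i v \<le> polar_gauge (a ?i) u" .
        then have "1 / polar_gauge (a ?i) u \<le> h ?i v / \<epsilon>"
          using p hpos[OF v, of ?i] \<epsilon>_pos by (simp add: field_simps)
        then have "G (h ?i v / \<epsilon>) u \<le> G (1 / polar_gauge (a ?i) u) u" using p by (intro G_antimono u) auto
        then show ?thesis using True by simp
      next
        case False
        then show ?thesis using G_pos[OF _ u, of "1 / polar_gauge (a ?i) u"] p by simp
      qed
    qed
    then show False using n avol[of ?i] by linarith
  qed
  obtain m where m: "0 < m" "\<forall>v\<in>unit_sphere. m \<le> h0 v" by (rule continuous_on_sphere_pos_lower[OF h0 h0_pos])
  obtain N where N: "\<forall>n x. n \<ge> N \<and> x \<in> unit_sphere \<longrightarrow> norm (h (k n) x - h0 x) < m / 2"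
    using unif[of "m / 2"] m(1) by auto
  (* The first N terms are dropped so that all remaining ones are bounded below by m / 2. *)
  define H where "H n = h (k (n + N))" for n
  have Hlow: "m / 2 \<le> H n v" if "v \<in> unit_sphere" for n v
  proof -
    have "\<bar>H n v - h0 v\<bar> < m / 2" using N that by (simp add: H_def)
    then show ?thesis using bspec[OF m(2) that] by linarith
  qed
  have H: "continuous_on unit_sphere (H n)" for n unfolding H_def by (rule h)
  have Hpos: "0 < H n v" if "v \<in> unit_sphere" for n v unfolding H_def by (rule hpos[OF that])
  have HR: "H n v \<le> R" if "v \<in> unit_sphere" for n v unfolding H_def by (rule hR[OF that])
  have h0R: "h0 v \<le> R" if "v \<in> unit_sphere" for v
    by (rule LIMSEQ_le_const2[OF ptw[OF that]]) (use hR[OF that] in blast)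
  define b where "b v = 1 / h0 v" for v
  have b: "continuous_on unit_sphere b" unfolding b_def using h0_pos by (intro continuous_intros h0) force
  have bpos: "0 < b v" if "v \<in> unit_sphere" for v using h0_pos[OF that] by (simp add: b_def)
  have volH: "dual_volume (\<lambda>v. 1 / H n v) = dual_volume (a (k (n + N)))" for n
    unfolding dual_volume_def H_def by (intro Bochner_Integration.integral_cong refl) (simp add: gauge_h)
  have "(\<lambda>n. dual_volume (\<lambda>v. 1 / H n v)) \<longlonglongrightarrow> dual_volume b"
  proof (rule dual_volume_tendsto[where m="1 / R" and M="2 / m"])
    show "continuous_on unit_sphere (\<lambda>v. 1 / H n v)" for n
      unfolding H_def by (intro continuous_on_divide continuous_on_const h hne)
    show "continuous_on unit_sphere b" by (rule b)
    show "0 < 1 / R" using R by simp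
    show "1 / R \<le> 1 / H n v" if "v \<in> unit_sphere" for n v
      using HR[OF that] Hpos[OF that] R by (intro divide_left_mono mult_pos_pos) auto
    show "1 / H n v \<le> 2 / m" if "v \<in> unit_sphere" for n v
      using Hlow[OF that, of n] Hpos[OF that, of n] m(1) by (simp add: field_simps)
    show "1 / R \<le> b v" if "v \<in> unit_sphere" for v
      unfolding b_def using h0R[OF that] h0_pos[OF that] R by (intro divide_left_mono mult_pos_pos) auto
    fix e :: real assume e: "0 < e"
    obtain N' where N': "\<forall>n x. n \<ge> N' \<and> x \<in> unit_sphere \<longrightarrow> norm (h (k n) x - h0 x) < e * (m / 2 * m)"
      using unif[of "e * (m / 2 * m)"] e m(1) by auto
    show "\<forall>\<^sub>F n in sequentially. \<forall>v\<in>unit_sphere. \<bar>1 / H n v - b v\<bar> \<le> e"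
      unfolding eventually_sequentially
    proof (intro exI[of _ N'] allI impI ballI)
      fix n and v :: 'a assume n: "N' \<le> n" and v: "v \<in> unit_sphere"
      have pos: "0 < H n v" "0 < h0 v" using Hpos[OF v] h0_pos[OF v] by auto
      have d: "\<bar>h0 v - H n v\<bar> \<le> e * (m / 2 * m)"
        using N'[rule_format, of "n + N" v] n v by (simp add: H_def abs_minus_commute)
      have "1 / H n v - b v = (h0 v - H n v) / (H n v * h0 v)" using pos by (simp add: b_def field_simps)
      then have "\<bar>1 / H n v - b v\<bar> = \<bar>h0 v - H n v\<bar> / (H n v * h0 v)" using pos by (simp add: abs_mult)
      also have "\<dots> \<le> e * (m / 2 * m) / (m / 2 * m)"
        using d m(1) e Hlow[OF v, of n] bspec[OF m(2) v] by (intro frac_le mult_mono) auto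
      also have "\<dots> = e" using m(1) by simp
      finally show "\<bar>1 / H n v - b v\<bar> \<le> e" .
    qed
  qed
  then have vol_b: "dual_volume b \<le> c"
    by (rule LIMSEQ_le_const2) (use avol volH in auto)
  have en_lim: "(\<lambda>n. energy (\<lambda>v. 1 / H n v)) \<longlonglongrightarrow> energy b"
    unfolding b_def
  proof (rule energy_tendsto[where M=R])
    show "(\<lambda>n. H n v) \<longlonglongrightarrow> h0 v" if "v \<in> unit_sphere" for v
      unfolding H_def using ptw[OF that] by (rule LIMSEQ_ignore_initial_segment)
  qed (rule H h0 Hpos HR h0_pos; assumption?)+
  have en_le: "energy (\<lambda>v. 1 / H n v) \<le> I + 1 / real (Suc n)" for n
  proof -
    have le: "n \<le> k (n + N)" using seq_suble[OF k, of "n + N"] by simp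
    have "energy (\<lambda>v. 1 / H n v) \<le> energy (a (k (n + N)))"
    proof (rule energy_mono)
      show "a (k (n + N)) v \<le> 1 / H n v" if "v \<in> unit_sphere" for v
        using h_le[OF that, of "k (n + N)"] hpos[OF that, of "k (n + N)"] apos[OF that, of "k (n + N)"]
        by (simp add: H_def field_simps)
      show "continuous_on unit_sphere (\<lambda>v. 1 / H n v)" unfolding H_def by (intro continuous_on_divide continuous_on_const h hne)
    qed (use ac apos in auto)
    also have "\<dots> \<le> I + 1 / real (Suc (k (n + N)))" using a(2) less_imp_le by blast
    also have "\<dots> \<le> I + 1 / real (Suc n)" using le by (intro add_left_mono divide_left_mono) auto
    finally show ?thesis .
  qed
  have "(\<lambda>n. I + 1 / real (Suc n)) \<longlonglongrightarrow> I + 0"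
    using LIMSEQ_inverse_real_of_nat by (intro tendsto_add tendsto_const) (simp add: inverse_eq_divide)
  then have en_b: "energy b \<le> I" using LIMSEQ_le[OF en_lim] en_le by auto
  define K where "K = wulff_shape b"
  have K: "convex_body_o K" unfolding K_def by (rule convex_body_o_wulff_shape[OF b bpos])
  have "dual_volume (inv_support K) = dual_volume b"
    unfolding dual_volume_def K_def
  proof (intro Bochner_Integration.integral_cong refl)
    fix u :: 'a assume "u \<in> space sphere_measure"
    then have "u \<in> unit_sphere" by simp
    then show "G (1 / polar_gauge (inv_support (wulff_shape b)) u) u = G (1 / polar_gauge b u) u"
      by (subst polar_gauge_inv_support_wulff_shape[OF b bpos]) auto
  qed
  moreover have "energy (inv_support K) \<le> energy b"
  proof (rule energy_mono[OF b bpos continuous_on_inv_support[OF K]])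
    show "b v \<le> inv_support K v" if "v \<in> unit_sphere" for v
      using support_fun_wulff_shape_le[OF b bpos that] support_fun_pos[OF K that] bpos[OF that]
      by (simp add: K_def field_simps)
  qed
  moreover have "origin_symmetric K"
    unfolding K_def by (rule origin_symmetric_wulff_shape) (simp add: b_def h0_even)
  ultimately have "minimal_body c K"
    unfolding minimal_body_def using K vol_b en_b I_le by (auto intro: order_trans)
  then show ?thesis unfolding c_def by blast
qed

end

section \<open>From the Euler-Lagrange equation to the measure\<close>

text \<open>
  The indicator of a closed set is the pointwise limit of the continuous functions
  \<open>max 0 (1 - k dist(x,F))\<close>, and the closed sets form an intersection-stable generator.
\<close>

lemma finite_measure_eqI_continuous:
  fixes M N :: "'a::metric_space measure"
  assumes M: "finite_measure M" "sets M = sets borel" and N: "finite_measure N" "sets N = sets borel"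
    and eq: "\<And>g :: 'a \<Rightarrow> real. continuous_on UNIV g \<Longrightarrow> (\<And>x. 0 \<le> g x \<and> g x \<le> 1) \<Longrightarrow> (\<integral>x. g x \<partial>M) = (\<integral>x. g x \<partial>N)"
  shows "M = N"
proof -
  have closed: "emeasure M F = emeasure N F" if F: "closed F" for F :: "'a set"
  proof (cases "F = {}")
    case False
    define g where "g k x = max 0 (1 - real k * infdist x F)" for k x
    have cont: "continuous_on UNIV (g k)" for k unfolding g_def by (intro continuous_intros)
    have g01: "0 \<le> g k x \<and> g k x \<le> 1" for k x by (simp add: g_def infdist_nonneg)
    have lim: "(\<lambda>k. g k x) \<longlonglongrightarrow> indicat_real F x" for x
    proof (cases "x \<in> F")
      case True
      then have "g k x = 1" for k by (simp add: g_def)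
      then show ?thesis using True by simp
    next
      case nF: False
      then have pos: "0 < infdist x F"
        using in_closed_iff_infdist_zero[OF F False] infdist_nonneg[of x F] by (metis less_eq_real_def)
      obtain n where n: "1 < real n * infdist x F" using reals_Archimedean3[OF pos] by blast
      have "\<forall>\<^sub>F k in sequentially. g k x = 0"
        unfolding eventually_sequentially
      proof (intro exI[of _ n] allI impI)
        fix k assume "n \<le> k"
        then have "real n * infdist x F \<le> real k * infdist x F" using pos by (intro mult_right_mono) auto
        with n show "g k x = 0" by (simp add: g_def)
      qed
      then show ?thesis using nF by (simp add: tendsto_eventually)
    qed
    have conv: "(\<lambda>k. \<integral>x. g k x \<partial>P) \<longlonglongrightarrow> measure P F" if P: "finite_measure P" "sets P = sets borel" for P
    proof -
      have F': "F \<in> sets P" using F P by simp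
      have "(\<lambda>k. \<integral>x. g k x \<partial>P) \<longlonglongrightarrow> (\<integral>x. indicat_real F x \<partial>P)"
      proof (rule integral_dominated_convergence[where w="\<lambda>_. 1"])
        show "indicat_real F \<in> borel_measurable P" using F' by simp
        show "g k \<in> borel_measurable P" for k
          using borel_measurable_continuous_onI[OF cont[of k]] measurable_cong_sets[OF P(2) refl] by blast
        show "integrable P (\<lambda>_. 1::real)" using P(1) by (rule finite_measure.integrable_const)
        show "AE x in P. (\<lambda>k. g k x) \<longlonglongrightarrow> indicat_real F x" using lim by simp
        show "AE x in P. norm (g k x) \<le> 1" for k using g01 by simp
      qed
      also have "(\<integral>x. indicat_real F x \<partial>P) = measure P F"
        by (subst Bochner_Integration.integral_indicator) (simp only: Int_absorb2[OF sets.sets_into_space[OF F']])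
      finally show ?thesis .
    qed
    have "measure M F = measure N F"
    proof (rule LIMSEQ_unique[OF conv[OF M]])
      show "(\<lambda>k. \<integral>x. g k x \<partial>M) \<longlonglongrightarrow> measure N F"
      proof -
        have "(\<integral>x. g k x \<partial>M) = (\<integral>x. g k x \<partial>N)" for k
          by (rule eq) (rule cont, rule g01)
        then show ?thesis using conv[OF N] by simp
      qed
    qed
    then show ?thesis by (simp add: finite_measure.emeasure_eq_measure[OF M(1)] finite_measure.emeasure_eq_measure[OF N(1)])
  qed simp
  show ?thesis
  proof (rule measure_eqI_generator_eq[where E="{F. closed F}" and \<Omega>=UNIV and A="\<lambda>_. UNIV"])
    show "Int_stable {F::'a set. closed F}" by (auto simp: Int_stable_def)
    show "sets M = sigma_sets UNIV {F. closed F}" "sets N = sigma_sets UNIV {F. closed F}"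
      using M(2) N(2) by (simp_all add: borel_eq_closed)
    show "emeasure M UNIV \<noteq> \<infinity>" for i :: nat
      using finite_measure.emeasure_finite[OF M(1), of UNIV] by simp
  qed (auto simp: closed)
qed

context dual_orlicz_minimization
begin

text \<open>
  The multiplier rule applied to the even function \<open>f(v) = (g(v) + g(-v)) / (2 \<psi>(h(v)))\<close>. Since \<open>\<mu>\<close> is
  even and \<open>K\<close> symmetric, replacing \<open>g\<close> by its even part changes neither of the two integrals.
  The factor \<open>DIM('a)\<close> is the \<open>1/n\<close> in front of the curvature measure.
\<close>

lemma minimal_body_curvature:
  assumes min: "minimal_body c K" and even: "even_measure \<mu>"
  obtains \<tau> where "\<tau> < 0" "\<forall>E\<in>sets \<mu>. measure \<mu> E = \<tau> * dual_orlicz_curvature G \<psi> K E"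
proof -
  have K: "convex_body_o K" "origin_symmetric K" using min by (auto simp: minimal_body_def)
  let ?S = "unit_sphere :: 'a set"
  obtain \<tau>0 where \<tau>0: "\<tau>0 < 0"
    and mult: "\<forall>g. continuous_on ?S g \<and> (\<forall>v\<in>?S. g (- v) = g v) \<longrightarrow> energy_slope K g = \<tau>0 * volume_slope K g"
    by (rule minimal_body_multiplier[OF min])
  define w where "w u = \<tau>0 * curvature_density K u" for u
  note radial_gauss_measurable[OF K(1), measurable] curvature_density_measurable[OF K(1), measurable]
  have w_meas [measurable]: "w \<in> borel_measurable sphere_measure" unfolding w_def by measurable
  have w_int: "integrable sphere_measure w"
    unfolding w_def by (intro integrable_mult_right curvature_density_integrable[OF K(1)])
  have w_nonneg: "AE u in sphere_measure. 0 \<le> w u"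
    by (rule AE_regular[OF K(1)]) (use curvature_density_neg[OF K(1)] \<tau>0 in \<open>force simp: w_def mult_nonpos_nonpos\<close>)
  (* Both measures live on the whole space, so that equality can be tested on closed sets. *)
  define M where "M = distr \<mu> borel (\<lambda>v. v)"
  define N where "N = distr (density sphere_measure (\<lambda>u. ennreal (w u))) borel (radial_gauss K)"
  have id_meas: "(\<lambda>v. v) \<in> measurable \<mu> borel" by (intro measurable_\<mu>_continuous continuous_intros)
  have rg_meas: "radial_gauss K \<in> measurable (density sphere_measure (\<lambda>u. ennreal (w u))) borel" by measurable
  have neg_meas: "uminus \<in> measurable \<mu> \<mu>"
  proof -
    have "uminus \<in> measurable (restrict_space borel ?S) (restrict_space borel ?S)"
      by (intro measurable_restrict_space3) auto
    then show ?thesis using measurable_cong_sets[OF sets_\<mu> sets_\<mu>] by blast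
  qed
  have \<mu>_neg: "distr \<mu> \<mu> uminus = \<mu>"
  proof (rule measure_eqI)
    fix E assume "E \<in> sets (distr \<mu> \<mu> uminus)"
    then have E: "E \<in> sets \<mu>" by simp
    then have ES: "E \<subseteq> ?S" using sets.sets_into_space[OF E] by simp
    then have "uminus -` E \<inter> space \<mu> = uminus ` E" by (force simp: image_iff)
    then have "emeasure (distr \<mu> \<mu> uminus) E = emeasure \<mu> (uminus ` E)"
      using emeasure_distr[OF neg_meas E] by simp
    also have "\<dots> = emeasure \<mu> E"
      using even E by (simp add: even_measure_def finite_measure.emeasure_eq_measure[OF finite_\<mu>])
    finally show "emeasure (distr \<mu> \<mu> uminus) E = emeasure \<mu> E" .
  qed simp
  have "M = N"
  proof (rule finite_measure_eqI_continuous)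
    show "finite_measure M" unfolding M_def by (rule finite_measure.finite_measure_distr[OF finite_\<mu> id_meas])
    show "sets M = sets borel" "sets N = sets borel" by (simp_all add: M_def N_def)
    have "finite_measure (density sphere_measure (\<lambda>u. ennreal (w u)))"
    proof
      have "emeasure (density sphere_measure (\<lambda>u. ennreal (w u))) (space sphere_measure) = (\<integral>\<^sup>+u. ennreal (w u) \<partial>sphere_measure)"
      proof -
        have "emeasure (density sphere_measure (\<lambda>u. ennreal (w u))) (space sphere_measure)
            = (\<integral>\<^sup>+u. ennreal (w u) * indicator (space sphere_measure) u \<partial>sphere_measure)"
          by (rule emeasure_density) measurable
        also have "\<dots> = (\<integral>\<^sup>+u. ennreal (w u) \<partial>sphere_measure)" by (rule nn_integral_cong) simp
        finally show ?thesis .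
      qed
      also have "\<dots> = ennreal (\<integral>u. w u \<partial>sphere_measure)" by (rule nn_integral_eq_integral[OF w_int w_nonneg])
      finally show "emeasure (density sphere_measure (\<lambda>u. ennreal (w u))) (space (density sphere_measure (\<lambda>u. ennreal (w u)))) \<noteq> \<infinity>" by simp
    qed
    then show "finite_measure N" unfolding N_def by (rule finite_measure.finite_measure_distr[OF _ rg_meas])
    fix g :: "'a \<Rightarrow> real" assume g: "continuous_on UNIV g" and g01: "\<And>x. 0 \<le> g x \<and> g x \<le> 1"
    have g_borel [measurable]: "g \<in> borel_measurable borel" using g by (rule borel_measurable_continuous_onI)
    have gS: "continuous_on ?S g" "continuous_on ?S (\<lambda>v. g (- v))"
      by (rule continuous_on_subset[OF g], simp) (intro continuous_on_compose2[OF g] continuous_intros, simp)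
    have g_gauss_meas: "(\<lambda>u. g (radial_gauss K u)) \<in> borel_measurable sphere_measure" by measurable
    have g_abs: "\<bar>g v\<bar> \<le> 1" "\<bar>g (- v)\<bar> \<le> 1" for v using g01[of v] g01[of "- v"] by auto
    define f where "f v = (g v + g (- v)) / (2 * \<psi> (support_fun K v))" for v
    have psi: "0 < \<psi> (support_fun K v)" if "v \<in> ?S" for v by (intro \<psi>_pos support_fun_pos[OF K(1) that])
    have f_cont: "continuous_on ?S f" unfolding f_def
      using psi by (intro continuous_intros gS psi_support_continuous[OF K(1)]) force
    have f_even: "\<forall>v\<in>?S. f (- v) = f v" by (simp add: f_def support_fun_uminus[OF K(2)] add.commute)
    have slope_eq: "energy_slope K f = \<tau>0 * volume_slope K f" using mult f_cont f_even by blast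
    have "energy_slope K f = (\<integral>v. (g v + g (- v)) / 2 \<partial>\<mu>)"
      unfolding energy_slope_def
    proof (intro Bochner_Integration.integral_cong refl)
      fix v assume "v \<in> space \<mu>"
      then show "\<psi> (support_fun K v) * f v = (g v + g (- v)) / 2" using psi[of v] by (simp add: f_def)
    qed
    also have "\<dots> = ((\<integral>v. g v \<partial>\<mu>) + (\<integral>v. g (- v) \<partial>\<mu>)) / 2"
      using integrable_\<mu>_continuous[OF gS(1)] integrable_\<mu>_continuous[OF gS(2)] by simp
    also have "(\<integral>v. g (- v) \<partial>\<mu>) = (\<integral>v. g v \<partial>\<mu>)"
    proof -
      have "(\<integral>v. g v \<partial>distr \<mu> \<mu> uminus) = (\<integral>v. g (- v) \<partial>\<mu>)"
        by (rule integral_distr[OF neg_meas measurable_\<mu>_continuous[OF gS(1)]])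
      then show ?thesis by (simp add: \<mu>_neg)
    qed
    finally have e1: "energy_slope K f = (\<integral>v. g v \<partial>\<mu>)" by simp
    have int1: "integrable sphere_measure (\<lambda>u. g (radial_gauss K u) * curvature_density K u)"
      by (rule curvature_integrable[OF K(1) g_borel, where B=1]) (rule g_abs)
    have int2: "integrable sphere_measure (\<lambda>u. g (- radial_gauss K u) * curvature_density K u)"
    proof (rule curvature_integrable[OF K(1), where B=1])
      show "(\<lambda>v. g (- v)) \<in> borel_measurable borel" by measurable
    qed (rule g_abs)
    have "volume_slope K f = (\<integral>u. (g (radial_gauss K u) * curvature_density K u + g (- radial_gauss K u) * curvature_density K u) / 2 \<partial>sphere_measure)"
      unfolding volume_slope_def
    proof (rule integral_cong_AE)
      show "(\<lambda>u. radial_fun K u * partial_t G (radial_fun K u) u * f (radial_gauss K u)) \<in> borel_measurable sphere_measure"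
        by (rule borel_measurable_integrable[OF volume_slope_integrable[OF K(1) f_cont]])
      show "(\<lambda>u. (g (radial_gauss K u) * curvature_density K u + g (- radial_gauss K u) * curvature_density K u) / 2) \<in> borel_measurable sphere_measure"
        using int1 int2 by (intro borel_measurable_integrable) auto
      show "AE u in sphere_measure. radial_fun K u * partial_t G (radial_fun K u) u * f (radial_gauss K u)
          = (g (radial_gauss K u) * curvature_density K u + g (- radial_gauss K u) * curvature_density K u) / 2"
        by (intro AE_I2) (simp add: f_def curvature_density_def add_divide_distrib distrib_left mult_ac)
    qed
    also have "\<dots> = (\<integral>u. g (radial_gauss K u) * curvature_density K u \<partial>sphere_measure)"
      using int1 int2 curvature_integral_reflect[OF K(1) g_borel K(2)] by simp
    finally have e2: "volume_slope K f = (\<integral>u. g (radial_gauss K u) * curvature_density K u \<partial>sphere_measure)" .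
    have "(\<integral>x. g x \<partial>M) = (\<integral>v. g v \<partial>\<mu>)"
      unfolding M_def by (rule integral_distr[OF id_meas g_borel])
    also have "\<dots> = \<tau>0 * (\<integral>u. g (radial_gauss K u) * curvature_density K u \<partial>sphere_measure)"
      using slope_eq e1 e2 by simp
    also have "\<dots> = (\<integral>u. w u * g (radial_gauss K u) \<partial>sphere_measure)"
      unfolding w_def by (simp only: integral_mult_right_zero[symmetric] mult_ac)
    also have "\<dots> = (\<integral>u. g (radial_gauss K u) \<partial>density sphere_measure (\<lambda>u. ennreal (w u)))"
      by (rule integral_real_density[OF w_meas w_nonneg g_gauss_meas, symmetric])
    also have "\<dots> = (\<integral>x. g x \<partial>N)"
      unfolding N_def by (rule integral_distr[OF rg_meas g_borel, symmetric])
    finally show "(\<integral>x. g x \<partial>M) = (\<integral>x. g x \<partial>N)" .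
  qed
  have "measure \<mu> E = \<tau>0 * real DIM('a) * dual_orlicz_curvature G \<psi> K E" if E: "E \<in> sets \<mu>" for E
  proof -
    have ES: "E \<subseteq> ?S" using sets.sets_into_space[OF E] by simp
    have EB [measurable]: "E \<in> sets borel"
    proof -
      obtain B where B: "B \<in> sets borel" "E = ?S \<inter> B" using E unfolding sets_\<mu> sets_restrict_space by blast
      then show ?thesis by simp
    qed
    have "measure \<mu> E = measure M E"
      unfolding M_def using measure_distr[OF id_meas EB] ES by (simp add: Int_absorb2)
    also have "\<dots> = (\<integral>x. indicat_real E x \<partial>N)" by (simp add: \<open>M = N\<close> N_def)
    also have "\<dots> = (\<integral>u. indicat_real E (radial_gauss K u) \<partial>density sphere_measure (\<lambda>u. ennreal (w u)))"
      unfolding N_def by (rule integral_distr[OF rg_meas]) measurable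
    also have "\<dots> = (\<integral>u. w u * indicat_real E (radial_gauss K u) \<partial>sphere_measure)"
      by (rule integral_real_density[OF w_meas w_nonneg]) measurable
    also have "\<dots> = \<tau>0 * (\<integral>u. indicat_real E (radial_gauss K u) * curvature_density K u \<partial>sphere_measure)"
      unfolding w_def by (simp only: integral_mult_right_zero[symmetric] mult_ac)
    also have "\<dots> = \<tau>0 * real DIM('a) * dual_orlicz_curvature G \<psi> K E"
      by (simp add: dual_orlicz_curvature_eq[OF K(1) EB])
    finally show ?thesis .
  qed
  then show ?thesis using \<tau>0 by (intro that[of "\<tau>0 * real DIM('a)"]) (auto simp: mult_neg_pos)
qed

end

section \<open>The primitive of \<open>\<psi>(s)/s\<close>\<close>

lemma orlicz_primitive:
  fixes \<psi> :: "real \<Rightarrow> real"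
  assumes pos: "\<forall>t>0. \<psi> t > 0" and cont: "continuous_on {0<..} \<psi>"
    and inf: "(\<integral>\<^sup>+ s\<in>{1..}. ennreal (\<psi> s / s) \<partial>lborel) = \<infinity>"
    and fin: "\<forall>t>0. (\<integral>\<^sup>+ s\<in>{0<..t}. ennreal (\<psi> s / s) \<partial>lborel) < \<infinity>"
  obtains \<phi> where "\<forall>t>0. (\<phi> has_real_derivative \<psi> t / t) (at t)" "\<forall>t>0. 0 \<le> \<phi> t" "filterlim \<phi> at_top at_top"
proof -
  define q where "q s = \<psi> s / s" for s
  define \<phi> where "\<phi> t = enn2real (\<integral>\<^sup>+ s\<in>{0<..t}. ennreal (q s) \<partial>lborel)" for t
  have q_pos: "0 < q s" if "0 < s" for s using pos that by (simp add: q_def)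
  have q_cont: "continuous_on {0<..} q" unfolding q_def by (intro continuous_intros cont) auto
  have meas: "(\<lambda>s. ennreal (q s) * indicator A s) \<in> borel_measurable borel" if A: "A \<in> sets borel" "A \<subseteq> {0<..}" for A
  proof -
    have "(\<lambda>s. indicator {0<..} s *\<^sub>R q s) \<in> borel_measurable borel"
      by (rule borel_measurable_continuous_on_indicator[OF _ q_cont]) simp
    then have "(\<lambda>s. ennreal (indicator {0<..} s *\<^sub>R q s) * indicator A s) \<in> borel_measurable borel"
      using A(1) by measurable
    moreover have "ennreal (indicator {0<..} s *\<^sub>R q s) * indicator A s = ennreal (q s) * indicator A s" for s
      using A(2) by (auto simp: indicator_def)
    ultimately show ?thesis by simp
  qed
  have fin': "(\<integral>\<^sup>+ s\<in>{0<..t}. ennreal (q s) \<partial>lborel) < \<infinity>" if "0 < t" for t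
    using fin that by (simp add: q_def)
  have piece: "(\<integral>\<^sup>+ s\<in>{a..b}. ennreal (q s) \<partial>lborel) = ennreal (integral {a..b} q)" if ab: "0 < a" "a \<le> b" for a b
  proof -
    have c: "continuous_on {a..b} q" using ab by (intro continuous_on_subset[OF q_cont]) auto
    have "(q has_integral integral {a..b} q) {a..b}" using c by (intro integrable_integral integrable_continuous_real)
    then show ?thesis
      using q_pos ab by (intro nn_integral_has_integral_lebesgue') (auto intro: less_imp_le order_less_le_trans)
  qed
  have split: "\<phi> b = \<phi> a + integral {a..b} q" if ab: "0 < a" "a \<le> b" for a b
  proof -
    have "(\<integral>\<^sup>+ s\<in>{0<..b}. ennreal (q s) \<partial>lborel) = (\<integral>\<^sup>+ s. ennreal (q s) * indicator {0<..a} s + ennreal (q s) * indicator {a<..b} s \<partial>lborel)"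
      using ab by (intro nn_integral_cong) (auto simp: indicator_def)
    also have "\<dots> = (\<integral>\<^sup>+ s\<in>{0<..a}. ennreal (q s) \<partial>lborel) + (\<integral>\<^sup>+ s\<in>{a<..b}. ennreal (q s) \<partial>lborel)"
    proof (rule nn_integral_add)
      have "{0<..a} \<subseteq> {0<..}" "{a<..b} \<subseteq> {0<..}" using ab by auto
      then show "(\<lambda>s. ennreal (q s) * indicator {0<..a} s) \<in> borel_measurable lborel"
        "(\<lambda>s. ennreal (q s) * indicator {a<..b} s) \<in> borel_measurable lborel"
        using meas[of "{0<..a}"] meas[of "{a<..b}"] by simp_all
    qed
    also have "(\<integral>\<^sup>+ s\<in>{a<..b}. ennreal (q s) \<partial>lborel) = (\<integral>\<^sup>+ s\<in>{a..b}. ennreal (q s) \<partial>lborel)"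
    proof (rule nn_integral_cong_AE)
      have "AE s in lborel. s \<noteq> a" by (rule AE_lborel_singleton)
      then show "AE s in lborel. ennreal (q s) * indicator {a<..b} s = ennreal (q s) * indicator {a..b} s"
        by eventually_elim (auto simp: indicator_def)
    qed
    also have "\<dots> = ennreal (integral {a..b} q)" by (rule piece[OF ab])
    finally have "\<phi> b = enn2real ((\<integral>\<^sup>+ s\<in>{0<..a}. ennreal (q s) \<partial>lborel) + ennreal (integral {a..b} q))" by (simp add: \<phi>_def)
    also have "\<dots> = \<phi> a + integral {a..b} q"
    proof -
      have "0 \<le> integral {a..b} q" using q_pos ab by (intro integral_nonneg integrable_continuous_real continuous_on_subset[OF q_cont]) (auto intro: less_imp_le order_less_le_trans)
      then show ?thesis using fin'[OF ab(1)] by (subst enn2real_plus) (auto simp: \<phi>_def)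
    qed
    finally show ?thesis .
  qed
  have deriv: "(\<phi> has_real_derivative q t) (at t)" if t: "0 < t" for t
  proof -
    define a b where "a = t / 2" and "b = 2 * t"
    have ab: "0 < a" "a < t" "t < b" using t by (auto simp: a_def b_def)
    have "((\<lambda>x. integral {a..x} q) has_real_derivative q t) (at t within {a..b})"
      using ab by (intro integral_has_real_derivative continuous_on_subset[OF q_cont]) auto
    then have "((\<lambda>x. integral {a..x} q) has_real_derivative q t) (at t)"
      using ab by (simp add: at_within_Icc_at)
    then have "((\<lambda>x. \<phi> a + integral {a..x} q) has_real_derivative q t) (at t)"
      by (auto intro!: derivative_eq_intros)
    then show ?thesis
    proof (rule DERIV_cong_ev[THEN iffD1, OF refl _ refl, rotated])
      have "\<forall>\<^sub>F x in nhds t. x \<in> {a<..<b}" using ab by (intro eventually_nhds_in_open) auto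
      then show "\<forall>\<^sub>F x in nhds t. \<phi> a + integral {a..x} q = \<phi> x"
      proof eventually_elim
        case (elim x)
        then show ?case by (intro split[OF ab(1), symmetric]) simp
      qed
    qed
  qed
  have nonneg: "0 \<le> \<phi> t" for t by (simp add: \<phi>_def)
  have mono: "\<phi> a \<le> \<phi> b" if "0 < a" "a \<le> b" for a b
    unfolding \<phi>_def
  proof (rule enn2real_mono)
    show "(\<integral>\<^sup>+ s\<in>{0<..a}. ennreal (q s) \<partial>lborel) \<le> (\<integral>\<^sup>+ s\<in>{0<..b}. ennreal (q s) \<partial>lborel)"
      using that by (intro nn_integral_mono) (auto simp: indicator_def)
    show "(\<integral>\<^sup>+ s\<in>{0<..b}. ennreal (q s) \<partial>lborel) < top" using fin'[of b] that by simp
  qed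
  have "filterlim \<phi> at_top at_top"
    unfolding filterlim_at_top eventually_at_top_linorder
  proof
    fix Z :: real
    have "\<exists>n::nat. Z \<le> \<phi> (real n + 1)"
    proof (rule ccontr)
      assume "\<not> ?thesis"
      then have less: "\<phi> (real n + 1) < Z" for n :: nat by (simp add: not_le)
      have "(\<integral>\<^sup>+ s\<in>{1..}. ennreal (q s) \<partial>lborel) = (\<integral>\<^sup>+ s. (SUP n. ennreal (q s) * indicator {1..real n + 1} s) \<partial>lborel)"
      proof (intro nn_integral_cong)
        fix s :: real
        show "ennreal (q s) * indicator {1..} s = (SUP n. ennreal (q s) * indicator {1..real n + 1} s)"
        proof (rule antisym)
          obtain n :: nat where "s \<le> real n" using real_arch_simple by blast
          then have "ennreal (q s) * indicator {1..} s \<le> ennreal (q s) * indicator {1..real n + 1} s"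
            by (auto simp: indicator_def)
          also have "\<dots> \<le> (SUP n. ennreal (q s) * indicator {1..real n + 1} s)" by (rule SUP_upper) simp
          finally show "ennreal (q s) * indicator {1..} s \<le> (SUP n. ennreal (q s) * indicator {1..real n + 1} s)" .
          show "(SUP n. ennreal (q s) * indicator {1..real n + 1} s) \<le> ennreal (q s) * indicator {1..} s"
            by (rule SUP_least) (auto simp: indicator_def)
        qed
      qed
      also have "\<dots> = (SUP n. \<integral>\<^sup>+ s\<in>{1..real n + 1}. ennreal (q s) \<partial>lborel)"
      proof (rule nn_integral_monotone_convergence_SUP)
        show "incseq (\<lambda>n s. ennreal (q s) * indicator {1..real n + 1} s)"
          by (auto simp: incseq_def le_fun_def indicator_def)
        show "(\<lambda>s. ennreal (q s) * indicator {1..real n + 1} s) \<in> borel_measurable lborel" for n :: nat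
        proof -
          have "{1..real n + 1} \<subseteq> {0<..}" by auto
          then show ?thesis using meas[of "{1..real n + 1}"] by simp
        qed
      qed
      also have "\<dots> \<le> ennreal Z"
      proof (rule SUP_least)
        fix n :: nat
        have "(\<integral>\<^sup>+ s\<in>{1..real n + 1}. ennreal (q s) \<partial>lborel) = ennreal (\<phi> (real n + 1) - \<phi> 1)"
          using piece[of 1 "real n + 1"] split[of 1 "real n + 1"] by simp
        also have "\<dots> \<le> ennreal Z" using less[of n] nonneg[of 1] by (intro ennreal_leI) linarith
        finally show "(\<integral>\<^sup>+ s\<in>{1..real n + 1}. ennreal (q s) \<partial>lborel) \<le> ennreal Z" .
      qed
      finally show False using inf by (simp add: q_def top_unique)
    qed
    then obtain n :: nat where n: "Z \<le> \<phi> (real n + 1)" by blast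
    show "\<exists>N. \<forall>t\<ge>N. Z \<le> \<phi> t"
      using order_trans[OF n mono] by (intro exI[of _ "real n + 1"]) auto
  qed
  then show ?thesis using deriv nonneg by (intro that[of \<phi>]) (auto simp: q_def)
qed

section \<open>The characterisation\<close>

context dual_orlicz
begin

lemma curvature_solution_even_spread:
  assumes \<mu>: "finite_borel_on_sphere \<mu>" and K: "convex_body_o K" "origin_symmetric K" and \<tau>: "\<tau> < 0"
    and eq: "\<forall>E\<in>sets \<mu>. measure \<mu> E = \<tau> * dual_orlicz_curvature G \<psi> K E"
  shows "even_measure \<mu>" "not_concentrated_on_closed_hemisphere \<mu>"
proof -
  let ?S = "unit_sphere :: 'a set"
  have sets: "sets \<mu> = sets (restrict_space borel ?S)" and fin: "finite_measure \<mu>"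
    using \<mu> by (auto simp: finite_borel_on_sphere_def)
  have space: "space \<mu> = ?S" using sets_eq_imp_space_eq[OF sets] by (simp add: space_restrict_space)
  have borel: "E \<in> sets \<mu> \<longleftrightarrow> E \<in> sets borel \<and> E \<subseteq> ?S" for E
    unfolding sets by (subst sets_restrict_space_iff) auto
  show "even_measure \<mu>" unfolding even_measure_def
  proof
    fix E assume E: "E \<in> sets \<mu>"
    have img: "uminus ` E = uminus -` E" by (force simp: image_iff)
    have "uminus ` E \<in> sets \<mu>"
      using E measurable_sets[of uminus borel borel E] unfolding borel img by auto
    then show "measure \<mu> E = measure \<mu> (uminus ` E)"
      using eq E dual_orlicz_curvature_even[OF K(1) _ K(2)] borel by simp
  qed
  show "not_concentrated_on_closed_hemisphere \<mu>" unfolding not_concentrated_on_closed_hemisphere_def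
  proof
    fix v :: 'a assume v: "v \<in> ?S"
    let ?E = "{u \<in> ?S. 0 < u \<bullet> v}"
    let ?f = "\<lambda>u. max (u \<bullet> v) 0"
    have "continuous_on ?S ?f" by (intro continuous_intros)
    then have f_meas: "?f \<in> borel_measurable \<mu>"
      using borel_measurable_continuous_on_restrict measurable_cong_sets[OF sets refl] by blast
    have int: "integrable \<mu> ?f"
    proof (rule finite_measure.integrable_const_bound[OF fin _ f_meas])
      show "AE u in \<mu>. norm (?f u) \<le> 1"
      proof (rule AE_I2)
        fix u assume "u \<in> space \<mu>"
        then show "norm (?f u) \<le> 1" using norm_cauchy_schwarz[of u v] v by (simp add: space)
      qed
    qed
    have E: "?E \<in> sets \<mu>"
    proof -
      have "?E = ?S \<inter> {u. 0 < u \<bullet> v}" by blast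
      moreover have "open {u. 0 < u \<bullet> v}" by (intro open_Collect_less continuous_intros)
      ultimately show ?thesis unfolding borel by (metis borel_closed borel_open closed_sphere sets.Int Int_lower1)
    qed
    have nz: "measure \<mu> ?E \<noteq> 0"
      using eq E dual_orlicz_curvature_open_hemisphere_neg[OF K(1) v] \<tau> by auto
    have "(\<integral>u. ?f u \<partial>\<mu>) \<noteq> 0"
    proof
      assume "(\<integral>u. ?f u \<partial>\<mu>) = 0"
      then have "AE u in \<mu>. ?f u = 0"
        using integral_nonneg_eq_0_iff_AE[OF int] by simp
      then have "AE u in \<mu>. u \<notin> ?E" by eventually_elim auto
      then have "?E \<in> null_sets \<mu>" using AE_iff_null_sets[OF E] by blast
      then have "measure \<mu> ?E = 0" by (simp add: measure_eq_0_null_sets)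
      with nz show False by simp
    qed
    moreover have "0 \<le> (\<integral>u. ?f u \<partial>\<mu>)" by (intro Bochner_Integration.integral_nonneg) simp
    ultimately show "0 < (\<integral>u. ?f u \<partial>\<mu>)" by linarith
  qed
qed

end

theorem theorem7p2:
  fixes G :: "real \<Rightarrow> real ^ 'n \<Rightarrow> real"
    and \<psi> :: "real \<Rightarrow> real"
    and \<epsilon>\<^sub>0 :: real
    and \<mu> :: "(real ^ 'n) measure"
  assumes dim: "CARD('n) \<ge> 2"
    and G_pos: "\<forall>t>0. \<forall>u\<in>unit_sphere. G t u > 0"
    and G_cont: "continuous_on ({0<..} \<times> unit_sphere) (\<lambda>(t, u). G t u)"
    and G_diff: "\<forall>t>0. \<forall>u\<in>unit_sphere. (\<lambda>s. G s u) differentiable (at t)"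
    and Gt_cont: "continuous_on ({0<..} \<times> unit_sphere) (\<lambda>(t, u). partial_t G t u)"
    and Gt_neg: "\<forall>t>0. \<forall>u\<in>unit_sphere. partial_t G t u < 0"
    and Gt_even: "\<forall>t>0. \<forall>u\<in>unit_sphere. partial_t G t u = partial_t G t (- u)"
    and eps: "0 < \<epsilon>\<^sub>0" "\<epsilon>\<^sub>0 < 1"
    and G_lim: "\<forall>v\<in>unit_sphere.
       filterlim (\<lambda>t. LINT u : cap \<epsilon>\<^sub>0 v | sphere_measure. G t u) at_top (at_right 0)"
    and \<psi>_pos: "\<forall>t>0. \<psi> t > 0"
    and \<psi>_cont: "continuous_on {0<..} \<psi>"
    and \<psi>_inf: "(\<integral>\<^sup>+ s\<in>{1..}. ennreal (\<psi> s / s) \<partial>lborel) = \<infinity>"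
    and \<phi>_fin: "\<forall>t>0. (\<integral>\<^sup>+ s\<in>{0<..t}. ennreal (\<psi> s / s) \<partial>lborel) < \<infinity>"
    and \<mu>: "finite_borel_on_sphere \<mu>"
  shows "even_measure \<mu> \<and> not_concentrated_on_closed_hemisphere \<mu> \<longleftrightarrow>
    (\<exists>K \<tau>. convex_body_o K \<and> origin_symmetric K \<and> \<tau> < 0 \<and>
       (\<forall>E\<in>sets \<mu>. measure \<mu> E = \<tau> * dual_orlicz_curvature G \<psi> K E) \<and>
       \<tau> = measure \<mu> unit_sphere / dual_orlicz_curvature G \<psi> K unit_sphere)"
proof -
  let ?S = "unit_sphere :: (real ^ 'n) set"
  (* If the sphere were null, the integrals over the caps would vanish and could not blow up. *)
  have nonnull: "emeasure sphere_measure ?S \<noteq> 0"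
  proof
    assume zero: "emeasure sphere_measure ?S = 0"
    obtain v where v: "v \<in> ?S" using unit_sphere_nonempty by blast
    have ae: "AE u in (sphere_measure :: (real ^ 'n) measure). P u" for P
      using zero sets.top[of "sphere_measure :: (real ^ 'n) measure"] by (intro AE_I[where N="?S"]) auto
    have "(LINT u : cap \<epsilon>\<^sub>0 v | sphere_measure. G t u) = 0" for t
      unfolding set_lebesgue_integral_def by (rule integral_eq_zero_AE[OF ae])
    then have "filterlim (\<lambda>t. 0::real) at_top (at_right (0::real))"
      using bspec[OF G_lim v] by simp
    then have "\<forall>\<^sub>F t in at_right (0::real). 1 \<le> (0::real)" unfolding filterlim_at_top by blast
    then show False by (simp add: trivial_limit_at_right_real)
  qed
  obtain \<phi> where \<phi>: "\<forall>t>0. (\<phi> has_real_derivative \<psi> t / t) (at t)" "\<forall>t>0. 0 \<le> \<phi> t" "filterlim \<phi> at_top at_top"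
    by (rule orlicz_primitive[OF \<psi>_pos \<psi>_cont \<psi>_inf \<phi>_fin])
  interpret dual_orlicz G \<psi>
  proof
    fix t :: real and u :: "real ^ 'n"
    assume tu: "0 < t" "u \<in> ?S"
    show "0 < G t u" using G_pos tu by blast
    show "(\<lambda>s. G s u) differentiable (at t)" using G_diff tu by blast
    show "partial_t G t u < 0" using Gt_neg tu by blast
    show "partial_t G t (- u) = partial_t G t u" by (rule Gt_even[rule_format, OF tu, symmetric])
  next
    fix t :: real assume "0 < t"
    then show "0 < \<psi> t" using \<psi>_pos by blast
  qed (fact G_cont Gt_cont nonnull \<psi>_cont)+
  show ?thesis
  proof
    assume i: "even_measure \<mu> \<and> not_concentrated_on_closed_hemisphere \<mu>"
    interpret dual_orlicz_minimization G \<psi> \<phi> \<mu> \<epsilon>\<^sub>0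
    proof
      fix t :: real assume t: "0 < t"
      show "(\<phi> has_real_derivative \<psi> t / t) (at t)" using \<phi>(1) t by blast
      show "0 \<le> \<phi> t" using \<phi>(2) t by blast
    next
      fix v assume "v \<in> ?S"
      then show "filterlim (\<lambda>t. LINT u : cap \<epsilon>\<^sub>0 v | sphere_measure. G t u) at_top (at_right 0)"
        using G_lim by blast
    qed (fact \<phi>(3) \<mu> conjunct2[OF i] eps(1))+
    obtain c K where min: "minimal_body c K" using minimal_body_exists by blast
    obtain \<tau> where \<tau>: "\<tau> < 0" "\<forall>E\<in>sets \<mu>. measure \<mu> E = \<tau> * dual_orlicz_curvature G \<psi> K E"
      using minimal_body_curvature[OF min conjunct1[OF i]] by blast
    have "?S \<in> sets \<mu>" using sets.top[of \<mu>] by simp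
    then have "measure \<mu> ?S = \<tau> * dual_orlicz_curvature G \<psi> K ?S" using \<tau>(2) by blast
    then have "\<tau> = measure \<mu> ?S / dual_orlicz_curvature G \<psi> K ?S"
      using \<mu>_nonzero by auto
    then show "\<exists>K \<tau>. convex_body_o K \<and> origin_symmetric K \<and> \<tau> < 0 \<and>
       (\<forall>E\<in>sets \<mu>. measure \<mu> E = \<tau> * dual_orlicz_curvature G \<psi> K E) \<and>
       \<tau> = measure \<mu> unit_sphere / dual_orlicz_curvature G \<psi> K unit_sphere"
      using min \<tau> unfolding minimal_body_def by blast
  next
    assume "\<exists>K \<tau>. convex_body_o K \<and> origin_symmetric K \<and> \<tau> < 0 \<and>
       (\<forall>E\<in>sets \<mu>. measure \<mu> E = \<tau> * dual_orlicz_curvature G \<psi> K E) \<and>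
       \<tau> = measure \<mu> unit_sphere / dual_orlicz_curvature G \<psi> K unit_sphere"
    then show "even_measure \<mu> \<and> not_concentrated_on_closed_hemisphere \<mu>"
      using curvature_solution_even_spread[OF \<mu>] by blast
  qed
qed

end
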